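(* Consider the circle $\mathbb{S}^1$. (1) For $-1\le s<1$, $s\neq0$, as $N\to\infty$, $$\mathcal{P}_{K_s}(N)=\mathcal{I}_{s,1}N+\frac{2\operatorname{sgn}(s)(2^s-1)}{(2\pi)^s}\zeta(s)N^s+\mathcal{O}(N^{s-2}).$$ (2) For $s=0$ and every $N\in\mathbb{N}$, $\mathcal{P}_{K_0}(N)=-\log(2)$. (3) For $-2<s<-1$ there are constants $b_{s,1},c_{s,1}\in\mathbb{R}_{>0}$ such that for all sufficiently large $N$, $$\mathcal{I}_{s,1}N-b_{s,1}N^s\le\mathcal{P}_{K_s}(N)\le\mathcal{I}_{s,1}N-c_{s,1}N^s.$$
   Context: $\mathbb{S}^1\subset\mathbb{R}^2$ is the unit circle with Euclidean norm $\|\cdot\|$, and $\sigma_1$ is the normalized arc-length (probability) measure. The Riesz $s$-kernel is $K_s(x,y)=\operatorname{sgn}(s)\|x-y\|^{-s}$ for $s\ne0$ and $K_0(x,y)=-\log\|x-y\|$ (with value $+\infty$ at $x=y$ when $s\ge0$). For $N$ points $\omega_N=\{x_1,\dots,x_N\}\subset\mathbb{S}^1$ (repetitions allowed), $P_{K}(\omega_N)=\min_{x\in\mathbb{S}^1}\sum_{j=1}^N K(x,x_j)$, and $\mathcal{P}_K(N)=\max_{\omega_N\subset\mathbb{S}^1}P_K(\omega_N)$. Also $\mathcal{I}_{s,1}=\int_{\mathbb{S}^1}\int_{\mathbb{S}^1}K_s(x,y)\,d\sigma_1(x)\,d\sigma_1(y)$, and $\zeta$ is the (analytically continued) Riemann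 zeta function. Implied constants may depend on $s$. *)

theory Defs
  imports "HOL-Complex_Analysis.Complex_Analysis" "HOL-Library.Landau_Symbols"
begin

abbreviation S1 :: "(real ^ 2) set" where
  "S1 \<equiv> sphere 0 1"

definition sigma1 :: "(real ^ 2) measure" where
  "sigma1 = distr (uniform_measure lborel {0..2*pi}) borel (\<lambda>t. vector [cos t, sin t])"

text \<open>For \<open>s < 0\<close> the value on the diagonal is \<open>- (0 powr (- s)) = 0\<close>.\<close>

definition riesz_kernel :: "real \<Rightarrow> real ^ 2 \<Rightarrow> real ^ 2 \<Rightarrow> ereal" where
  "riesz_kernel s x y =
     (if x = y \<and> s \<ge> 0 then \<infinity>
      else if s = 0 then ereal (- ln (norm (x - y)))
      else ereal (sgn s * norm (x - y) powr (- s)))"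

text \<open>A configuration of \<open>N\<close> points, repetitions allowed, is a map on \<open>{1..N}\<close>. Since
  \<open>LEAST\<close> and \<open>GREATEST\<close> range over the values of the respective function, they denote an
  attained minimum and an attained maximum.\<close>

definition polarization ::
    "(real ^ 2 \<Rightarrow> real ^ 2 \<Rightarrow> ereal) \<Rightarrow> nat \<Rightarrow> (nat \<Rightarrow> real ^ 2) \<Rightarrow> ereal" where
  "polarization K N \<omega> = (LEAST v. v \<in> (\<lambda>x. \<Sum>j=1..N. K x (\<omega> j)) ` S1)"

definition max_polarization :: "(real ^ 2 \<Rightarrow> real ^ 2 \<Rightarrow> ereal) \<Rightarrow> nat \<Rightarrow> ereal" where
  "max_polarization K N = (GREATEST v. v \<in> polarization K N ` ({1..N} \<rightarrow> S1))"

text \<open>\<open>real_of_ereal\<close> changes the kernel only on the diagonal, where it takes the value \<open>0\<close>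
  instead of \<open>\<infinity>\<close> for \<open>s \<ge> 0\<close>. For each \<open>x\<close> this concerns a single point,
  which is a null set of \<open>sigma1\<close>.\<close>

definition riesz_energy :: "real \<Rightarrow> real" where
  "riesz_energy s = (LINT x|sigma1. LINT y|sigma1. real_of_ereal (riesz_kernel s x y))"

text \<open>The analytic continuation of the Dirichlet series to the plane without \<open>1\<close> is unique by
  the identity theorem, so the choice below only affects the value at \<open>1\<close>.\<close>

definition riemann_zeta :: "complex \<Rightarrow> complex" where
  "riemann_zeta =
     (SOME f. f holomorphic_on (- {1}) \<and>
        (\<forall>z. Re z > 1 \<longrightarrow> (\<lambda>n. 1 / of_nat (Suc n) powr z) sums f z))"

end

theory Submission imports Defs begin

text \<open>
  For \<open>s \<ge> -1\<close> the kernel is a convex function of the angle in \<open>(0, 2\<pi>)\<close>. By a cycle-lemma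
  argument every configuration has a point \<open>x\<close> from which its sorted angles are majorized by
  \<open>(2j+1)\<pi>/N\<close>; Karamata's inequality then shows that equally spaced points are optimal, with the
  minimum attained at the midpoints. The value is thus a midpoint sum of \<open>(2 sin(\<theta>/2))\<^sup>-\<^sup>s\<close>,
  whose expansion follows from a fourth order midpoint rule after subtracting the endpoint
  singularities \<open>\<theta>\<^sup>-\<^sup>s\<close> and \<open>(2\<pi>-\<theta>)\<^sup>-\<^sup>s\<close>; their midpoint sums contribute the constant
  \<open>\<zeta>(s, 1/2) = (2\<^sup>s - 1) \<zeta>(s)\<close>, identified by analytic continuation from \<open>Re s > 1\<close>.
  For \<open>s = 0\<close> the value is read off \<open>z\<^sup>N + 1\<close> at \<open>z = 1\<close>.

  For \<open>-2 < s < -1\<close> convexity fails, but \<open>(D\<^sup>2 + s\<^sup>2/4)\<close> of \<open>(2 sin(\<theta>/2))\<^sup>-\<^sup>s\<close> is a positive multiple of the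
  convex kernel of exponent \<open>s + 2\<close>. Hence the potential cannot be
  nearly constant on a gap of length \<open>L\<close>: it deviates from its maximum by order \<open>L\<^sup>-\<^sup>s\<close>.
  Integrating and summing over the gaps of an arbitrary configuration gives the upper bound;
  equally spaced points give the lower bound.
\<close>

section \<open>Analytic continuation of the zeta function\<close>

text \<open>An error of order \<open>N powr (s - 2)\<close> calls for a fourth order rule, so the
  midpoint sum is corrected by first derivatives at the ends, and the corrections telescope. The
  function families start with a primitive at index 0; member 5 is then the fourth derivative that
  controls the error. After removal of the singular parts it contributes terms of order
  \<open>j powr (- s - 2)\<close>, not summable at \<open>s = -1\<close>. Their coefficient contains
  \<open>s + 1\<close>, and the estimates carry this factor in order to include that boundary case.
  Below \<open>-1\<close> an operator that tests the potential on a gap has to annihilate constants,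
  because only the deficit from the unknown extremal value has a sign, and
  \<open>D^2 + s^2/4\<close> does not do so. It is therefore composed, in discrete form, with a
  second difference. The resulting five point combination has nonnegative weights at the centre and
  the outer points and negative ones at the two inner points, so the sign of the deficit turns it
  into a lower bound at the inner points.\<close>

lemma suminf_holomorphic_on:
  fixes g :: "nat \<Rightarrow> complex \<Rightarrow> complex"
  assumes A: "open A" and hol: "\<And>n. g n holomorphic_on A"
    and bound: "\<And>z. z \<in> A \<Longrightarrow> \<exists>d>0. cball z d \<subseteq> A \<and>
          (\<exists>M. summable M \<and> (\<forall>n. \<forall>w\<in>cball z d. norm (g n w) \<le> M n))"
  shows "(\<lambda>z. \<Sum>n. g n z) holomorphic_on A"
proof (rule holomorphic_uniform_sequence[OF A])
  show "(\<lambda>z. \<Sum>k<n. g k z) holomorphic_on A" for n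
    by (intro holomorphic_on_sum hol)
  fix z assume "z \<in> A"
  then obtain d M where d: "d > 0" "cball z d \<subseteq> A"
    and M: "summable M" "\<And>n w. w \<in> cball z d \<Longrightarrow> norm (g n w) \<le> M n"
    using bound by metis
  have "uniform_limit (cball z d) (\<lambda>n x. \<Sum>k<n. g k x) (\<lambda>x. suminf (\<lambda>k. g k x)) sequentially"
    by (rule Weierstrass_m_test[OF _ M(1)]) (use M(2) in auto)
  then show "\<exists>d>0. cball z d \<subseteq> A \<and>
      uniform_limit (cball z d) (\<lambda>n z. \<Sum>k<n. g k z) (\<lambda>z. \<Sum>n. g n z) sequentially"
    using d by blast
qed

text \<open>The coefficient of the \<open>i\<close>-th derivative of \<open>z powr (1 - s)\<close>.
  The exponent is \<open>1 - s\<close> rather than \<open>- s\<close> because it is the primitive of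
  \<open>z powr (- s)\<close>, up to the factor \<open>1 - s\<close>, that telescopes.\<close>

definition ffact1 :: "complex \<Rightarrow> nat \<Rightarrow> complex" where
  "ffact1 s i = (\<Prod>k<i. 1 - s - of_nat k)"

lemma ffact1_simps [simp]: "ffact1 s 0 = 1" "ffact1 s (Suc i) = ffact1 s i * (1 - s - of_nat i)"
  by (simp_all add: ffact1_def)

lemma norm_ffact1_le:
  assumes "norm s \<le> r" shows "norm (ffact1 s i) \<le> (\<Prod>k<i. 1 + r + real k)"
proof -
  have "norm (1 - s - of_nat k) \<le> 1 + r + real k" for k
    using norm_triangle_ineq4[of "1 - s" "of_nat k"] norm_triangle_ineq4[of 1 s] assms by simp
  then show ?thesis
    unfolding ffact1_def prod_norm[symmetric] by (intro prod_mono) auto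
qed

lemma holomorphic_ffact1 [holomorphic_intros]:
  "f holomorphic_on A \<Longrightarrow> (\<lambda>z. ffact1 (f z) i) holomorphic_on A"
  unfolding ffact1_def by (intro holomorphic_intros)

lemma powr_has_field_derivative_ffact1:
  assumes "z \<notin> \<real>\<^sub>\<le>\<^sub>0"
  shows "((\<lambda>z. ffact1 s i * z powr (1 - s - of_nat i)) has_field_derivative
           ffact1 s (Suc i) * z powr (1 - s - of_nat (Suc i))) (at z within S)"
proof (rule has_field_derivative_at_within)
  show "((\<lambda>z. ffact1 s i * z powr (1 - s - of_nat i)) has_field_derivative
           ffact1 s (Suc i) * z powr (1 - s - of_nat (Suc i))) (at z)"
    using assms by (auto intro!: derivative_eq_intros simp: algebra_simps)
qed

lemma real_segment_bounds:
  fixes a b :: real and z :: complex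
  assumes "z \<in> closed_segment (of_real a) (of_real b)" "a \<le> b"
  shows "\<exists>x. z = of_real x \<and> a \<le> x \<and> x \<le> b"
proof -
  have "z \<in> of_real ` closed_segment a b"
    using assms(1) by (simp add: closed_segment_of_real)
  then show ?thesis
    using assms(2) by (auto simp: closed_segment_eq_real_ivl)
qed

text \<open>Taylor's theorem on a real segment. The condition on \<open>Re s\<close> makes the
  exponent in the remainder nonpositive, so the left end \<open>a\<close> gives the largest
  modulus.\<close>

lemma powr_Taylor_bound:
  assumes "a > 0" "a \<le> w" "w \<le> b" "a \<le> z" "z \<le> b" and "Re s + of_nat m \<ge> 0" "m = j + n"
  shows "norm (ffact1 s j * of_real z powr (1 - s - of_nat j)
      - (\<Sum>i\<le>n. ffact1 s (j + i) * of_real w powr (1 - s - of_nat (j + i)) * of_real (z - w) ^ i / fact i))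
    \<le> norm (ffact1 s (j + Suc n)) * a powr (- Re s - of_nat m) * \<bar>z - w\<bar> ^ Suc n"
proof -
  define S where "S = closed_segment (of_real a :: complex) (of_real b)"
  have S: "\<exists>x. z = of_real x \<and> a \<le> x \<and> x \<le> b" if "z \<in> S" for z
    using real_segment_bounds that assms(2,3) unfolding S_def by fastforce
  have inS: "of_real x \<in> S" if "a \<le> x" "x \<le> b" for x
    using that unfolding S_def closed_segment_of_real by (auto simp: closed_segment_eq_real_ivl)
  define f where "f = (\<lambda>i z. ffact1 s (j + i) * z powr (1 - s - of_nat (j + i)))"
  have "norm (f 0 (of_real z) - (\<Sum>i\<le>n. f i (of_real w) * (of_real z - of_real w) ^ i / fact i))
     \<le> norm (ffact1 s (j + Suc n)) * a powr (- Re s - of_nat m) *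
        norm (of_real z - of_real w :: complex) ^ Suc n / fact n"
  proof (rule field_Taylor)
    show "convex S" by (simp add: S_def)
    show "of_real w \<in> S" "of_real z \<in> S" using assms inS by auto
    show "(f i has_field_derivative f (Suc i) x) (at x within S)" if "x \<in> S" for i x
    proof -
      have "x \<notin> \<real>\<^sub>\<le>\<^sub>0"
        using S[OF that] assms(1) by auto
      from powr_has_field_derivative_ffact1[OF this, of s "j + i" S] show ?thesis
        by (simp add: f_def del: ffact1_simps)
    qed
    show "norm (f (Suc n) x) \<le> norm (ffact1 s (j + Suc n)) * a powr (- Re s - of_nat m)" if "x \<in> S" for x
    proof -
      obtain y where y: "x = of_real y" "a \<le> y" using S[OF \<open>x \<in> S\<close>] by auto
      have "norm (x powr (1 - s - of_nat (j + Suc n))) = y powr (- Re s - of_nat m)"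
        using y assms(1) \<open>m = j + n\<close> norm_powr_real_powr[of "of_real y" "1 - s - of_nat (j + Suc n)"]
        by (simp add: algebra_simps)
      also have "\<dots> \<le> a powr (- Re s - of_nat m)"
        using y assms by (intro powr_mono2') auto
      finally show ?thesis
        by (simp add: f_def norm_mult mult_left_mono del: ffact1_simps)
    qed
  qed
  also have "\<dots> \<le> norm (ffact1 s (j + Suc n)) * a powr (- Re s - of_nat m) * \<bar>z - w\<bar> ^ Suc n"
  proof -
    have "norm (of_real z - of_real w :: complex) = \<bar>z - w\<bar>"
      by (metis norm_of_real of_real_diff)
    moreover have "x / fact n \<le> x" if "x \<ge> 0" for x :: real
      using that by (simp add: divide_le_eq mult_le_cancel_left1 fact_ge_1 mult_right_mono)
    ultimately show ?thesis by (metis (no_types, lifting) abs_ge_zero mult_nonneg_nonneg norm_ge_zero powr_ge_zero zero_le_power)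
  qed
  finally show ?thesis by (simp add: f_def del: ffact1_simps)
qed


text \<open>The majorant is asked for where \<open>Re w \<ge> b\<close> and
  \<open>norm w \<le> r\<close>: the modulus of a power of \<open>n\<close> depends on the real part
  of the exponent, that of its polynomial coefficient is bounded through the norm.\<close>

lemma suminf_holomorphic_on_halfplane:
  fixes g :: "nat \<Rightarrow> complex \<Rightarrow> complex"
  assumes hol: "\<And>n. g n holomorphic_on {z. Re z > a}"
    and bound: "\<And>b r. b > a \<Longrightarrow> r \<ge> 0 \<Longrightarrow>
          \<exists>M. summable M \<and> (\<forall>n w. Re w \<ge> b \<longrightarrow> norm w \<le> r \<longrightarrow> norm (g n w) \<le> M n)"
  shows "(\<lambda>z. \<Sum>n. g n z) holomorphic_on {z. Re z > a}"
proof (rule suminf_holomorphic_on)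
  show "open {z. Re z > a}" by (rule open_halfspace_Re_gt)
  show "g n holomorphic_on {z. Re z > a}" for n by (rule hol)
  fix z assume "z \<in> {z. Re z > a}"
  then have z: "Re z > a" by simp
  define d where "d = (Re z - a) / 2"
  have d: "d > 0" "Re z - d > a" using z by (auto simp: d_def field_simps)
  obtain M where M: "summable M" "\<And>n w. Re w \<ge> Re z - d \<Longrightarrow> norm w \<le> norm z + d \<Longrightarrow> norm (g n w) \<le> M n"
    using bound[OF d(2), of "norm z + d"] d by (metis add_nonneg_nonneg less_eq_real_def norm_ge_zero)
  have w: "Re w \<ge> Re z - d \<and> norm w \<le> norm z + d" if "w \<in> cball z d" for w
  proof -
    have "norm (w - z) \<le> d" using that by (simp add: dist_norm norm_minus_commute)
    then show ?thesis
      using abs_Re_le_cmod[of "w - z"] norm_triangle_sub[of w z] by auto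
  qed
  have "cball z d \<subseteq> {z. Re z > a}" using w d(2) by force
  then show "\<exists>d>0. cball z d \<subseteq> {z. Re z > a} \<and>
          (\<exists>M. summable M \<and> (\<forall>n. \<forall>w\<in>cball z d. norm (g n w) \<le> M n))"
    using d(1) M w by blast
qed

section \<open>The Dirichlet series and its continuation by Taylor expansion\<close>

definition zeta_series :: "complex \<Rightarrow> complex" where
  "zeta_series z = (\<Sum>n. 1 / of_nat (Suc n) powr z)"

lemma norm_of_nat_Suc_powr: "norm (of_nat (Suc n) powr z) = real (Suc n) powr Re z"
  using norm_powr_real_powr[of "of_nat (Suc n)" z] by simp

lemma summable_Suc_powr: "summable (\<lambda>n. real (Suc n) powr a)" if "a < -1"
  using that by (subst summable_Suc_iff) (simp add: summable_real_powr_iff)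

lemma summable_zeta_series:
  assumes "Re z > 1"
  shows "summable (\<lambda>n. 1 / of_nat (Suc n) powr z)"
proof (rule summable_comparison_test[OF _ summable_Suc_powr])
  show "\<exists>N. \<forall>n\<ge>N. norm (1 / of_nat (Suc n) powr z) \<le> real (Suc n) powr (- Re z)"
    by (simp only: norm_divide norm_of_nat_Suc_powr) (auto simp: powr_minus divide_simps)
qed (use assms in auto)

lemma holomorphic_zeta_series: "zeta_series holomorphic_on {z. Re z > 1}"
  unfolding zeta_series_def
proof (rule suminf_holomorphic_on_halfplane)
  show "(\<lambda>z. 1 / of_nat (Suc n) powr z) holomorphic_on {z. Re z > 1}" for n
    by (intro holomorphic_intros) auto
  fix b r :: real assume "b > 1"
  have "norm (1 / of_nat (Suc n) powr w) \<le> real (Suc n) powr (- b)" if "Re w \<ge> b" for n and w :: complex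
  proof -
    have "norm (1 / of_nat (Suc n) powr w) = real (Suc n) powr (- Re w)"
      by (simp only: norm_divide norm_of_nat_Suc_powr) (auto simp: powr_minus divide_simps)
    also have "\<dots> \<le> real (Suc n) powr (- b)" using that by (intro powr_mono) auto
    finally show ?thesis .
  qed
  then show "\<exists>M. summable M \<and> (\<forall>n w. Re w \<ge> b \<longrightarrow> norm w \<le> r \<longrightarrow> norm (1 / of_nat (Suc n) powr w) \<le> M n)"
    using summable_Suc_powr[of "-b"] \<open>b > 1\<close> by (intro exI[of _ "\<lambda>n. real (Suc n) powr (- b)"]) auto
qed

text \<open>Taylor remainder of degree \<open>m\<close> for the step from \<open>Suc n\<close> to
  \<open>Suc (Suc n)\<close>. Being of order \<open>n powr (- Re s - m)\<close>, it is summable for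
  \<open>Re s > 1 - m\<close>, hence ever further to the left as \<open>m\<close> grows.\<close>

definition powr_remainder :: "nat \<Rightarrow> complex \<Rightarrow> nat \<Rightarrow> complex" where
  "powr_remainder m s n = of_nat (Suc (Suc n)) powr (1 - s) -
     (\<Sum>i\<le>m. ffact1 s i * of_nat (Suc n) powr (1 - s - of_nat i) / fact i)"

lemma norm_powr_remainder_le:
  assumes "Re s + real m \<ge> 0"
  shows "norm (powr_remainder m s n) \<le> norm (ffact1 s (Suc m)) * real (Suc n) powr (- Re s - real m)"
  using powr_Taylor_bound[of "real (Suc n)" "real (Suc n)" "real (Suc (Suc n))" "real (Suc (Suc n))" s m 0 m] assms
  by (simp add: powr_remainder_def mult.assoc del: ffact1_simps(2))

lemma holomorphic_powr_remainder: "(\<lambda>s. powr_remainder m s n) holomorphic_on A"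
  unfolding powr_remainder_def by (intro holomorphic_intros) (auto simp del: of_nat_Suc)

lemma powr_remainder_bound:
  assumes "b + real m > 1"
  shows "\<exists>M. summable M \<and> (\<forall>n w. Re w \<ge> b \<longrightarrow> norm w \<le> r \<longrightarrow> norm (powr_remainder m w n) \<le> M n)"
proof (intro exI conjI allI impI)
  let ?M = "\<lambda>n. (\<Prod>k<Suc m. 1 + r + real k) * real (Suc n) powr (- b - real m)"
  show "summable ?M" by (intro summable_mult summable_Suc_powr) (use assms in auto)
  fix n and w :: complex assume w: "Re w \<ge> b" "norm w \<le> r"
  then have r: "r \<ge> 0" using norm_ge_zero order_trans by blast
  then have "norm (powr_remainder m w n) \<le> norm (ffact1 w (Suc m)) * real (Suc n) powr (- Re w - real m)"
    using assms w by (intro norm_powr_remainder_le) auto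
  also have "\<dots> \<le> ?M n"
    using w by (intro mult_mono norm_ffact1_le powr_mono prod_nonneg) (use r in auto)
  finally show "norm (powr_remainder m w n) \<le> ?M n" .
qed

lemma Suc_powr_tendsto_0:
  assumes "Re z < 0" shows "(\<lambda>n. of_nat (Suc n) powr z :: complex) \<longlonglongrightarrow> 0"
proof (rule Lim_null_comparison)
  show "\<forall>\<^sub>F n in sequentially. norm (of_nat (Suc n) powr z) \<le> real (Suc n) powr Re z"
    by (simp only: norm_of_nat_Suc_powr) auto
  have "filterlim (\<lambda>n. real (Suc n)) at_top sequentially"
    using filterlim_real_sequentially filterlim_sequentially_Suc by blast
  then show "(\<lambda>n. real (Suc n) powr Re z) \<longlonglongrightarrow> 0"
    by (rule tendsto_neg_powr[OF assms])
qed

lemma Suc_powr_telescope: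
  assumes "Re z < 0"
  shows "(\<lambda>n. of_nat (Suc (Suc n)) powr z - of_nat (Suc n) powr z :: complex) sums (-1)"
  using telescope_sums[OF Suc_powr_tendsto_0[OF assms]] by simp

text \<open>The parts of degree 0 telescope to -1, those of degree \<open>k\<close> sum to multiples
  of \<open>zeta_series (s + k - 1)\<close>. For \<open>k = 1\<close> this is
  \<open>(1 - s) * zeta_series s\<close>, the quantity to be continued.\<close>

lemma powr_remainder_sums:
  assumes "Re s > 1" "m \<ge> 1"
  shows "powr_remainder m s sums (-1 - (\<Sum>k=1..m. ffact1 s k / fact k * zeta_series (s + of_nat k - 1)))"
proof -
  have 1: "(\<lambda>n. \<Sum>k=1..m. ffact1 s k / fact k * (1 / of_nat (Suc n) powr (s + of_nat k - 1))) sums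
     (\<Sum>k=1..m. ffact1 s k / fact k * zeta_series (s + of_nat k - 1))"
    unfolding zeta_series_def using assms
    by (intro sums_sum sums_mult summable_sums summable_zeta_series) auto
  have 2: "powr_remainder m s n = (of_nat (Suc (Suc n)) powr (1 - s) - of_nat (Suc n) powr (1 - s)) -
     (\<Sum>k=1..m. ffact1 s k / fact k * (1 / of_nat (Suc n) powr (s + of_nat k - 1)))" for n
  proof -
    have "{..m} = insert 0 {1..m}" by auto
    moreover have "ffact1 s k * of_nat (Suc n) powr (1 - s - of_nat k) / fact k =
        ffact1 s k / fact k * (1 / of_nat (Suc n) powr (s + of_nat k - 1))" for k
      using powr_minus_divide[of "of_nat (Suc n)" "s + of_nat k - 1"] by (simp add: algebra_simps)
    ultimately show ?thesis
      unfolding powr_remainder_def using powr_minus_divide[of "of_nat (Suc n)" "s - 1"]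
      by (simp only:) (simp del: of_nat_Suc)
  qed
  show ?thesis
    unfolding 2 using assms by (intro sums_diff Suc_powr_telescope 1) auto
qed

text \<open>One step of the continuation: expanding \<open>(n + 1)\<^sup>1\<^sup>-\<^sup>s\<close> about \<open>n\<close> and summing over \<open>n\<close>
  expresses \<open>(s - 1) \<zeta>(s)\<close> through the values at \<open>s + 1, s + 2, \<dots>\<close>.\<close>

lemma zeta_strip_continuation:
  "\<exists>F. F holomorphic_on {z. Re z > 1 - real m} \<and> (\<forall>z. Re z > 1 \<longrightarrow> F z = (z - 1) * zeta_series z)"
proof (induction m)
  case 0
  show ?case
    by (rule exI[of _ "\<lambda>z. (z - 1) * zeta_series z"]) (auto intro!: holomorphic_intros holomorphic_zeta_series)
next
  case (Suc m)
  then obtain F where F: "F holomorphic_on {z. Re z > 1 - real m}"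
    and eq: "\<And>z. Re z > 1 \<Longrightarrow> F z = (z - 1) * zeta_series z" by blast
  define M where "M = m + 2"
  \<comment> \<open>The identity of \<open>powr_remainder_sums\<close> solved for
    \<open>(s - 1) * zeta_series s\<close>. The last factor of \<open>ffact1 s k\<close> is
    \<open>- ((s + k - 1) - 1)\<close>, which turns \<open>zeta_series (s + k - 1)\<close> into
    \<open>- F (s + k - 1)\<close>, so no pole is met.\<close>
  define G where "G = (\<lambda>s. 1 + (\<Sum>n. powr_remainder M s n) -
     (\<Sum>k=2..M. ffact1 s (k - 1) / fact k * F (s + of_nat k - 1)))"
  have "(\<lambda>s. \<Sum>n. powr_remainder M s n) holomorphic_on {z. Re z > - real m}"
    by (rule suminf_holomorphic_on_halfplane)
      (auto intro!: holomorphic_powr_remainder powr_remainder_bound simp: M_def)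
  moreover have "(\<lambda>s. F (s + of_nat k - 1)) holomorphic_on {z. Re z > - real m}" if "k \<ge> 2" for k
  proof -
    have "F \<circ> (\<lambda>s. s + of_nat k - 1) holomorphic_on {z. Re z > - real m}"
      by (rule holomorphic_on_compose_gen[OF _ F]) (use that in \<open>auto intro!: holomorphic_intros\<close>)
    then show ?thesis by (simp add: o_def)
  qed
  ultimately have "G holomorphic_on {z. Re z > - real m}"
    unfolding G_def by (intro holomorphic_intros) auto
  moreover have "G s = (s - 1) * zeta_series s" if s: "Re s > 1" for s
  proof -
    have sum: "(\<Sum>n. powr_remainder M s n) = -1 - (\<Sum>k=1..M. ffact1 s k / fact k * zeta_series (s + of_nat k - 1))"
      using powr_remainder_sums[OF s, of M] by (simp add: sums_iff M_def)
    have "{1..M} = insert 1 {2..M}" by (auto simp: M_def)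
    then have sp: "(\<Sum>k=1..M. ffact1 s k / fact k * zeta_series (s + of_nat k - 1)) =
       (1 - s) * zeta_series s + (\<Sum>k=2..M. ffact1 s k / fact k * zeta_series (s + of_nat k - 1))"
      by simp
    have "ffact1 s (k - 1) / fact k * F (s + of_nat k - 1) =
       - (ffact1 s k / fact k * zeta_series (s + of_nat k - 1))" if k2: "k \<in> {2..M}" for k
    proof -
      obtain l where k: "k = Suc l" using k2 by (cases k) auto
      have "F (s + of_nat k - 1) = (s + of_nat l - 1) * zeta_series (s + of_nat k - 1)"
        using s k2 by (subst eq) (auto simp: k)
      also have "s + of_nat l - 1 = - (1 - s - of_nat l)" by simp
      finally have "F (s + of_nat k - 1) = - (1 - s - of_nat l) * zeta_series (s + of_nat k - 1)" .
      then show ?thesis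
        by (simp only: k diff_Suc_1 ffact1_simps mult_minus_left mult_minus_right minus_divide_left
            times_divide_eq_left times_divide_eq_right mult.assoc)
    qed
    then have "(\<Sum>k=2..M. ffact1 s (k - 1) / fact k * F (s + of_nat k - 1)) =
        - (\<Sum>k=2..M. ffact1 s k / fact k * zeta_series (s + of_nat k - 1))"
      by (simp add: sum_negf)
    then show ?thesis unfolding G_def sum sp by (simp add: algebra_simps)
  qed
  ultimately show ?case by (intro exI[of _ G]) auto
qed

lemma holomorphic_eq_on_halfplane:
  assumes "f holomorphic_on {z. Re z > a}" "g holomorphic_on {z. Re z > a}"
    and "\<And>z. Re z > b \<Longrightarrow> f z = g z" and "Re z > a"
  shows "f z = g z"
proof (cases "a < b")
  case True
  show ?thesis
  proof (rule analytic_continuation_open[where f = f and g = g])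
    show "open {z. Re z > b}" "open {z. Re z > a}" by (auto intro: open_halfspace_Re_gt)
    show "f holomorphic_on {z. Re z > a}" "g holomorphic_on {z. Re z > a}" by fact+
    show "f z = g z" if "z \<in> {z. Re z > b}" for z using that assms(3) by simp
    show "{z. Re z > b} \<noteq> {}" by (auto intro!: exI[of _ "of_real (b + 1)"])
    show "connected {z. Re z > a}" by (intro convex_connected convex_halfspace_Re_gt)
  qed (use assms True in auto)
qed (use assms in auto)

text \<open>Supplies the witness for the choice that defines \<open>riemann_zeta\<close>. The
  continuations to half-planes agree where both are defined and glue to an entire version of
  \<open>(z - 1) * zeta\<close>; division by \<open>z - 1\<close> costs only the point 1.\<close>

lemma riemann_zeta_exists:
  "\<exists>f. f holomorphic_on (- {1}) \<and> (\<forall>z. Re z > 1 \<longrightarrow> (\<lambda>n. 1 / of_nat (Suc n) powr z) sums f z)"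
proof -
  obtain F where F: "\<And>m. F m holomorphic_on {z. Re z > 1 - real m}"
    and eq: "\<And>m z. Re z > 1 \<Longrightarrow> F m z = (z - 1) * zeta_series z"
    using zeta_strip_continuation by metis
  have Feq: "F m z = F n z" if "Re z > 1 - real m" "m \<le> n" for m n z
  proof (rule holomorphic_eq_on_halfplane[of "F m" "1 - real m" "F n" 1])
    show "F n holomorphic_on {z. Re z > 1 - real m}"
      by (rule holomorphic_on_subset[OF F]) (use that in auto)
  qed (use F eq that in auto)
  \<comment> \<open>Any index \<open>m\<close> with \<open>Re z > 1 - m\<close> would do; the
    ceiling selects one.\<close>
  define G where "G = (\<lambda>z. F (nat \<lceil>2 - Re z\<rceil>) z)"
  have G: "G z = F m z" if "Re z > 1 - real m" for m z
  proof -
    have "Re z > 1 - real (nat \<lceil>2 - Re z\<rceil>)" by linarith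
    then show ?thesis
      unfolding G_def using that Feq by (metis nle_le)
  qed
  have "G holomorphic_on {z. Re z > 1 - real m}" for m
    by (rule holomorphic_transform[OF F[of m]]) (simp add: G)
  then have "G holomorphic_on (\<Union>m. {z. Re z > 1 - real m})"
    by (intro holomorphic_on_UN_open open_halfspace_Re_gt)
  moreover have "(\<Union>m. {z. Re z > 1 - real m}) = UNIV"
  proof -
    have "\<exists>m. Re z > 1 - real m" for z
      using reals_Archimedean2[of "1 - Re z"] by (auto simp: algebra_simps)
    then show ?thesis by auto
  qed
  ultimately have "G holomorphic_on UNIV" by simp
  then have hol: "(\<lambda>z. G z / (z - 1)) holomorphic_on (- {1})"
    by (intro holomorphic_intros) (auto intro: holomorphic_on_subset)
  moreover have "(\<lambda>n. 1 / of_nat (Suc n) powr z) sums (G z / (z - 1))" if "Re z > 1" for z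
  proof -
    have "G z = (z - 1) * zeta_series z" using G[of 0 z] eq that by simp
    moreover have "z \<noteq> 1" using that by auto
    ultimately show ?thesis
      using summable_sums[OF summable_zeta_series[OF that]] by (simp add: zeta_series_def)
  qed
  ultimately show ?thesis by blast
qed

lemma riemann_zeta_holomorphic: "riemann_zeta holomorphic_on (- {1})"
  and riemann_zeta_sums: "Re z > 1 \<Longrightarrow> (\<lambda>n. 1 / of_nat (Suc n) powr z) sums riemann_zeta z"
  using someI_ex[OF riemann_zeta_exists, folded riemann_zeta_def] by auto

section \<open>The constant term of midpoint sums\<close>

text \<open>\<open>U 1\<close> is the integrand and \<open>U 0\<close> its primitive; the
  \<open>U 2\<close> term is the Euler-Maclaurin correction that raises the midpoint rule from
  second to fourth order. The general field covers complex powers as well as the real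
  kernel.\<close>

lemma midpoint_Taylor_bound:
  fixes U :: "nat \<Rightarrow> 'a::{banach, real_normed_field} \<Rightarrow> 'a"
  assumes S: "convex S" "x \<in> S" "x + t \<in> S" "x - t \<in> S"
    and U: "\<And>i y. y \<in> S \<Longrightarrow> i \<le> 4 \<Longrightarrow> (U i has_field_derivative U (Suc i) y) (at y within S)"
    and B: "\<And>y. y \<in> S \<Longrightarrow> norm (U 5 y) \<le> B"
  shows "norm (2 * t * U 1 x - (U 0 (x + t) - U 0 (x - t)) + t\<^sup>2 / 6 * (U 2 (x + t) - U 2 (x - t)))
           \<le> B * norm t ^ 5"
proof -
  define A where "A = (\<lambda>t. U 0 (x + t) - (\<Sum>i\<le>4. U i x * t ^ i / fact i))"
  define C where "C = (\<lambda>t. U 2 (x + t) - (\<Sum>i\<le>2. U (i + 2) x * t ^ i / fact i))"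
  have A: "norm (A s) \<le> B * norm s ^ 5 / 24" if "x + s \<in> S" for s
    using field_Taylor[of S 4 U B x "x + s"] assms that by (simp add: A_def fact_numeral)
  have C: "norm (C s) \<le> B * norm s ^ 3 / 2" if "x + s \<in> S" for s
  proof -
    have "norm (U (0 + 2) (x + s) - (\<Sum>i\<le>2. U (i + 2) x * (x + s - x) ^ i / fact i))
        \<le> B * norm (x + s - x) ^ Suc 2 / fact 2"
      by (rule field_Taylor[of S]) (use assms that in \<open>auto simp: eval_nat_numeral\<close>)
    then show ?thesis by (simp add: C_def fact_numeral eval_nat_numeral)
  qed
  have AA: "A t - A (- t) = U 0 (x + t) - U 0 (x - t) - 2 * t * U 1 x - t ^ 3 / 3 * U 3 x"
    unfolding A_def by (simp add: eval_nat_numeral field_simps)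
  have CC: "C t - C (- t) = U 2 (x + t) - U 2 (x - t) - 2 * t * U 3 x"
    unfolding C_def by (simp add: eval_nat_numeral field_simps)
  \<comment> \<open>The contributions \<open>t ^ 3 / 3 * U 3 x\<close> hidden in \<open>AA\<close>
    and \<open>CC\<close> cancel; the weight \<open>t\<^sup>2 / 6\<close> is chosen for
    this.\<close>
  have "2 * t * U 1 x - (U 0 (x + t) - U 0 (x - t)) + t\<^sup>2 / 6 * (U 2 (x + t) - U 2 (x - t))
      = - (A t - A (- t)) + t\<^sup>2 / 6 * (C t - C (- t))"
    unfolding AA CC by (simp add: field_simps eval_nat_numeral)
  also have "norm \<dots> \<le> (norm (A t) + norm (A (- t))) + norm t ^ 2 / 6 * (norm (C t) + norm (C (- t)))"
    using norm_triangle_ineq[of "- (A t - A (- t))" "t\<^sup>2 / 6 * (C t - C (- t))"]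
      norm_triangle_ineq4[of "A t" "A (- t)"]
      mult_left_mono[OF norm_triangle_ineq4[of "C t" "C (- t)"], of "norm t ^ 2 / 6"]
    by (simp add: norm_mult norm_divide norm_power norm_minus_commute)
  also have "\<dots> \<le> (B * norm t ^ 5 / 24 + B * norm t ^ 5 / 24) +
      norm t ^ 2 / 6 * (B * norm t ^ 3 / 2 + B * norm t ^ 3 / 2)"
    using A[of t] A[of "- t"] C[of t] C[of "- t"] S by (intro add_mono mult_left_mono) auto
  also have "\<dots> = B * norm t ^ 5 / 4" by (simp add: field_simps eval_nat_numeral)
  also have "\<dots> \<le> B * norm t ^ 5"
    using order_trans[OF norm_ge_zero B[OF S(2)]] by simp
  finally show ?thesis .
qed

text \<open>Error on the cell from \<open>j\<close> to \<open>j + 1\<close> of the corrected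
  midpoint rule for \<open>(1 - s) * x powr (- s)\<close>. The factor \<open>1 - s\<close> avoids a
  division in the primitive, so that for \<open>j > 0\<close> the defect is entire in
  \<open>s\<close>.\<close>

definition midpoint_defect :: "complex \<Rightarrow> nat \<Rightarrow> complex" where
  "midpoint_defect s j = (1 - s) * of_real (real j + 1/2) powr (- s)
     - (of_real (real j + 1) powr (1 - s) - of_real (real j) powr (1 - s))
     + (1 - s) * (- s) / 24 * (of_real (real j + 1) powr (- s - 1) - of_real (real j) powr (- s - 1))"

lemma norm_midpoint_defect_le:
  assumes "Re s + 4 \<ge> 0" "j \<ge> 1"
  shows "norm (midpoint_defect s j) \<le> norm (ffact1 s 5) * real j powr (- Re s - 4)"
proof -
  define S where "S = closed_segment (of_real (real j) :: complex) (of_real (real j + 1))"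
  have S: "\<exists>x. z = of_real x \<and> real j \<le> x \<and> x \<le> real j + 1" if "z \<in> S" for z
    using real_segment_bounds that unfolding S_def by fastforce
  have inS: "of_real x \<in> S" if "real j \<le> x" "x \<le> real j + 1" for x
    using that unfolding S_def closed_segment_of_real by (auto simp: closed_segment_eq_real_ivl)
  define U where "U = (\<lambda>i z. ffact1 s i * z powr (1 - s - of_nat i))"
  define x where "x = (of_real (real j + 1/2) :: complex)"
  have x: "x + 1/2 = of_real (real j + 1)" "x - 1/2 = of_real (real j)"
    by (auto simp: x_def)
  have "norm (2 * (1/2) * U 1 x - (U 0 (x + 1/2) - U 0 (x - 1/2)) + (1/2)\<^sup>2 / 6 * (U 2 (x + 1/2) - U 2 (x - 1/2)))
      \<le> norm (ffact1 s 5) * real j powr (- Re s - 4) * norm (1/2 :: complex) ^ 5"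
  proof (rule midpoint_Taylor_bound)
    show "convex S" by (simp add: S_def)
    show "x \<in> S" "x + 1/2 \<in> S" "x - 1/2 \<in> S" unfolding x unfolding x_def by (rule inS; simp)+
    show "(U i has_field_derivative U (Suc i) y) (at y within S)" if "y \<in> S" for i y
    proof -
      have "y \<notin> \<real>\<^sub>\<le>\<^sub>0"
        using S[OF that] assms(2) by auto
      from powr_has_field_derivative_ffact1[OF this] show ?thesis
        by (simp add: U_def del: ffact1_simps)
    qed
    show "norm (U 5 y) \<le> norm (ffact1 s 5) * real j powr (- Re s - 4)" if y: "y \<in> S" for y
    proof -
      obtain r where r: "y = of_real r" "real j \<le> r" using S[OF y] by auto
      have "norm (y powr (1 - s - 5)) = r powr (- Re s - 4)"
        using r assms(2) norm_powr_real_powr[of "of_real r" "1 - s - 5"] by (simp add: algebra_simps)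
      also have "\<dots> \<le> real j powr (- Re s - 4)"
        using r assms by (intro powr_mono2') auto
      finally show ?thesis
        by (simp add: U_def norm_mult mult_left_mono)
    qed
  qed
  also have "2 * (1/2) * U 1 x - (U 0 (x + 1/2) - U 0 (x - 1/2)) + (1/2)\<^sup>2 / 6 * (U 2 (x + 1/2) - U 2 (x - 1/2)) = midpoint_defect s j"
  proof -
    have e: "1 - s - of_nat 2 = - s - 1" "1 - s - of_nat 1 = - s" "1 - s - of_nat 0 = 1 - s"
      and f: "ffact1 s 2 = (1 - s) * (- s)" "ffact1 s 1 = 1 - s"
      by (simp_all add: eval_nat_numeral)
    show ?thesis unfolding x unfolding x_def U_def midpoint_defect_def e f
      by (simp add: algebra_simps power2_eq_square diff_divide_distrib)
  qed
  also have "norm (ffact1 s 5) * real j powr (- Re s - 4) * norm (1/2 :: complex) ^ 5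
      \<le> norm (ffact1 s 5) * real j powr (- Re s - 4)"
    by (simp add: norm_divide mult_left_le power_divide)
  finally show ?thesis .
qed

lemma summable_midpoint_defect:
  assumes "Re s > - 3" shows "summable (\<lambda>j. midpoint_defect s (Suc j))"
proof (rule summable_comparison_test)
  show "\<exists>N. \<forall>n\<ge>N. norm (midpoint_defect s (Suc n)) \<le> norm (ffact1 s 5) * real (Suc n) powr (- Re s - 4)"
    using norm_midpoint_defect_le[of s "Suc _"] assms by auto
  show "summable (\<lambda>n. norm (ffact1 s 5) * real (Suc n) powr (- Re s - 4))"
    using assms by (intro summable_mult summable_Suc_powr) auto
qed

lemma holomorphic_midpoint_defect: "(\<lambda>s. midpoint_defect s (Suc j)) holomorphic_on A"
  unfolding midpoint_defect_def by (intro holomorphic_intros) (auto simp add: nonpos_Reals_def)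

lemma holomorphic_suminf_midpoint_defect:
  "(\<lambda>s. \<Sum>j. midpoint_defect s (Suc j)) holomorphic_on {s. Re s > - 3}"
proof (rule suminf_holomorphic_on_halfplane[OF holomorphic_midpoint_defect])
  fix b r :: real assume b: "b > -3" and r: "r \<ge> 0"
  show "\<exists>M. summable M \<and> (\<forall>n w. Re w \<ge> b \<longrightarrow> norm w \<le> r \<longrightarrow> norm (midpoint_defect w (Suc n)) \<le> M n)"
  proof (intro exI conjI allI impI)
    let ?M = "\<lambda>n. (\<Prod>k<5. 1 + r + real k) * real (Suc n) powr (- b - 4)"
    show "summable ?M" using b by (intro summable_mult summable_Suc_powr) auto
    fix n and w :: complex assume w: "Re w \<ge> b" "norm w \<le> r"
    have "norm (midpoint_defect w (Suc n)) \<le> norm (ffact1 w 5) * real (Suc n) powr (- Re w - 4)"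
      using w b by (intro norm_midpoint_defect_le) auto
    also have "\<dots> \<le> ?M n"
      using w r by (intro mult_mono norm_ffact1_le powr_mono prod_nonneg) auto
    finally show "norm (midpoint_defect w (Suc n)) \<le> ?M n" .
  qed
qed

text \<open>Scaled by \<open>2 powr s\<close>, the odd term \<open>2 * n + 1\<close> of the
  Dirichlet series becomes \<open>(n + 1/2) powr (- s)\<close> and the even term
  \<open>2 * n + 2\<close> becomes \<open>(n + 1) powr (- s)\<close>. Grouping in pairs and
  subtracting the full series leaves the half-integers.\<close>

lemma zeta_half_series:
  assumes "Re s > 1"
  shows "(\<lambda>j. of_real (real j + 1/2) powr (- s)) sums ((2 powr s - 1) * riemann_zeta s)"
proof -
  have z: "(\<lambda>n. of_nat (Suc n) powr (- s)) sums riemann_zeta s"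
    using riemann_zeta_sums[OF assms] by (simp add: powr_minus_divide del: of_nat_Suc)
  have pos: "of_real (a * b) powr w = of_real a powr w * of_real b powr w" if "a > 0" "b > 0" for a b and w :: complex
    using that Ln_of_real[of "a * b"] Ln_of_real[of a] Ln_of_real[of b]
    by (simp add: powr_def exp_add[symmetric] ln_mult distrib_left)
  have "(\<lambda>n. 2 powr s * (\<Sum>i\<in>{n*2..<n*2+2}. of_nat (Suc i) powr (- s))) sums (2 powr s * riemann_zeta s)"
    by (intro sums_mult sums_group z) auto
  then have "(\<lambda>n. 2 powr s * (\<Sum>i\<in>{n*2..<n*2+2}. of_nat (Suc i) powr (- s)) - of_nat (Suc n) powr (- s)) sums
      (2 powr s * riemann_zeta s - riemann_zeta s)"
    by (intro sums_diff z)
  moreover have "2 powr s * (\<Sum>i\<in>{n*2..<n*2+2}. of_nat (Suc i) powr (- s)) - of_nat (Suc n) powr (- s) =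
       of_real (real n + 1/2) powr (- s)" for n
  proof -
    have "{n*2..<n*2+2} = {2*n, 2*n+1}" by auto
    then have "(\<Sum>i\<in>{n*2..<n*2+2}. of_nat (Suc i) powr (- s)) =
       of_real (2 * (real n + 1/2)) powr (- s) + of_real (2 * real (Suc n)) powr (- s)"
      by (simp add: algebra_simps)
    also have "\<dots> = 2 powr (- s) * (of_real (real n + 1/2) powr (- s) + of_nat (Suc n) powr (- s))"
      by (subst (1 2) pos) (auto simp: distrib_left)
    finally show ?thesis
      by (simp add: powr_minus field_simps)
  qed
  ultimately show ?thesis by (simp add: algebra_simps)
qed

text \<open>The constant term of the midpoint sums of \<open>x\<^sup>-\<^sup>s\<close>; by the identity theorem
  it suffices to compute it for \<open>Re s > 1\<close>, where everything telescopes.\<close>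

lemma zeta_midpoint_formula:
  assumes "Re s > - 3" "s \<noteq> 1"
  shows "(1 - s) * ((2 powr s - 1) * riemann_zeta s) =
    (\<Sum>j. midpoint_defect s (Suc j)) + (1 - s) * 2 powr s - 1 - (1 - s) * s / 24"
proof -
  let ?l = "\<lambda>s. (1 - s) * ((2 powr s - 1) * riemann_zeta s)"
  let ?r = "\<lambda>s. (\<Sum>j. midpoint_defect s (Suc j)) + (1 - s) * 2 powr s - 1 - (1 - s) * s / 24"
  have *: "?l z = ?r z" if z: "Re z > 1" for z
  proof -
    \<comment> \<open>The term \<open>j = 0\<close> is split off because its cell has a singular
      end. Its value \<open>2 powr z\<close> reappears on the right of the formula; each telescoping
      sum over the other cells contributes -1.\<close>
    have half: "(\<lambda>j. of_real (real (Suc j) + 1/2) powr (- z)) sums ((2 powr z - 1) * riemann_zeta z - 2 powr z)"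
    proof -
      have "(1/2 :: complex) powr (- z) = 2 powr z"
          using Ln_of_real[of "1/2"] Ln_of_real[of 2] by (simp add: powr_def ln_div)
      then show ?thesis
        using zeta_half_series[OF z] by (subst sums_Suc_iff) simp
    qed
    have "(\<lambda>j. (1 - z) * of_real (real (Suc j) + 1/2) powr (- z)
     - (of_nat (Suc (Suc j)) powr (1 - z) - of_nat (Suc j) powr (1 - z))
     + (1 - z) * (- z) / 24 * (of_nat (Suc (Suc j)) powr (- z - 1) - of_nat (Suc j) powr (- z - 1)))
      sums ((1 - z) * ((2 powr z - 1) * riemann_zeta z - 2 powr z) - (-1) + (1 - z) * (- z) / 24 * (- 1))"
      using z by (intro sums_add sums_diff sums_mult half Suc_powr_telescope) auto
    then have "(\<lambda>j. midpoint_defect z (Suc j)) sums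
       ((1 - z) * ((2 powr z - 1) * riemann_zeta z - 2 powr z) - (-1) + (1 - z) * (- z) / 24 * (- 1))"
      unfolding midpoint_defect_def by (simp add: add.commute)
    then show ?thesis by (simp add: sums_iff algebra_simps)
  qed
  show ?thesis
  proof (rule analytic_continuation_open[where f = ?l and g = ?r])
    show "open {z. Re z > 1}" "open ({z. Re z > -3} - {1})"
      by (auto intro: open_halfspace_Re_gt open_delete)
    show "{z. Re z > 1} \<noteq> {}" by (auto intro!: exI[of _ 2])
    show "connected ({z. Re z > -3} - {1})"
      by (intro connected_open_delete open_halfspace_Re_gt convex_connected convex_halfspace_Re_gt) auto
    show "?l holomorphic_on ({z. Re z > -3} - {1})"
      by (intro holomorphic_intros holomorphic_on_subset[OF riemann_zeta_holomorphic]) auto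
    show "?r holomorphic_on ({z. Re z > -3} - {1})"
      by (intro holomorphic_intros holomorphic_on_subset[OF holomorphic_suminf_midpoint_defect]) auto
  qed (use assms * in auto)
qed

section \<open>Polarization on the circle\<close>

definition circ :: "real \<Rightarrow> real ^ 2" where
  "circ t = vector [cos t, sin t]"

lemma circ_nth [simp]: "circ t $ 1 = cos t" "circ t $ 2 = sin t"
  by (simp_all add: circ_def)

lemma norm_real2: "norm (x :: real ^ 2) = sqrt ((x $ 1)\<^sup>2 + (x $ 2)\<^sup>2)"
  by (simp add: norm_vec_def L2_set_def UNIV_2)

lemma circ_in_S1 [simp]: "circ t \<in> S1"
  by (simp add: norm_real2)

lemma S1_circE:
  assumes "x \<in> S1" obtains t where "0 \<le> t" "t < 2 * pi" "x = circ t"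
proof -
  have "(x $ 1)\<^sup>2 + (x $ 2)\<^sup>2 = 1" using assms by (simp add: norm_real2)
  then obtain t where t: "0 \<le> t" "t < 2 * pi" "x $ 1 = cos t" "x $ 2 = sin t"
    by (rule sincos_total_2pi)
  then have "x = circ t" by (simp add: vec_eq_iff forall_2)
  with t that show thesis by blast
qed

lemma circ_periodic [simp]: "circ (t + 2 * pi) = circ t" "circ (t - 2 * pi) = circ t"
  "circ (t + 2 * pi * real k) = circ t"
proof -
  show "circ (t + 2 * pi) = circ t" "circ (t - 2 * pi) = circ t"
    by (simp_all add: vec_eq_iff forall_2 sin_add cos_add sin_diff cos_diff)
  show "circ (t + 2 * pi * real k) = circ t"
    using cos.plus_of_nat[of t k] sin.plus_of_nat[of t k]
    by (simp add: vec_eq_iff forall_2 mult.commute mult.left_commute)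
qed

lemma continuous_on_circ: "continuous_on A circ"
  unfolding continuous_on_def
proof (intro ballI vec_tendstoI)
  fix x i show "((\<lambda>t. circ t $ i) \<longlongrightarrow> circ x $ i) (at x within A)"
    using exhaust_2[of i] by (elim disjE) (simp_all add: tendsto_cos tendsto_sin tendsto_ident_at)
qed

lemma norm_circ_diff: "norm (circ a - circ b) = \<bar>2 * sin ((a - b) / 2)\<bar>"
proof -
  have "(cos a - cos b)\<^sup>2 + (sin a - sin b)\<^sup>2 = 2 - 2 * cos (a - b)"
    using sin_cos_squared_add[of a] sin_cos_squared_add[of b]
    by (simp add: power2_eq_square algebra_simps cos_diff)
  also have "\<dots> = (2 * sin ((a - b) / 2))\<^sup>2"
  proof -
    have e: "2 * ((a - b) / 2) = a - b" by simp
    show ?thesis using cos_double_sin[of "(a - b) / 2", unfolded e] by (simp add: power2_eq_square)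
  qed
  finally show ?thesis using real_sqrt_abs by (metis circ_nth norm_real2 vector_minus_component)
qed

text \<open>No absolute value is taken: the angle is meant to lie between \<open>0\<close> and
  \<open>2 * pi\<close>, where \<open>sin (\<theta> / 2)\<close> is nonnegative.\<close>

definition arc_kernel :: "real \<Rightarrow> real \<Rightarrow> real" where
  "arc_kernel s \<theta> = (if s = 0 then - ln (2 * sin (\<theta> / 2)) else sgn s * (2 * sin (\<theta> / 2)) powr (- s))"

lemma sin_half_pos: "0 < \<theta> \<Longrightarrow> \<theta> < 2 * pi \<Longrightarrow> 0 < sin (\<theta> / 2)"
  by (intro sin_gt_zero) auto

lemma sin_half_nonneg: "0 \<le> \<theta> \<Longrightarrow> \<theta> \<le> 2 * pi \<Longrightarrow> 0 \<le> sin (\<theta> / 2)"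
  by (intro sin_ge_zero) auto

text \<open>At coinciding points the two kernels agree only for \<open>s < 0\<close>, where both are
  0; for \<open>s \<ge> 0\<close> the Riesz kernel is infinite there, hence the strict bounds in
  that case.\<close>

lemma riesz_kernel_circ:
  assumes "0 \<le> b - a" "b - a \<le> 2 * pi" "s < 0 \<or> 0 < b - a \<and> b - a < 2 * pi"
  shows "riesz_kernel s (circ a) (circ b) = ereal (arc_kernel s (b - a))"
proof -
  have n: "norm (circ a - circ b) = 2 * sin ((b - a) / 2)"
    using norm_circ_diff[of b a] sin_half_nonneg[of "b - a"] assms by (simp add: norm_minus_commute)
  show ?thesis
  proof (cases "s < 0")
    case True
    then show ?thesis by (simp add: riesz_kernel_def arc_kernel_def n)
  next
    case False
    then have "norm (circ a - circ b) \<noteq> 0"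
      using sin_half_pos[of "b - a"] assms n by auto
    then have "circ a \<noteq> circ b" by auto
    then show ?thesis by (simp add: riesz_kernel_def arc_kernel_def n)
  qed
qed

lemma arc_kernel_reflect: "arc_kernel s (2 * pi - \<theta>) = arc_kernel s \<theta>"
proof -
  have "sin ((2 * pi - \<theta>) / 2) = sin (\<theta> / 2)"
    using sin_pi_minus[of "\<theta> / 2"] by (simp add: diff_divide_distrib)
  then show ?thesis by (simp add: arc_kernel_def)
qed

lemma riesz_kernel_neq_MInf: "riesz_kernel s x y \<noteq> - \<infinity>"
  by (auto simp: riesz_kernel_def)

section \<open>Continuity of potentials and attainment of the minimum\<close>

lemma continuous_on_riesz_kernel: "continuous_on A (\<lambda>x. riesz_kernel s x y)"
proof -
  define k where "k = (\<lambda>r. if r = 0 \<and> s \<ge> 0 then \<infinity> else if s = 0 then ereal (- ln r)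
      else ereal (sgn s * r powr (- s)))"
  have "(k \<longlongrightarrow> k r) (at r within {0..})" if r: "r \<ge> 0" for r
  proof (cases "s < 0")
    case True
    have "((\<lambda>r. sgn s * r powr (- s)) \<longlongrightarrow> sgn s * r powr (- s)) (at r within {0..})"
    proof -
      have "continuous_on {0..} (\<lambda>r::real. sgn s * r powr (- s))"
        by (intro continuous_on_mult continuous_on_const continuous_on_powr' continuous_on_id) (use True in auto)
      then show ?thesis using r by (auto simp: continuous_on_def)
    qed
    then show ?thesis using True by (simp add: k_def)
  next
    case s: False
    show ?thesis
    proof (cases "r = 0")
      case False
      then have "r > 0" using r by simp
      have "((\<lambda>r. ereal (if s = 0 then - ln r else sgn s * r powr (- s))) \<longlongrightarrow> k r) (at r within {0..})"
        using \<open>r > 0\<close> by (auto simp: k_def intro!: tendsto_intros)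
      moreover have "\<forall>\<^sub>F r in at r within {0..}. ereal (if s = 0 then - ln r else sgn s * r powr (- s)) = k r"
      proof -
        have "\<forall>\<^sub>F r' in at r within {0..}. r' > 0"
          using \<open>r > 0\<close> order_tendstoD(1)[OF tendsto_ident_at] by blast
        then show ?thesis by eventually_elim (auto simp: k_def)
      qed
      ultimately show ?thesis by (rule Lim_transform_eventually)
    next
      case True
      have "(k \<longlongrightarrow> \<infinity>) (at 0 within {0..})"
        unfolding tendsto_PInfty
      proof
        fix B :: real
        \<comment> \<open>Solves \<open>k d = B\<close> in the logarithmic case and
          \<open>k d = \<bar>B\<bar> + 1\<close> for \<open>s > 0\<close>; the absolute value keeps
          the base of the power positive.\<close>
        define d where "d = (if s = 0 then exp (- B) else (\<bar>B\<bar> + 1) powr (- 1 / s))"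
        have "d > 0" by (auto simp: d_def)
        have "ereal B < k x" if "0 < x" "x < d" for x
        proof (cases "s = 0")
          case True
          have "ln x < - B" using that True ln_less_cancel_iff[of x "exp (- B)"] by (simp add: d_def)
          then show ?thesis using that True by (simp add: k_def)
        next
          case False
          then have "s > 0" using s by simp
          have "d powr (- s) < x powr (- s)"
            using that \<open>s > 0\<close> by (intro powr_less_mono2_neg) auto
          moreover have "d powr (- s) = \<bar>B\<bar> + 1"
            using \<open>s > 0\<close> by (simp add: d_def powr_powr)
          ultimately show ?thesis using that \<open>s > 0\<close> by (simp add: k_def)
        qed
        then have "\<forall>x\<in>{0..}. x \<noteq> 0 \<and> dist x 0 < d \<longrightarrow> ereal B < k x" by (auto simp: dist_real_def)
        then show "\<forall>\<^sub>F x in at 0 within {0..}. ereal B < k x"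
          using \<open>d > 0\<close> eventually_at by blast
      qed
      moreover have "k 0 = \<infinity>" using s by (simp add: k_def)
      ultimately show ?thesis using True by simp
    qed
  qed
  then have "continuous_on {0..} k" by (auto simp: continuous_on_def)
  moreover have "riesz_kernel s x y = k (norm (x - y))" for x
    by (auto simp: riesz_kernel_def k_def)
  moreover have "continuous_on A (\<lambda>x. norm (x - y))" by (intro continuous_intros)
  ultimately show ?thesis
    using continuous_on_compose2[of "{0..}" k A "\<lambda>x. norm (x - y)"] by (simp add: image_subset_iff)
qed

lemma continuous_on_sum_riesz_kernel:
  "finite J \<Longrightarrow> continuous_on A (\<lambda>x. \<Sum>j\<in>J. riesz_kernel s x (f j))"
proof (induction J rule: finite_induct)
  case (insert i J)
  have "(\<Sum>j\<in>J. riesz_kernel s x (f j)) \<noteq> - \<infinity>" for x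
    using insert.hyps riesz_kernel_neq_MInf by (induction J rule: finite_induct) auto
  then show ?case
    using insert continuous_on_riesz_kernel[of A s "f i"] riesz_kernel_neq_MInf
    unfolding continuous_on_def by (auto intro!: tendsto_add_ereal_nonneg)
qed simp

text \<open>Makes \<open>LEAST\<close> a genuine minimum: potentials are continuous into
  \<open>ereal\<close>, poles included, and the circle is compact.\<close>

lemma polarization_attained:
  obtains x where "x \<in> S1" "polarization (riesz_kernel s) N \<omega> = (\<Sum>j=1..N. riesz_kernel s x (\<omega> j))"
    "\<And>y. y \<in> S1 \<Longrightarrow> polarization (riesz_kernel s) N \<omega> \<le> (\<Sum>j=1..N. riesz_kernel s y (\<omega> j))"
proof -
  let ?U = "\<lambda>x. \<Sum>j=1..N. riesz_kernel s x (\<omega> j)"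
  have "\<exists>x\<in>S1. \<forall>y\<in>S1. ?U x \<le> ?U y"
    by (intro continuous_attains_inf continuous_on_sum_riesz_kernel) auto
  then obtain x where x: "x \<in> S1" "\<And>y. y \<in> S1 \<Longrightarrow> ?U x \<le> ?U y" by blast
  have "polarization (riesz_kernel s) N \<omega> = ?U x"
    unfolding polarization_def by (rule Least_equality) (use x in auto)
  with x that show thesis by auto
qed

section \<open>Karamata's inequality and the cycle lemma\<close>

lemma tangent_line_le:
  fixes f f' :: "real \<Rightarrow> real"
  assumes der: "\<And>x. A < x \<Longrightarrow> x < B \<Longrightarrow> (f has_real_derivative f' x) (at x)"
    and mono: "\<And>x y. A < x \<Longrightarrow> x \<le> y \<Longrightarrow> y < B \<Longrightarrow> f' x \<le> f' y"
    and "A < a" "a < B" "A < b" "b < B"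
  shows "f a + f' a * (b - a) \<le> f b"
proof (cases a b rule: linorder_cases)
  case less
  obtain z where "a < z" "z < b" "f b - f a = (b - a) * f' z"
    using MVT2[of a b f f'] less assms by (meson order.strict_trans1 order.strict_trans2)
  moreover have "f' a \<le> f' z" using mono[of a z] calculation assms by simp
  ultimately show ?thesis
    using mult_right_mono[of "f' a" "f' z" "b - a"] less by (simp add: algebra_simps)
next
  case greater
  obtain z where "b < z" "z < a" "f a - f b = (a - b) * f' z"
    using MVT2[of b a f f'] greater assms by (meson order.strict_trans1 order.strict_trans2)
  moreover have "f' z \<le> f' a" using mono[of z a] calculation assms by simp
  ultimately show ?thesis
    using mult_right_mono[of "f' z" "f' a" "a - b"] greater by (simp add: algebra_simps)
qed auto

text \<open>Tangent lines at the \<open>a i\<close> bound \<open>f (b i)\<close> from below. In the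
  resulting sum the slopes \<open>f' (a i)\<close> increase with \<open>i\<close>, while the partial
  sums of \<open>a i - b i\<close> are nonnegative and end at 0, so Abel summation gives the
  sign.\<close>

lemma karamata:
  fixes f f' :: "real \<Rightarrow> real" and a b :: "nat \<Rightarrow> real"
  assumes der: "\<And>x. A < x \<Longrightarrow> x < B \<Longrightarrow> (f has_real_derivative f' x) (at x)"
    and mono: "\<And>x y. A < x \<Longrightarrow> x \<le> y \<Longrightarrow> y < B \<Longrightarrow> f' x \<le> f' y"
    and a: "\<And>i. i < n \<Longrightarrow> A < a i \<and> a i < B" and b: "\<And>i. i < n \<Longrightarrow> A < b i \<and> b i < B"
    and sorted: "\<And>i. Suc i < n \<Longrightarrow> a i \<le> a (Suc i)"
    and partial: "\<And>k. k \<le> n \<Longrightarrow> (\<Sum>i<k. b i) \<le> (\<Sum>i<k. a i)"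
    and total: "(\<Sum>i<n. a i) = (\<Sum>i<n. b i)"
  shows "(\<Sum>i<n. f (a i)) \<le> (\<Sum>i<n. f (b i))"
proof (cases n)
  case (Suc m)
  have Abel: "(\<Sum>i<Suc k. f' (a i) * (a i - b i)) \<le> f' (a k) * (\<Sum>i<Suc k. a i - b i)" if "k < n" for k
    using that
  proof (induction k)
    case (Suc k)
    have "f' (a k) * (\<Sum>i<Suc k. a i - b i) \<le> f' (a (Suc k)) * (\<Sum>i<Suc k. a i - b i)"
    proof (rule mult_right_mono)
      show "f' (a k) \<le> f' (a (Suc k))" using mono a[of k] a[of "Suc k"] sorted[of k] Suc.prems by simp
      show "0 \<le> (\<Sum>i<Suc k. a i - b i)" using partial[of "Suc k"] Suc.prems by (simp add: sum_subtractf)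
    qed
    then show ?case using Suc by (simp add: distrib_left)
  qed simp
  have "(\<Sum>i<n. f' (a i) * (a i - b i)) \<le> 0"
    using Abel[of m] total Suc by (simp add: sum_subtractf)
  moreover have "(\<Sum>i<n. f (a i) - f' (a i) * (a i - b i)) \<le> (\<Sum>i<n. f (b i))"
  proof (rule sum_mono)
    fix i assume "i \<in> {..<n}"
    then show "f (a i) - f' (a i) * (a i - b i) \<le> f (b i)"
      using tangent_line_le[OF der mono, of A B "a i" "b i"] a[of i] b[of i] by (simp add: algebra_simps)
  qed
  ultimately show ?thesis by (simp add: sum_subtractf)
qed auto

lemma sum_periodic_window:
  fixes g :: "nat \<Rightarrow> 'a :: comm_monoid_add"
  assumes "\<And>k. g (k + N) = g k"
  shows "(\<Sum>j<N. g (m + j)) = (\<Sum>j<N. g j)"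
proof (induction m)
  case (Suc m)
  show ?case
  proof (cases N)
    case (Suc M)
    have "(\<Sum>j<N. g (Suc m + j)) = (\<Sum>j<M. g (m + Suc j)) + g (m + N)"
      by (simp add: Suc)
    also have "\<dots> = (\<Sum>j<N. g (m + j))"
      using assms[of m] by (simp add: Suc sum.lessThan_Suc_shift add.commute del: sum.lessThan_Suc)
    finally show ?thesis using Suc.IH by simp
  qed simp
qed simp

text \<open>A vanishing total makes the partial sums themselves periodic, so they have a global
  minimum; sums started at that index never become negative.\<close>

lemma periodic_partial_sums_nonneg:
  fixes d :: "nat \<Rightarrow> real"
  assumes per: "\<And>k. d (k + N) = d k" and total: "(\<Sum>k<N. d k) = 0" and "N \<ge> 1"
  obtains m where "\<And>k. 0 \<le> (\<Sum>j<k. d (m + j))"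
proof -
  define S where "S = (\<lambda>k. \<Sum>j<k. d j)"
  have SN: "S (k + N) = S k" for k
    by (induction k) (use total per in \<open>auto simp: S_def\<close>)
  have Sk: "S (k + N * i) = S k" for k i
  proof (induction i)
    case (Suc i)
    then show ?case using SN[of "k + N * i"] by (simp add: algebra_simps)
  qed simp
  have "finite (S ` {..<N})" "S ` {..<N} \<noteq> {}" using \<open>N \<ge> 1\<close> by (auto simp: lessThan_empty_iff)
  then obtain m where m: "m < N" "\<And>i. i < N \<Longrightarrow> S m \<le> S i"
    using Min_in[of "S ` {..<N}"] Min_le[of "S ` {..<N}"] by fastforce
  have "S m \<le> S k" for k
    using m(2)[of "k mod N"] \<open>N \<ge> 1\<close> Sk[of "k mod N" "k div N"] by simp
  moreover have "(\<Sum>j<k. d (m + j)) = S (m + k) - S m" for k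
    by (induction k) (auto simp: S_def)
  ultimately show thesis using that[of m] by simp
qed

text \<open>Unrolls the circle to the line: the sorted angles are continued by adding
  \<open>2 * pi\<close> every \<open>N\<close> indices. Any \<open>N\<close> consecutive indices
  then list the configuration, so the numbering may start anywhere.\<close>

lemma sorted_lift:
  assumes \<omega>: "\<omega> \<in> {1..N} \<rightarrow> S1" and N: "N \<ge> 1"
  obtains X :: "nat \<Rightarrow> real" where "\<And>k. X k \<le> X (Suc k)" "\<And>k. X (k + N) = X k + 2 * pi"
    "\<And>m (g :: real ^ 2 \<Rightarrow> 'a::comm_monoid_add). (\<Sum>j=1..N. g (\<omega> j)) = (\<Sum>j<N. g (circ (X (m + j))))"
proof -
  have "\<forall>j\<in>{1..N}. \<exists>t. 0 \<le> t \<and> t < 2 * pi \<and> \<omega> j = circ t"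
    using \<omega> S1_circE by (metis Pi_iff)
  then obtain \<theta> where \<theta>: "\<And>j. j \<in> {1..N} \<Longrightarrow> 0 \<le> \<theta> j \<and> \<theta> j < 2 * pi \<and> \<omega> j = circ (\<theta> j)"
    by metis
  define xs where "xs = sort (map \<theta> [1..<Suc N])"
  have len: "length xs = N" by (simp add: xs_def)
  have rng: "0 \<le> xs ! i \<and> xs ! i < 2 * pi" if "i < N" for i
  proof -
    have "xs ! i \<in> set xs" using that len by simp
    then have "xs ! i \<in> \<theta> ` {1..<Suc N}" by (simp only: xs_def set_sort set_map set_upt)
    then obtain j where "j \<in> {1..N}" "xs ! i = \<theta> j" by (auto simp: less_Suc_eq_le)
    then show ?thesis using \<theta> by simp
  qed
  define X where "X = (\<lambda>k. xs ! (k mod N) + 2 * pi * real (k div N))"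
  have per: "X (k + N) = X k + 2 * pi" for k
    using N by (simp add: X_def algebra_simps)
  have mono: "X k \<le> X (Suc k)" for k
  proof (cases "Suc (k mod N) = N")
    case True
    then have "Suc k mod N = 0" "Suc k div N = Suc (k div N)"
      by (auto simp: mod_Suc div_Suc)
    then show ?thesis
      using rng[of "k mod N"] rng[of 0] N by (simp add: X_def algebra_simps)
  next
    case False
    then have "Suc k mod N = Suc (k mod N)" "Suc k div N = k div N"
      by (auto simp: mod_Suc div_Suc)
    moreover have "Suc (k mod N) < N" using False N by (meson Suc_lessI mod_less_divisor less_le_trans zero_less_one)
    then have "xs ! (k mod N) \<le> xs ! Suc (k mod N)"
      using len by (intro sorted_nth_mono) (auto simp: xs_def)
    ultimately show ?thesis by (simp add: X_def)
  qed
  have circX: "circ (X k) = circ (xs ! (k mod N))" for k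
    by (simp add: X_def)
  have "(\<Sum>j=1..N. g (\<omega> j)) = (\<Sum>j<N. g (circ (X (m + j))))" for m and g :: "real ^ 2 \<Rightarrow> 'a"
  proof -
    have "(\<Sum>j=1..N. g (\<omega> j)) = (\<Sum>j=1..N. g (circ (\<theta> j)))"
      using \<theta> by (intro sum.cong) auto
    also have "\<dots> = sum_list (map (\<lambda>j. g (circ (\<theta> j))) [1..<Suc N])"
      by (simp only: interv_sum_list_conv_sum_set_nat set_upt atLeastLessThanSuc_atLeastAtMost)
    \<comment> \<open>The detour through multisets keeps the multiplicity of coinciding points under
      sorting.\<close>
    also have "\<dots> = sum_mset (image_mset (\<lambda>t. g (circ t)) (mset (map \<theta> [1..<Suc N])))"
      by (simp only: mset_map[symmetric] sum_mset_sum_list map_map o_def)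
    also have "\<dots> = sum_list (map (\<lambda>t. g (circ t)) xs)"
    proof -
      have "mset (map \<theta> [1..<Suc N]) = mset xs" unfolding xs_def by (rule mset_sort[symmetric])
      then show ?thesis by (simp only: mset_map[symmetric] sum_mset_sum_list)
    qed
    also have "\<dots> = (\<Sum>j<N. g (circ (xs ! j)))"
      by (simp add: sum_list_sum_nth len atLeast0LessThan)
    also have "\<dots> = (\<Sum>j<N. g (circ (X j)))"
      by (intro sum.cong) (auto simp: circX)
    also have "\<dots> = (\<Sum>j<N. g (circ (X (m + j))))"
      by (rule sum_periodic_window[symmetric]) (simp add: per)
    finally show ?thesis .
  qed
  with per mono that show thesis by blast
qed

lemma arc_kernel_has_derivative:
  assumes "0 < \<theta>" "\<theta> < 2 * pi"
  shows "(arc_kernel s has_real_derivative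
      - (if s = 0 then 1 else \<bar>s\<bar>) * ((2 * sin (\<theta> / 2)) powr (- s - 1) * cos (\<theta> / 2))) (at \<theta>)"
proof (cases "s = 0")
  case True
  have "((\<lambda>\<theta>. - ln (2 * sin (\<theta> / 2))) has_real_derivative - (cos (\<theta> / 2) / (2 * sin (\<theta> / 2)))) (at \<theta>)"
    using sin_half_pos[OF assms] by (auto intro!: derivative_eq_intros)
  then show ?thesis
    using True sin_half_pos[OF assms] by (simp add: arc_kernel_def[abs_def] powr_minus_divide)
next
  case False
  have "((\<lambda>\<theta>. sgn s * (2 * sin (\<theta> / 2)) powr (- s)) has_real_derivative
      sgn s * (- s * (2 * sin (\<theta> / 2)) powr (- s - 1) * cos (\<theta> / 2))) (at \<theta>)"
    using sin_half_pos[OF assms] by (auto intro!: derivative_eq_intros)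
  moreover have "sgn s * (- s * A * c) = - \<bar>s\<bar> * (A * c)" for A c :: real
    by (simp add: sgn_real_def abs_real_def)
  moreover have "arc_kernel s = (\<lambda>\<theta>. sgn s * (2 * sin (\<theta> / 2)) powr (- s))"
    using False by (simp add: arc_kernel_def fun_eq_iff)
  ultimately show ?thesis using False by (simp only: if_False)
qed

text \<open>Convexity of the kernel. With \<open>u = 2 * sin (z / 2)\<close> the derivative of
  \<open>u powr (- s - 1) * cos (z / 2)\<close> has the two parts
  \<open>- (s + 1) * u powr (- s - 2) * cos^2\<close> and
  \<open>- u powr (- s - 1) * sin / 2\<close>, both nonpositive. For \<open>s < -1\<close> the first
  changes sign and dominates near \<open>u = 0\<close>.\<close>

lemma arc_kernel_derivative_mono:
  assumes "s \<ge> -1" "0 < x" "x \<le> y" "y < 2 * pi"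
  shows "- (if s = 0 then 1 else \<bar>s\<bar>) * ((2 * sin (x / 2)) powr (- s - 1) * cos (x / 2))
    \<le> - (if s = 0 then 1 else \<bar>s\<bar>) * ((2 * sin (y / 2)) powr (- s - 1) * cos (y / 2))"
proof -
  have "(2 * sin (y / 2)) powr (- s - 1) * cos (y / 2) \<le> (2 * sin (x / 2)) powr (- s - 1) * cos (x / 2)"
  proof (rule DERIV_nonpos_imp_nonincreasing[OF assms(3)])
    fix z assume "x \<le> z" "z \<le> y"
    then have z: "0 < z" "z < 2 * pi" using assms by auto
    let ?D = "(- s - 1) * (2 * sin (z / 2)) powr (- s - 2) * cos (z / 2) * cos (z / 2)
       - (2 * sin (z / 2)) powr (- s - 1) * sin (z / 2) / 2"
    have "((\<lambda>z. (2 * sin (z / 2)) powr (- s - 1) * cos (z / 2)) has_real_derivative ?D) (at z)"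
      using sin_half_pos[OF z] by (auto intro!: derivative_eq_intros simp: field_simps)
    moreover have "?D \<le> 0"
    proof -
      have "0 \<le> (s + 1) * ((2 * sin (z / 2)) powr (- s - 2) * (cos (z / 2) * cos (z / 2)))"
        using assms(1) by (intro mult_nonneg_nonneg zero_le_square) auto
      moreover have "0 \<le> (2 * sin (z / 2)) powr (- s - 1) * sin (z / 2) / 2"
        using sin_half_pos[OF z] by simp
      ultimately show ?thesis by (simp add: algebra_simps)
    qed
    ultimately show "\<exists>D. ((\<lambda>z. (2 * sin (z / 2)) powr (- s - 1) * cos (z / 2)) has_real_derivative D) (at z) \<and> D \<le> 0"
      by blast
  qed
  then show ?thesis by (simp add: mult_left_mono)
qed

section \<open>Optimality of equally spaced points\<close>

text \<open>The configuration is compared with the equally spaced one having the same mean angle.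
  Starting the numbering where the partial sums of the angular displacements are smallest
  makes the angles, seen from the midpoint of the corresponding gap of the equally spaced
  configuration, majorized by the equally spaced ones.\<close>

lemma polarization_le_equally_spaced:
  assumes \<omega>: "\<omega> \<in> {1..N} \<rightarrow> S1" and N: "N \<ge> 1" and s: "s \<ge> -1"
  shows "polarization (riesz_kernel s) N \<omega> \<le> ereal (\<Sum>j<N. arc_kernel s ((2 * real j + 1) * pi / N))"
proof -
  obtain X where mono: "\<And>k. X k \<le> X (Suc k)" and per: "\<And>k. X (k + N) = X k + 2 * pi"
    and sumX: "\<And>m (g :: real ^ 2 \<Rightarrow> ereal). (\<Sum>j=1..N. g (\<omega> j)) = (\<Sum>j<N. g (circ (X (m + j))))"
    by (rule sorted_lift[OF \<omega> N, where ?'a = ereal]) (use that in blast)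
  \<comment> \<open>The mean displacement of \<open>X k\<close> from \<open>2 * pi * k / N\<close>;
    subtracting it makes the displacements \<open>d\<close> sum to 0 over a period.\<close>
  define c where "c = (\<Sum>k<N. X k - 2 * pi * k / N) / N"
  define d where "d = (\<lambda>k. X k - (c + 2 * pi * k / N))"
  have dper: "d (k + N) = d k" for k
    using N per[of k] by (simp add: d_def field_simps)
  have dtot: "(\<Sum>k<N. d k) = 0"
  proof -
    have "(\<Sum>k<N. d k) = (\<Sum>k<N. X k - 2 * pi * k / N) - real N * c"
      by (simp add: d_def sum_subtractf sum.distrib)
    then show ?thesis using N by (simp add: c_def)
  qed
  obtain m where m: "\<And>k. 0 \<le> (\<Sum>j<k. d (m + j))"
    using periodic_partial_sums_nonneg[OF dper dtot N] by blast
  \<comment> \<open>Half a gap before the \<open>m\<close>-th point of the equally spaced comparison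
    configuration, whose points are then seen at the angles \<open>b j\<close>.\<close>
  define t where "t = c + 2 * pi * m / N - pi / N"
  define a where "a = (\<lambda>j. X (m + j) - t)"
  define b where "b = (\<lambda>j. (2 * real j + 1) * pi / N)"
  have ab: "a j - b j = d (m + j)" for j
    using N by (simp add: a_def b_def d_def t_def field_simps)
  have atot: "(\<Sum>j<N. a j) = (\<Sum>j<N. b j)"
    using sum_periodic_window[of d N m, OF dper] dtot by (simp add: ab[symmetric] sum_subtractf)
  have apart: "(\<Sum>j<k. b j) \<le> (\<Sum>j<k. a j)" for k
    using m[of k] by (simp add: ab[symmetric] sum_subtractf)
  have amono: "a i \<le> a j" if "i \<le> j" for i j
    using lift_Suc_mono_le[of X "m + i" "m + j"] mono that by (simp add: a_def)
  have b: "0 < b i" "b i < 2 * pi" if "i < N" for i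
  proof -
    show "0 < b i" using N by (simp add: b_def)
    have "(2 * real i + 1) * pi < (2 * real N) * pi" using that by (intro mult_strict_right_mono) auto
    then show "b i < 2 * pi" using N by (simp add: b_def field_simps)
  qed
  \<comment> \<open>The first angle is at least \<open>b 0\<close> by the first partial sum, the
    last at most \<open>b M\<close> because the totals agree; sortedness covers the rest. Thus no
    angle leaves the open period on which the kernel is convex.\<close>
  have a: "0 < a i" "a i < 2 * pi" if "i < N" for i
  proof -
    show "0 < a i" using apart[of 1] b(1)[of 0] amono[of 0 i] N by simp
    obtain M where M: "N = Suc M" using N by (cases N) auto
    have "a M \<le> b M" using atot apart[of M] by (simp add: M)
    then show "a i < 2 * pi" using amono[of i M] b(2)[of M] that M by simp
  qed
  have "(\<Sum>j=1..N. riesz_kernel s (circ t) (\<omega> j)) = (\<Sum>j<N. riesz_kernel s (circ t) (circ (X (m + j))))"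
    by (rule sumX)
  also have "\<dots> = (\<Sum>j<N. ereal (arc_kernel s (a j)))"
    using a by (intro sum.cong) (auto simp: a_def intro!: riesz_kernel_circ less_imp_le)
  also have "\<dots> = ereal (\<Sum>j<N. arc_kernel s (a j))" by simp
  also have "\<dots> \<le> ereal (\<Sum>j<N. arc_kernel s (b j))"
    using karamata[where A = 0 and B = "2 * pi" and f = "arc_kernel s" and a = a and b = b and n = N,
        OF arc_kernel_has_derivative arc_kernel_derivative_mono[OF s]]
      a b amono apart atot by simp
  finally have "(\<Sum>j=1..N. riesz_kernel s (circ t) (\<omega> j)) \<le> ereal (\<Sum>j<N. arc_kernel s (b j))" .
  moreover have "polarization (riesz_kernel s) N \<omega> \<le> (\<Sum>j=1..N. riesz_kernel s (circ t) (\<omega> j))"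
    using polarization_attained[of s N \<omega>] circ_in_S1[of t] by blast
  ultimately show ?thesis unfolding b_def by (rule order_trans[rotated])
qed

lemma riesz_kernel_rotate: "riesz_kernel s (circ (a + r)) (circ (b + r)) = riesz_kernel s (circ a) (circ b)"
proof -
  have "norm (circ (a + r) - circ (b + r)) = norm (circ a - circ b)" by (simp add: norm_circ_diff)
  moreover from this have "circ (a + r) = circ (b + r) \<longleftrightarrow> circ a = circ b"
    by (metis eq_iff_diff_eq_0 norm_eq_zero)
  ultimately show ?thesis by (simp add: riesz_kernel_def)
qed

text \<open>By rotation and periodicity any point may be moved to the gap just before angle 0;
  \<open>\<tau>\<close> is its distance to the next point of the configuration.\<close>

lemma equally_spaced_sum:
  assumes "x \<in> S1" and N: "N \<ge> 1"
  obtains \<tau> where "0 < \<tau>" "\<tau> \<le> 2 * pi / N"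
    "(\<Sum>j=1..N. riesz_kernel s x (circ (2 * pi * real j / real N))) = (\<Sum>j<N. riesz_kernel s (circ (- \<tau>)) (circ (2 * pi * real j / real N)))"
proof -
  obtain \<theta> where \<theta>: "0 \<le> \<theta>" "\<theta> < 2 * pi" "x = circ \<theta>" by (rule S1_circE[OF assms(1)])
  \<comment> \<open>Index of the first equally spaced point strictly beyond \<open>\<theta>\<close>;
    if \<open>x\<close> is itself such a point, this gives
    \<open>\<tau> = 2 * pi / N\<close>.\<close>
  define i where "i = nat (\<lfloor>\<theta> * N / (2 * pi)\<rfloor> + 1)"
  define \<tau> where "\<tau> = 2 * pi * real i / real N - \<theta>"
  have fl: "0 \<le> \<theta> * N / (2 * pi)" using \<theta> by simp
  then have "real i = of_int \<lfloor>\<theta> * N / (2 * pi)\<rfloor> + 1" by (simp add: i_def)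
  then have "real i > \<theta> * N / (2 * pi)" "real i \<le> \<theta> * N / (2 * pi) + 1" by linarith+
  then have "2 * pi / N * (\<theta> * N / (2 * pi)) < 2 * pi / N * real i"
    "2 * pi / N * real i \<le> 2 * pi / N * (\<theta> * N / (2 * pi) + 1)"
    using N by (intro mult_strict_left_mono mult_left_mono; simp)+
  then have \<tau>: "0 < \<tau>" "\<tau> \<le> 2 * pi / N" using N by (simp_all add: \<tau>_def distrib_left)
  define g where "g = (\<lambda>j::nat. riesz_kernel s x (circ (2 * pi * real j / real N)))"
  have g: "g (k + N) = g k" for k
    using N by (simp add: g_def add_divide_distrib distrib_left)
  have "(\<Sum>j=1..N. riesz_kernel s x (circ (2 * pi * real j / real N))) = (\<Sum>j<N. g (1 + j))"
    unfolding g_def by (rule sum.reindex_bij_witness[of _ Suc "\<lambda>j. j - 1"]) auto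
  also have "\<dots> = (\<Sum>j<N. g (i + j))"
    by (simp only: sum_periodic_window[of g N, OF g])
  also have "\<dots> = (\<Sum>j<N. riesz_kernel s (circ (- \<tau>)) (circ (2 * pi * real j / real N)))"
  proof (rule sum.cong)
    fix j
    show "g (i + j) = riesz_kernel s (circ (- \<tau>)) (circ (2 * pi * real j / real N))"
      using riesz_kernel_rotate[of s "- \<tau>" "2 * pi * real i / real N" "2 * pi * real j / real N"]
      by (simp add: g_def \<theta>(3) \<tau>_def add_divide_distrib distrib_left add.commute)
  qed simp
  finally show thesis by (rule that[OF \<tau>])
qed

text \<open>Inside a gap the potential is symmetric about the midpoint, so averaging the offsets
  \<open>\<delta>\<close> and \<open>- \<delta>\<close> and using convexity termwise compares it
  with its midpoint value. The end \<open>\<tau> = 2 * pi / N\<close>, where the kernel may be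
  infinite, follows by a left limit.\<close>

lemma equally_spaced_sum_ge:
  assumes s: "s \<ge> -1" and N: "N \<ge> 1" and x: "x \<in> S1"
  shows "ereal (\<Sum>j<N. arc_kernel s ((2 * real j + 1) * pi / N))
    \<le> (\<Sum>j=1..N. riesz_kernel s x (circ (2 * pi * real j / real N)))"
proof -
  define V where "V = (\<Sum>j<N. arc_kernel s ((2 * real j + 1) * pi / N))"
  define U where "U = (\<lambda>\<tau>. \<Sum>j<N. riesz_kernel s (circ (- \<tau>)) (circ (2 * pi * real j / real N)))"
  have inner: "ereal V \<le> U \<tau>" if \<tau>: "0 < \<tau>" "\<tau> < 2 * pi / N" for \<tau>
  proof -
    define \<delta> where "\<delta> = \<tau> - pi / N"
    define b where "b = (\<lambda>j. (2 * real j + 1) * pi / N)"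
    have \<delta>: "- (pi / N) < \<delta>" "\<delta> < pi / N" using \<tau> by (auto simp: \<delta>_def)
    have b: "0 < b j - pi / N \<or> b j = pi / N" "b j \<ge> pi / N" "b j \<le> 2 * pi - pi / N" if "j < N" for j
    proof -
      have "(2 * real j + 1) * (pi / N) \<le> (2 * real N - 1) * (pi / N)"
        using that by (intro mult_right_mono) auto
      then show "b j \<le> 2 * pi - pi / N" using N by (simp add: b_def left_diff_distrib diff_divide_distrib)
      show "b j \<ge> pi / N" using N by (simp add: b_def divide_right_mono)
      then show "0 < b j - pi / N \<or> b j = pi / N" by auto
    qed
    have U: "U \<tau> = ereal (\<Sum>j<N. arc_kernel s (b j + \<delta>))"
    proof -
      have "riesz_kernel s (circ (- \<tau>)) (circ (2 * pi * real j / real N)) = ereal (arc_kernel s (b j + \<delta>))" if "j < N" for j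
      proof -
        have e: "2 * pi * real j / real N - (- \<tau>) = b j + \<delta>" using N by (simp add: b_def \<delta>_def field_simps)
        show ?thesis
          using riesz_kernel_circ[of "2 * pi * real j / real N" "- \<tau>" s] unfolding e using b[OF that] \<delta> by auto
      qed
      then show ?thesis by (simp add: U_def)
    qed
    have "(\<Sum>j<N. arc_kernel s (b j + \<delta>)) = (\<Sum>j<N. arc_kernel s (b j - \<delta>))"
    proof (rule sum.reindex_bij_witness[of _ "\<lambda>j. N - Suc j" "\<lambda>j. N - Suc j"])
      fix j assume j: "j \<in> {..<N}"
      have "b (N - Suc j) - \<delta> = 2 * pi - (b j + \<delta>)"
        using j N by (simp add: b_def of_nat_diff field_simps)
      then show "arc_kernel s (b (N - Suc j) - \<delta>) = arc_kernel s (b j + \<delta>)"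
        by (simp only: arc_kernel_reflect)
    qed auto
    moreover have "2 * arc_kernel s (b j) \<le> arc_kernel s (b j + \<delta>) + arc_kernel s (b j - \<delta>)" if "j < N" for j
      using tangent_line_le[of 0 "2 * pi" "arc_kernel s", OF arc_kernel_has_derivative arc_kernel_derivative_mono[OF s], of "b j" "b j + \<delta>"]
        tangent_line_le[of 0 "2 * pi" "arc_kernel s", OF arc_kernel_has_derivative arc_kernel_derivative_mono[OF s], of "b j" "b j - \<delta>"]
        b[OF that] \<delta> by (simp add: algebra_simps)
    then have "(\<Sum>j<N. 2 * arc_kernel s (b j)) \<le> (\<Sum>j<N. arc_kernel s (b j + \<delta>) + arc_kernel s (b j - \<delta>))"
      by (intro sum_mono) auto
    ultimately have "V \<le> (\<Sum>j<N. arc_kernel s (b j + \<delta>))"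
      by (simp add: V_def b_def sum.distrib sum_distrib_left[symmetric])
    then show ?thesis by (simp add: U)
  qed
  obtain \<tau> where \<tau>: "0 < \<tau>" "\<tau> \<le> 2 * pi / N"
    and eq: "(\<Sum>j=1..N. riesz_kernel s x (circ (2 * pi * real j / real N))) = U \<tau>"
    unfolding U_def by (rule equally_spaced_sum[OF x N])
  have "continuous_on UNIV (\<lambda>x. \<Sum>j<N. riesz_kernel s x (circ (2 * pi * real j / real N)))"
    by (rule continuous_on_sum_riesz_kernel) simp
  then have "continuous_on UNIV U"
    unfolding U_def
    by (rule continuous_on_compose2) (auto intro!: continuous_on_compose2[OF continuous_on_circ] continuous_intros)
  then have "(U \<longlongrightarrow> U \<tau>) (at_left \<tau>)"
    by (meson UNIV_I continuous_on_def tendsto_within_subset subset_UNIV)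
  moreover have "\<forall>\<^sub>F t in at_left \<tau>. ereal V \<le> U t"
    using eventually_at_left_real[OF \<tau>(1)] by eventually_elim (use inner \<tau> in auto)
  ultimately have "ereal V \<le> U \<tau>"
    by (rule tendsto_lowerbound) simp
  then show ?thesis unfolding eq V_def .
qed

lemma max_polarization_eq:
  assumes s: "s \<ge> -1" and N: "N \<ge> 1"
  shows "max_polarization (riesz_kernel s) N = ereal (\<Sum>j<N. arc_kernel s ((2 * real j + 1) * pi / N))"
    (is "_ = ?V")
  unfolding max_polarization_def
proof (rule Greatest_equality)
  let ?\<omega> = "\<lambda>j::nat. circ (2 * pi * real j / real N)"
  have \<omega>: "?\<omega> \<in> {1..N} \<rightarrow> S1" by (intro Pi_I circ_in_S1)
  have "polarization (riesz_kernel s) N ?\<omega> = ?V"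
  proof (rule antisym)
    show "polarization (riesz_kernel s) N ?\<omega> \<le> ?V"
      by (rule polarization_le_equally_spaced[OF \<omega> N s])
    show "?V \<le> polarization (riesz_kernel s) N ?\<omega>"
    proof -
      obtain x where "x \<in> S1"
        "polarization (riesz_kernel s) N ?\<omega> = (\<Sum>j=1..N. riesz_kernel s x (?\<omega> j))"
        by (rule polarization_attained)
      then show ?thesis using equally_spaced_sum_ge[OF s N] by simp
    qed
  qed
  then show "?V \<in> polarization (riesz_kernel s) N ` ({1..N} \<rightarrow> S1)"
    using \<omega> by (intro image_eqI[of _ _ ?\<omega>]) auto
qed (use polarization_le_equally_spaced[OF _ N s] in auto)

section \<open>The logarithmic kernel\<close>

text \<open>The numbers \<open>cis (\<alpha> j)\<close> are \<open>N\<close> distinct roots of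
  \<open>z ^ N + 1\<close>, so this monic polynomial is the product of the
  \<open>z - cis (\<alpha> j)\<close>; at \<open>z = 1\<close> these factors have modulus
  \<open>2 * sin (\<alpha> j / 2)\<close>.\<close>

lemma prod_sin_odd_multiples:
  assumes N: "N \<ge> 1"
  shows "(\<Prod>j<N. 2 * sin ((2 * real j + 1) * pi / N / 2)) = 2"
proof -
  define \<alpha> where "\<alpha> = (\<lambda>j. (2 * real j + 1) * pi / N)"
  have \<alpha>: "0 < \<alpha> j" "\<alpha> j < 2 * pi" if "j < N" for j
  proof -
    show "0 < \<alpha> j" using N by (simp add: \<alpha>_def)
    have "(2 * real j + 1) * pi < (2 * real N) * pi" using that by (intro mult_strict_right_mono) auto
    then show "\<alpha> j < 2 * pi" using N by (simp add: \<alpha>_def field_simps)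
  qed
  define p where "p = monom 1 N + (1 :: complex poly)"
  define q where "q = (\<Prod>j<N. [:- cis (\<alpha> j), 1:])"
  have "inj_on (\<lambda>j. cis (\<alpha> j)) {..<N}"
  proof (rule inj_onI)
    fix i j assume ij: "i \<in> {..<N}" "j \<in> {..<N}" "cis (\<alpha> i) = cis (\<alpha> j)"
    then have "sin (\<alpha> i) = sin (\<alpha> j) \<and> cos (\<alpha> i) = cos (\<alpha> j)" by (simp add: complex_eq_iff)
    then obtain n :: int where n: "\<alpha> i = \<alpha> j + 2 * pi * of_int n"
      using iffD1[OF sin_cos_eq_iff] by blast
    have "n = 0"
    proof (rule ccontr)
      assume "n \<noteq> 0"
      then have "\<bar>2 * pi * of_int n\<bar> \<ge> 2 * pi" by (simp add: abs_mult)
      then show False using n \<alpha>[of i] \<alpha>[of j] ij by auto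
    qed
    then show "i = j" using n N by (simp add: \<alpha>_def)
  qed
  then have card: "card ((\<lambda>j. cis (\<alpha> j)) ` {..<N}) = N" by (simp add: card_image)
  have dq: "degree q = N" unfolding q_def by (subst degree_prod_eq_sum_degree) auto
  have "p = q"
  proof (rule poly_eqI_degree_lead_coeff[where n = N and A = "(\<lambda>j. cis (\<alpha> j)) ` {..<N}"])
    have "lead_coeff q = 1" unfolding q_def by (simp add: lead_coeff_prod)
    then show "poly.coeff p N = poly.coeff q N" using N dq by (simp add: p_def)
    show "degree p \<le> N" unfolding p_def by (intro degree_add_le degree_monom_le) auto
    show "degree q \<le> N" using dq by simp
    fix z assume "z \<in> (\<lambda>j. cis (\<alpha> j)) ` {..<N}"
    then obtain j where j: "j < N" "z = cis (\<alpha> j)" by auto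
    have "real N * \<alpha> j = pi + 2 * pi * real j"
      using N by (simp add: \<alpha>_def field_simps)
    then have "z ^ N = cis (pi + 2 * pi * real j)"
      by (simp only: j(2) Complex.DeMoivre)
    also have "\<dots> = - 1"
      using cos.plus_of_nat[of pi j] sin.plus_of_nat[of pi j]
      by (simp add: complex_eq_iff mult.commute mult.left_commute)
    finally have "poly p z = 0" by (simp add: p_def poly_monom)
    moreover have "poly q z = 0" using j by (auto simp: q_def poly_prod)
    ultimately show "poly p z = poly q z" by simp
  qed (simp add: card)
  then have "poly p 1 = poly q 1" by simp
  then have "2 = (\<Prod>j<N. 1 - cis (\<alpha> j))"
    by (simp add: p_def q_def poly_monom poly_prod)
  then have "2 = (\<Prod>j<N. norm (1 - cis (\<alpha> j)))"
    by (metis norm_numeral prod_norm)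
  also have "\<dots> = (\<Prod>j<N. 2 * sin (\<alpha> j / 2))"
  proof (rule prod.cong)
    fix j assume "j \<in> {..<N}"
    then have "sin (\<alpha> j / 2) > 0" using \<alpha>[of j] sin_half_pos by simp
    then show "norm (1 - cis (\<alpha> j)) = 2 * sin (\<alpha> j / 2)"
      using dist_exp_i_1[of "\<alpha> j"] by (simp add: cis_conv_exp norm_minus_commute)
  qed simp
  finally show ?thesis by (simp add: \<alpha>_def)
qed

lemma max_polarization_log:
  assumes N: "N \<ge> 1"
  shows "max_polarization (riesz_kernel 0) N = ereal (- ln 2)"
proof -
  have pos: "2 * sin ((2 * real j + 1) * pi / N / 2) > 0" if "j < N" for j
  proof -
    have "(2 * real j + 1) * pi < (2 * real N) * pi" using that by (intro mult_strict_right_mono) auto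
    then have "0 < (2 * real j + 1) * pi / N" "(2 * real j + 1) * pi / N < 2 * pi"
      using N by (simp, simp add: field_simps)
    from sin_half_pos[OF this] show ?thesis by simp
  qed
  have "ln 2 = (\<Sum>j<N. ln (2 * sin ((2 * real j + 1) * pi / N / 2)))"
    using ln_prod[of "{..<N}" "\<lambda>j. 2 * sin ((2 * real j + 1) * pi / N / 2)"] pos prod_sin_odd_multiples[OF N]
    by (force dest: less_imp_neq)
  then show ?thesis
    using max_polarization_eq[OF _ N, of 0] by (simp add: arc_kernel_def sum_negf)
qed

section \<open>The chord kernel\<close>

text \<open>Cell errors add up while the primitive and the correction telescope. The bound
  \<open>B j\<close> depends on the cell because the fourth derivative may grow towards singular
  ends.\<close>

lemma midpoint_rule_composite:
  fixes U :: "nat \<Rightarrow> real \<Rightarrow> real"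
  assumes h: "h > 0" and mM: "m \<le> M"
    and U: "\<And>i y. a + h * real m \<le> y \<Longrightarrow> y \<le> a + h * real M \<Longrightarrow> i \<le> 4 \<Longrightarrow>
              (U i has_real_derivative U (Suc i) y) (at y)"
    and B: "\<And>j y. m \<le> j \<Longrightarrow> j < M \<Longrightarrow> a + h * real j \<le> y \<Longrightarrow> y \<le> a + h * real (Suc j) \<Longrightarrow> \<bar>U 5 y\<bar> \<le> B j"
  shows "\<bar>h * (\<Sum>j=m..<M. U 1 (a + h * real j + h / 2)) - (U 0 (a + h * real M) - U 0 (a + h * real m))
      + h\<^sup>2 / 24 * (U 2 (a + h * real M) - U 2 (a + h * real m))\<bar> \<le> h ^ 5 * (\<Sum>j=m..<M. B j)"
  using mM U B
proof (induction M rule: dec_induct)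
  case base
  then show ?case by simp
next
  case (step n)
  have IH: "\<bar>h * (\<Sum>j=m..<n. U 1 (a + h * real j + h / 2)) - (U 0 (a + h * real n) - U 0 (a + h * real m))
      + h\<^sup>2 / 24 * (U 2 (a + h * real n) - U 2 (a + h * real m))\<bar> \<le> h ^ 5 * (\<Sum>j=m..<n. B j)"
  proof (rule step.IH)
    fix i y assume "a + h * real m \<le> y" "y \<le> a + h * real n" "i \<le> (4::nat)"
    then show "(U i has_real_derivative U (Suc i) y) (at y)"
      using h by (intro step.prems(1)) (auto simp: distrib_left)
  qed (use step.prems(2) in auto)
  define x where "x = a + h * real n + h / 2"
  have x: "x + h / 2 = a + h * real (Suc n)" "x - h / 2 = a + h * real n"
    by (auto simp: x_def field_simps)
  have "\<bar>2 * (h / 2) * U 1 x - (U 0 (x + h / 2) - U 0 (x - h / 2)) + (h / 2)\<^sup>2 / 6 * (U 2 (x + h / 2) - U 2 (x - h / 2))\<bar>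
      \<le> B n * norm (h / 2) ^ 5"
    unfolding real_norm_def[symmetric]
  proof (rule midpoint_Taylor_bound[of "{x - h / 2..x + h / 2}"])
    fix i y assume y: "y \<in> {x - h / 2..x + h / 2}" "i \<le> (4::nat)"
    have "h * real m \<le> h * real n" using step.hyps h by simp
    then show "(U i has_field_derivative U (Suc i) y) (at y within {x - h / 2..x + h / 2})"
      using y unfolding x by (intro has_field_derivative_at_within[OF step.prems(1)]) auto
  next
    fix y assume "y \<in> {x - h / 2..x + h / 2}"
    then show "norm (U 5 y) \<le> B n" unfolding x real_norm_def using step.hyps by (intro step.prems(2)) auto
  qed (use h in auto)
  also have "B n * norm (h / 2) ^ 5 \<le> h ^ 5 * B n"
  proof -
    have "B n \<ge> 0" using step.prems(2)[of n "a + h * real n"] step.hyps h by (auto simp: distrib_left intro: order_trans[OF abs_ge_zero])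
    then show ?thesis using h by (simp add: power_divide mult_ac mult_left_mono divide_le_eq)
  qed
  finally have "\<bar>h * U 1 x - (U 0 (a + h * real (Suc n)) - U 0 (a + h * real n))
      + h\<^sup>2 / 24 * (U 2 (a + h * real (Suc n)) - U 2 (a + h * real n))\<bar> \<le> h ^ 5 * B n"
    unfolding x by (simp add: power2_eq_square)
  with IH have "\<bar>(h * (\<Sum>j=m..<n. U 1 (a + h * real j + h / 2)) - (U 0 (a + h * real n) - U 0 (a + h * real m))
      + h\<^sup>2 / 24 * (U 2 (a + h * real n) - U 2 (a + h * real m))) +
      (h * U 1 x - (U 0 (a + h * real (Suc n)) - U 0 (a + h * real n))
      + h\<^sup>2 / 24 * (U 2 (a + h * real (Suc n)) - U 2 (a + h * real n)))\<bar> \<le> h ^ 5 * (\<Sum>j=m..<n. B j) + h ^ 5 * B n"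
    by (rule abs_triangle_ineq[THEN order_trans, OF add_mono])
  then show ?case
    using step.hyps by (simp add: x_def algebra_simps)
qed

definition chord :: "real \<Rightarrow> real \<Rightarrow> real" where
  "chord a \<theta> = (2 * sin (\<theta> / 2)) powr (- a)"

definition chord1 :: "real \<Rightarrow> real \<Rightarrow> real" where
  "chord1 a \<theta> = - a * ((2 * sin (\<theta> / 2)) powr (- a - 1) * cos (\<theta> / 2))"

text \<open>With \<open>u = 2 * sin (\<theta> / 2)\<close> one has
  \<open>cos^2 = 1 - u^2 / 4\<close>, so the second derivative of \<open>u powr (- a)\<close> only
  involves the kernels of exponents \<open>a + 2\<close> and \<open>a\<close>. Iterating this yields
  \<open>chord3\<close> and \<open>chord4\<close>.\<close>

definition chord2 :: "real \<Rightarrow> real \<Rightarrow> real" where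
  "chord2 a \<theta> = a * (a + 1) * chord (a + 2) \<theta> - a\<^sup>2 / 4 * chord a \<theta>"

definition chord3 :: "real \<Rightarrow> real \<Rightarrow> real" where
  "chord3 a \<theta> = a * (a + 1) * chord1 (a + 2) \<theta> - a\<^sup>2 / 4 * chord1 a \<theta>"

definition chord4 :: "real \<Rightarrow> real \<Rightarrow> real" where
  "chord4 a \<theta> = a * (a + 1) * chord2 (a + 2) \<theta> - a\<^sup>2 / 4 * chord2 a \<theta>"

lemma chord_has_derivative:
  assumes "0 < \<theta>" "\<theta> < 2 * pi"
  shows "(chord a has_real_derivative chord1 a \<theta>) (at \<theta>)"
  unfolding chord_def[abs_def] chord1_def
  using sin_half_pos[OF assms] by (auto intro!: derivative_eq_intros)

lemma chord1_has_derivative: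
  assumes "0 < \<theta>" "\<theta> < 2 * pi"
  shows "(chord1 a has_real_derivative chord2 a \<theta>) (at \<theta>)"
proof -
  define u where "u = 2 * sin (\<theta> / 2)"
  have u: "u > 0" using sin_half_pos[OF assms] by (simp add: u_def)
  have c: "cos (\<theta> / 2) * cos (\<theta> / 2) = 1 - u\<^sup>2 / 4"
    using sin_cos_squared_add[of "\<theta> / 2"] by (simp add: u_def power2_eq_square)
  have "((\<lambda>\<theta>. - a * ((2 * sin (\<theta> / 2)) powr (- a - 1) * cos (\<theta> / 2))) has_real_derivative
     - a * ((- a - 1) * u powr (- a - 2) * (cos (\<theta> / 2) * cos (\<theta> / 2)) - u powr (- a - 1) * (u / 4))) (at \<theta>)"
    using sin_half_pos[OF assms] by (auto intro!: derivative_eq_intros simp: u_def minus_diff_commute mult_ac)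
  also have "- a * ((- a - 1) * u powr (- a - 2) * (cos (\<theta> / 2) * cos (\<theta> / 2)) - u powr (- a - 1) * (u / 4)) = chord2 a \<theta>"
  proof -
    have "u powr (- a - 1) * u = u powr (- a)" "u powr (- a - 2) * u\<^sup>2 = u powr (- a)" "- (a + 2) = - a - 2"
      using u by (simp_all add: powr_diff powr_minus powr_numeral)
    then show ?thesis
      unfolding c chord2_def chord_def u_def[symmetric] by (simp add: algebra_simps power2_eq_square diff_divide_distrib)
  qed
  finally show ?thesis by (simp add: chord1_def[abs_def])
qed

lemma chord2_has_derivative:
  assumes "0 < \<theta>" "\<theta> < 2 * pi"
  shows "(chord2 a has_real_derivative chord3 a \<theta>) (at \<theta>)"
  unfolding chord2_def[abs_def] chord3_def
  by (intro DERIV_diff DERIV_cmult chord_has_derivative assms)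

lemma chord3_has_derivative:
  assumes "0 < \<theta>" "\<theta> < 2 * pi"
  shows "(chord3 a has_real_derivative chord4 a \<theta>) (at \<theta>)"
  unfolding chord3_def[abs_def] chord4_def
  by (intro DERIV_diff DERIV_cmult chord1_has_derivative assms)

lemma chord_reflect:
  "chord a (2 * pi - \<theta>) = chord a \<theta>" "chord1 a (2 * pi - \<theta>) = - chord1 a \<theta>"
  "chord2 a (2 * pi - \<theta>) = chord2 a \<theta>" "chord4 a (2 * pi - \<theta>) = chord4 a \<theta>"
proof -
  have "sin ((2 * pi - \<theta>) / 2) = sin (\<theta> / 2)" "cos ((2 * pi - \<theta>) / 2) = - cos (\<theta> / 2)"
    using sin_pi_minus[of "\<theta> / 2"] cos_pi_minus[of "\<theta> / 2"] by (simp_all add: diff_divide_distrib)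
  then show c: "chord a (2 * pi - \<theta>) = chord a \<theta>" "chord1 a (2 * pi - \<theta>) = - chord1 a \<theta>" for a
    by (simp_all add: chord_def chord1_def)
  show "chord2 a (2 * pi - \<theta>) = chord2 a \<theta>" for a by (simp add: chord2_def c)
  then show "chord4 a (2 * pi - \<theta>) = chord4 a \<theta>" by (simp add: chord4_def)
qed

lemma chord_nonneg: "chord a \<theta> \<ge> 0"
  by (simp add: chord_def)

section \<open>Comparison of chord length with arc length\<close>

lemma sin_ge_cubic: "x - x ^ 3 / 6 \<le> sin x" if "0 \<le> x" for x :: real
proof -
  have "0 - 0 ^ 3 / 6 - sin 0 \<ge> x - x ^ 3 / 6 - sin x"
  proof (rule DERIV_nonpos_imp_nonincreasing[OF that])
    fix t :: real assume "0 \<le> t"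
    have "1 - cos t \<le> t\<^sup>2 / 2"
    proof -
      have "cos t = 1 - 2 * (sin (t / 2))\<^sup>2" using cos_double_sin[of "t / 2"] by simp
      moreover have "(sin (t / 2))\<^sup>2 \<le> (t / 2)\<^sup>2"
        using abs_sin_x_le_abs_x[of "t / 2"] by (metis abs_le_square_iff)
      ultimately show ?thesis by (simp add: power2_eq_square)
    qed
    moreover have "((\<lambda>x. x - x ^ 3 / 6 - sin x) has_real_derivative 1 - t\<^sup>2 / 2 - cos t) (at t)"
      by (auto intro!: derivative_eq_intros)
    ultimately show "\<exists>y. ((\<lambda>x. x - x ^ 3 / 6 - sin x) has_real_derivative y) (at t) \<and> y \<le> 0"
      by (intro exI[of _ "1 - t\<^sup>2 / 2 - cos t"]) auto
  qed
  then show ?thesis by simp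
qed

lemma chord_length_bounds:
  assumes "0 < \<theta>" "\<theta> \<le> pi"
  shows "2 * sin (\<theta> / 2) \<le> \<theta>" "\<theta> / 2 \<le> 2 * sin (\<theta> / 2)" "\<theta> - 2 * sin (\<theta> / 2) \<le> \<theta> ^ 3 / 24"
proof -
  show "2 * sin (\<theta> / 2) \<le> \<theta>" using sin_x_le_x[of "\<theta> / 2"] assms by simp
  show 3: "\<theta> - 2 * sin (\<theta> / 2) \<le> \<theta> ^ 3 / 24"
    using sin_ge_cubic[of "\<theta> / 2"] assms by (simp add: power_divide)
  have "\<theta>\<^sup>2 \<le> 12"
  proof -
    have "\<theta>\<^sup>2 \<le> 3.2\<^sup>2" using assms pi_less_4 pi_approx by (intro power_mono) auto
    then show ?thesis by (simp add: power2_eq_square)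
  qed
  then have "\<theta> * \<theta>\<^sup>2 \<le> \<theta> * 12" using assms by (intro mult_left_mono) auto
  then show "\<theta> / 2 \<le> 2 * sin (\<theta> / 2)" using 3 by (simp add: power3_eq_cube power2_eq_square)
qed

lemma powr_comparable:
  fixes x y b :: real
  assumes "0 < y" "y / 2 \<le> x" "x \<le> y"
  shows "x powr b \<le> 2 powr \<bar>b\<bar> * y powr b"
proof (cases "b \<ge> 0")
  case True
  then have "x powr b \<le> y powr b" using assms by (intro powr_mono2) auto
  moreover have "1 \<le> 2 powr \<bar>b\<bar>" by (simp add: ge_one_powr_ge_zero)
  ultimately show ?thesis using mult_right_mono[of 1 "2 powr \<bar>b\<bar>" "y powr b"] by simp
next
  case False
  then have "x powr b \<le> (y / 2) powr b" using assms by (intro powr_mono2') auto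
  also have "\<dots> = 2 powr \<bar>b\<bar> * y powr b" using False assms by (simp add: powr_divide powr_minus divide_simps)
  finally show ?thesis .
qed

lemma chord_le:
  assumes "0 < \<theta>" "\<theta> \<le> pi"
  shows "chord a \<theta> \<le> 2 powr \<bar>a\<bar> * \<theta> powr (- a)"
  unfolding chord_def using powr_comparable[OF assms(1) chord_length_bounds(2,1)[OF assms], of "- a"] by simp

text \<open>Chord and arc differ by order \<open>\<theta> ^ 3\<close>, and the derivative of the
  power is of order \<open>\<theta> powr (- a - 1)\<close>: passing from the kernel to the pure
  power gains two orders, on which the analysis at the endpoints rests.\<close>

lemma chord_diff_le:
  assumes "0 < \<theta>" "\<theta> \<le> pi"
  shows "\<bar>chord a \<theta> - \<theta> powr (- a)\<bar> \<le> \<bar>a\<bar> * 2 powr \<bar>a + 1\<bar> * \<theta> powr (2 - a)"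
proof -
  define u where "u = 2 * sin (\<theta> / 2)"
  note b = chord_length_bounds[OF assms, folded u_def]
  have u: "u > 0" using b assms by simp
  have "\<bar>u powr (- a) - \<theta> powr (- a)\<bar> \<le> \<bar>a\<bar> * 2 powr \<bar>a + 1\<bar> * \<theta> powr (2 - a)"
  proof (cases "u = \<theta>")
    case False
    then have "u < \<theta>" using b by simp
    moreover have "((\<lambda>x. x powr (- a)) has_real_derivative - a * x powr (- a - 1)) (at x)" if "u \<le> x" for x
      using u that by (auto intro!: derivative_eq_intros)
    ultimately obtain z where z: "u < z" "z < \<theta>" "\<theta> powr (- a) - u powr (- a) = (\<theta> - u) * (- a * z powr (- a - 1))"
      using MVT2[of u \<theta> "\<lambda>x. x powr (- a)" "\<lambda>z. - a * z powr (- a - 1)"] by blast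
    have "\<bar>u powr (- a) - \<theta> powr (- a)\<bar> = (\<theta> - u) * (\<bar>a\<bar> * z powr (- a - 1))"
      using z by (subst abs_minus_commute) (simp add: abs_mult)
    also have "\<dots> \<le> \<theta> ^ 3 * (\<bar>a\<bar> * (2 powr \<bar>- a - 1\<bar> * \<theta> powr (- a - 1)))"
    proof (intro mult_mono powr_comparable)
      have "\<theta> ^ 3 \<ge> 0" using assms by simp
      then show "\<theta> - u \<le> \<theta> ^ 3" using b by linarith
    qed (use b z assms in auto)
    also have "\<theta> ^ 3 * (\<bar>a\<bar> * (2 powr \<bar>- a - 1\<bar> * \<theta> powr (- a - 1))) = \<bar>a\<bar> * 2 powr \<bar>a + 1\<bar> * \<theta> powr (2 - a)"
    proof -
      have "\<theta> powr (2 - a) = \<theta> powr 3 * \<theta> powr (- a - 1)" by (simp add: powr_add[symmetric])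
      moreover have "\<bar>- a - 1\<bar> = \<bar>a + 1\<bar>" by linarith
      ultimately show ?thesis using assms by (simp add: powr_numeral)
    qed
    finally show ?thesis .
  qed simp
  then show ?thesis by (simp add: chord_def u_def)
qed

lemma chord1_le:
  assumes "0 < \<theta>" "\<theta> \<le> pi"
  shows "\<bar>chord1 a \<theta>\<bar> \<le> \<bar>a\<bar> * 2 powr \<bar>a + 1\<bar> * \<theta> powr (- a - 1)"
proof -
  have "\<bar>chord1 a \<theta>\<bar> = \<bar>a\<bar> * (chord (a + 1) \<theta> * \<bar>cos (\<theta> / 2)\<bar>)"
  proof -
    have "- (a + 1) = - a - 1" by simp
    then show ?thesis unfolding chord1_def chord_def by (simp only: abs_mult abs_minus_cancel abs_of_nonneg powr_ge_zero)
  qed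
  also have "\<dots> \<le> \<bar>a\<bar> * (2 powr \<bar>a + 1\<bar> * \<theta> powr (- (a + 1)) * 1)"
    using chord_le[OF assms, of "a + 1"] by (intro mult_left_mono mult_mono chord_nonneg) auto
  finally show ?thesis by (simp add: minus_diff_commute mult_ac)
qed

lemma chord1_diff_le:
  assumes "0 < \<theta>" "\<theta> \<le> pi"
  shows "\<bar>chord1 a \<theta> - (- a * \<theta> powr (- a - 1))\<bar>
    \<le> \<bar>a\<bar> * (\<bar>a + 1\<bar> * 2 powr \<bar>a + 2\<bar> + 2 powr \<bar>a + 1\<bar>) * \<theta> powr (1 - a)"
proof -
  have cos: "\<bar>1 - cos (\<theta> / 2)\<bar> \<le> \<theta>\<^sup>2"
  proof -
    have "cos (\<theta> / 2) = 1 - 2 * (sin (\<theta> / 4))\<^sup>2" using cos_double_sin[of "\<theta> / 4"] by simp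
    moreover have "(sin (\<theta> / 4))\<^sup>2 \<le> (\<theta> / 4)\<^sup>2"
      using abs_sin_x_le_abs_x[of "\<theta> / 4"] by (metis abs_le_square_iff)
    moreover have "(\<theta> / 4)\<^sup>2 = \<theta>\<^sup>2 / 16" by (simp add: power_divide)
    moreover have "0 \<le> (sin (\<theta> / 4))\<^sup>2" "0 \<le> \<theta>\<^sup>2" by simp_all
    ultimately show ?thesis by linarith
  qed
  have e: "- (a + 1) = - a - 1" "2 - (a + 1) = 1 - a" "a + 1 + 1 = a + 2" by simp_all
  have "chord1 a \<theta> - (- a * \<theta> powr (- a - 1)) =
      - a * ((chord (a + 1) \<theta> - \<theta> powr (- (a + 1))) - chord (a + 1) \<theta> * (1 - cos (\<theta> / 2)))"
    unfolding chord1_def chord_def e(1) by (simp add: right_diff_distrib left_diff_distrib mult_ac)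
  also have "\<bar>\<dots>\<bar> \<le> \<bar>a\<bar> * (\<bar>chord (a + 1) \<theta> - \<theta> powr (- (a + 1))\<bar> + \<bar>chord (a + 1) \<theta>\<bar> * \<bar>1 - cos (\<theta> / 2)\<bar>)"
    unfolding abs_mult[symmetric] abs_minus_cancel
    by (subst abs_mult) (simp add: mult_left_mono abs_triangle_ineq4)
  also have "\<dots> \<le> \<bar>a\<bar> * (\<bar>a + 1\<bar> * 2 powr \<bar>a + 2\<bar> * \<theta> powr (1 - a) + (2 powr \<bar>a + 1\<bar> * \<theta> powr (- a - 1)) * \<theta>\<^sup>2)"
    using chord_diff_le[OF assms, of "a + 1"] chord_le[OF assms, of "a + 1"] cos chord_nonneg[of "a + 1" \<theta>]
    unfolding e by (intro mult_left_mono add_mono mult_mono) auto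
  also have "(2 powr \<bar>a + 1\<bar> * \<theta> powr (- a - 1)) * \<theta>\<^sup>2 = 2 powr \<bar>a + 1\<bar> * \<theta> powr (1 - a)"
  proof -
    have "\<theta> powr (1 - a) = \<theta> powr (- a - 1) * \<theta> powr 2" by (simp add: powr_add[symmetric])
    then show ?thesis using assms by (simp add: powr_numeral)
  qed
  finally show ?thesis by (simp only: distrib_left distrib_right mult.assoc)
qed

section \<open>The integral of the chord kernel\<close>

lemma chord_integrable:
  assumes "a < 1"
  shows "chord a integrable_on {0..2 * pi}"
proof (rule measurable_bounded_by_integrable_imp_integrable_real)
  let ?p = "\<lambda>\<theta>::real. \<theta> powr (- a)"
  have "(\<lambda>\<theta>. chord a \<theta>) \<in> borel_measurable borel"
    unfolding chord_def by measurable
  then show "chord a \<in> borel_measurable (lebesgue_on {0..2 * pi})"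
    by (intro measurable_restrict_space1 measurable_completion) simp
  have p: "?p integrable_on cbox 0 (2 * pi)"
    using has_integral_powr_from_0[of "- a" "2 * pi"] assms by (auto simp: integrable_on_def)
  have "(\<lambda>\<theta>. ?p ((-1) *\<^sub>R \<theta> + 2 * pi)) integrable_on ((\<lambda>x. (1 / (-1)) *\<^sub>R x + -((1 / (-1)) *\<^sub>R (2 * pi))) ` cbox 0 (2 * pi))"
    using has_integral_affinity[OF integrable_integral[OF p], of "-1" "2 * pi"] by (auto simp: integrable_on_def)
  moreover have "(\<lambda>x. (1 / (-1)) *\<^sub>R x + -((1 / (-1)) *\<^sub>R (2 * pi))) ` cbox 0 (2 * pi) = {0..2 * pi}"
    by (auto intro!: image_eqI[of _ _ "2 * pi - _"])
  ultimately have "(\<lambda>\<theta>. ?p (2 * pi - \<theta>)) integrable_on {0..2 * pi}"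
    by simp
  then show "(\<lambda>\<theta>. 2 powr \<bar>a\<bar> * (?p \<theta> + ?p (2 * pi - \<theta>))) integrable_on {0..2 * pi}"
    using p by (intro integrable_on_mult_right integrable_add) auto
  fix \<theta> assume \<theta>: "\<theta> \<in> {0..2 * pi}"
  consider "\<theta> = 0" | "\<theta> = 2 * pi" | "0 < \<theta>" "\<theta> \<le> pi" | "pi < \<theta>" "\<theta> < 2 * pi" using \<theta> by fastforce
  then have "chord a \<theta> \<le> 2 powr \<bar>a\<bar> * (?p \<theta> + ?p (2 * pi - \<theta>))"
  proof cases
    case 3
    show ?thesis using chord_le[OF 3, of a] by (simp add: distrib_left add_increasing2)
  next
    case 4
    then show ?thesis using chord_le[of "2 * pi - \<theta>" a] by (simp add: chord_reflect distrib_left add_increasing)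
  qed (simp_all add: chord_def)
  then show "\<bar>chord a \<theta>\<bar> \<le> 2 powr \<bar>a\<bar> * (?p \<theta> + ?p (2 * pi - \<theta>))"
    by (simp add: abs_of_nonneg chord_nonneg)
qed simp

text \<open>The primitive that vanishes at 0, with an integrable singularity there if
  \<open>0 < a < 1\<close>. Its value at \<open>2 * pi\<close>, divided by \<open>2 * pi\<close>, is
  the Riesz energy up to sign.\<close>

definition chord_integral :: "real \<Rightarrow> real \<Rightarrow> real" where
  "chord_integral a x = integral {0..x} (chord a)"

lemma continuous_on_chord: "0 < b \<Longrightarrow> c < 2 * pi \<Longrightarrow> continuous_on {b..c} (chord a)"
  by (intro continuous_at_imp_continuous_on ballI DERIV_isCont[OF chord_has_derivative]) auto

text \<open>The kernel may be singular at 0, so the fundamental theorem is applied on an interval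
  \<open>{b..c}\<close> around \<open>x\<close> inside the open period; the part up to
  \<open>b\<close> is a constant.\<close>

lemma chord_integral_has_derivative:
  assumes "a < 1" "0 < x" "x < 2 * pi"
  shows "(chord_integral a has_real_derivative chord a x) (at x)"
proof -
  define b where "b = x / 2"
  define c where "c = (x + 2 * pi) / 2"
  have bc: "0 < b" "b < x" "x < c" "c < 2 * pi" using assms by (auto simp: b_def c_def)
  have "((\<lambda>y. integral {b..y} (chord a)) has_real_derivative chord a x) (at x within {b..c})"
    using bc by (intro integral_has_real_derivative continuous_on_chord) auto
  then have "((\<lambda>y. integral {b..y} (chord a)) has_real_derivative chord a x) (at x)"
    using bc by (simp add: at_within_Icc_at)
  from DERIV_add[OF DERIV_const this]
  have "((\<lambda>y. chord_integral a b + integral {b..y} (chord a)) has_real_derivative chord a x) (at x)"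
    by simp
  then show ?thesis
  proof (rule has_field_derivative_transform_within_open[where S = "{b<..<c}"])
    fix y assume y: "y \<in> {b<..<c}"
    have "chord a integrable_on {0..y}"
      by (rule integrable_on_subinterval[OF chord_integrable[OF assms(1)]]) (use y bc in auto)
    then show "chord_integral a b + integral {b..y} (chord a) = chord_integral a y"
      unfolding chord_integral_def using y bc by (intro Henstock_Kurzweil_Integration.integral_combine) auto
  qed (use bc in auto)
qed

lemma chord_integral_reflect:
  assumes "a < 1" "0 \<le> x" "x \<le> 2 * pi"
  shows "chord_integral a (2 * pi) - chord_integral a (2 * pi - x) = chord_integral a x"
proof -
  have int: "chord a integrable_on {0..x}"
    by (rule integrable_on_subinterval[OF chord_integrable[OF assms(1)]]) (use assms in auto)
  have "((\<lambda>\<theta>. chord a ((-1) *\<^sub>R \<theta> + 2 * pi)) has_integral chord_integral a x)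
     ((\<lambda>\<theta>. (1 / (-1)) *\<^sub>R \<theta> + -((1 / (-1)) *\<^sub>R (2 * pi))) ` cbox 0 x)"
    using has_integral_affinity[of "chord a" _ 0 x "-1" "2 * pi"] integrable_integral[OF int] by (simp add: chord_integral_def)
  moreover have "(\<lambda>\<theta>. (1 / (-1)) *\<^sub>R \<theta> + -((1 / (-1)) *\<^sub>R (2 * pi))) ` cbox 0 x = {2 * pi - x..2 * pi}"
    by (auto intro!: image_eqI[of _ _ "2 * pi - _"])
  ultimately have "(chord a has_integral chord_integral a x) {2 * pi - x..2 * pi}"
    by (simp add: chord_reflect)
  then have "integral {2 * pi - x..2 * pi} (chord a) = chord_integral a x"
    by (rule integral_unique)
  moreover have "chord_integral a (2 * pi - x) + integral {2 * pi - x..2 * pi} (chord a) = chord_integral a (2 * pi)"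
    unfolding chord_integral_def using assms by (intro Henstock_Kurzweil_Integration.integral_combine chord_integrable) auto
  ultimately show ?thesis by simp
qed

lemma chord_integral_diff_le:
  assumes "a < 1" "0 < h" "h \<le> pi"
  shows "\<bar>chord_integral a h - h powr (1 - a) / (1 - a)\<bar> \<le> \<bar>a\<bar> * 2 powr \<bar>a + 1\<bar> * h powr (3 - a)"
proof -
  let ?K = "\<bar>a\<bar> * 2 powr \<bar>a + 1\<bar>"
  have int: "chord a integrable_on {0..h}"
    by (rule integrable_on_subinterval[OF chord_integrable[OF assms(1)]]) (use assms in auto)
  have p: "((\<lambda>x. x powr (- a)) has_integral h powr (1 - a) / (1 - a)) {0..h}"
    using has_integral_powr_from_0[of "- a" h] assms by simp
  have "chord_integral a h - h powr (1 - a) / (1 - a) = integral {0..h} (\<lambda>x. chord a x - x powr (- a))"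
    unfolding chord_integral_def using int p by (subst integral_diff) (auto simp: integrable_on_def integral_unique)
  also have "norm \<dots> \<le> integral {0..h} (\<lambda>x. ?K * h powr (2 - a))"
  proof (rule integral_norm_bound_integral)
    show "(\<lambda>x. chord a x - x powr (- a)) integrable_on {0..h}"
      using int p by (intro integrable_diff) (auto simp: integrable_on_def)
    fix x assume x: "x \<in> {0..h}"
    show "norm (chord a x - x powr (- a)) \<le> ?K * h powr (2 - a)"
    proof (cases "x = 0")
      case False
      then have "norm (chord a x - x powr (- a)) \<le> ?K * x powr (2 - a)"
        using chord_diff_le[of x a] x assms by simp
      also have "\<dots> \<le> ?K * h powr (2 - a)"
        using x assms by (intro mult_left_mono powr_mono2) auto
      finally show ?thesis .
    qed (simp add: chord_def)
  qed auto
  also have "\<dots> = ?K * (h * h powr (2 - a))" using assms by simp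
  also have "h * h powr (2 - a) = h powr (3 - a)"
    using assms powr_add[of h 1 "2 - a"] by simp
  finally show ?thesis by simp
qed

section \<open>Midpoint defects for real exponents\<close>

definition defect :: "real \<Rightarrow> nat \<Rightarrow> real" where
  "defect s j = (1 - s) * (real j + 1/2) powr (- s)
     - ((real j + 1) powr (1 - s) - real j powr (1 - s))
     + (1 - s) * (- s) / 24 * ((real j + 1) powr (- s - 1) - real j powr (- s - 1))"

lemma midpoint_defect_of_real: "midpoint_defect (of_real s) j = of_real (defect s j)"
proof -
  have "of_real x powr (of_real y) = (of_real (x powr y) :: complex)" if "x \<ge> 0" for x y
    using powr_of_real[OF that] .
  from this[of "real j + 1/2" "- s"] this[of "real j + 1" "1 - s"] this[of "real j" "1 - s"]
    this[of "real j + 1" "- s - 1"] this[of "real j" "- s - 1"]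
  show ?thesis by (simp add: midpoint_defect_def defect_def)
qed

text \<open>The fifth derivative of \<open>x powr (1 - s)\<close> has a factor
  \<open>- 1 - s\<close>. Keeping \<open>s + 1\<close> visible lets the tails be controlled by sums
  of \<open>(s + 1) * j powr (- s - 2)\<close> even at \<open>s = -1\<close>.\<close>

lemma abs_defect_le:
  assumes "-1 \<le> s" "s < 1"
  shows "\<bar>defect s (Suc j)\<bar> \<le> (s + 1) * 48 * real (Suc j) powr (- s - 4)"
proof -
  have "norm (midpoint_defect (of_real s) (Suc j)) \<le> norm (ffact1 (of_real s) 5) * real (Suc j) powr (- s - 4)"
    using norm_midpoint_defect_le[of "of_real s" "Suc j"] assms by simp
  moreover have "ffact1 (of_real s) 5 = of_real ((1 - s) * (- s) * (- 1 - s) * (- 2 - s) * (- 3 - s))"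
    by (simp add: eval_nat_numeral)
  moreover have "\<bar>(1 - s) * (- s) * (- 1 - s) * (- 2 - s) * (- 3 - s)\<bar> \<le> 2 * 1 * (s + 1) * 3 * 8"
    unfolding abs_mult using assms by (intro mult_mono) auto
  ultimately have "\<bar>defect s (Suc j)\<bar> \<le> (2 * 1 * (s + 1) * 3 * 8) * real (Suc j) powr (- s - 4)"
    unfolding midpoint_defect_of_real by (simp only: norm_of_real) (erule order_trans, rule mult_right_mono, simp_all)
  then show ?thesis by (simp add: mult_ac)
qed

lemma zeta_defect_formula:
  assumes "-1 \<le> s" "s < 1"
  shows "(1 - s) * ((2 powr s - 1) * Re (riemann_zeta (of_real s))) =
    (\<Sum>j. defect s (Suc j)) + (1 - s) * 2 powr s - 1 - (1 - s) * s / 24"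
    and "summable (\<lambda>j. defect s (Suc j))"
proof -
  have "summable (\<lambda>j. midpoint_defect (of_real s) (Suc j))"
    using summable_midpoint_defect[of "of_real s"] assms by simp
  then have sum: "summable (\<lambda>j. of_real (defect s (Suc j)) :: complex)"
    by (simp only: midpoint_defect_of_real)
  then show s: "summable (\<lambda>j. defect s (Suc j))" by (simp add: summable_complex_of_real)
  have "of_real s \<noteq> (1::complex)" using assms by simp
  then have eq: "(1 - of_real s) * ((2 powr of_real s - 1) * riemann_zeta (of_real s)) =
    (\<Sum>j. midpoint_defect (of_real s) (Suc j)) + (1 - of_real s) * 2 powr of_real s - 1 - (1 - of_real s) * of_real s / 24"
    using zeta_midpoint_formula[of "of_real s"] assms by simp
  have two: "2 powr (of_real s :: complex) = of_real (2 powr s)"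
    using powr_of_real[of 2 s] by simp
  have ser: "(\<Sum>j. midpoint_defect (of_real s) (Suc j)) = of_real (\<Sum>j. defect s (Suc j))"
    using suminf_of_real[OF s, where ?'a = complex] by (simp only: midpoint_defect_of_real)
  have "of_real ((1 - s) * (2 powr s - 1)) * riemann_zeta (of_real s) =
     of_real ((\<Sum>j. defect s (Suc j)) + (1 - s) * 2 powr s - 1 - (1 - s) * s / 24)"
    using eq unfolding two ser by (simp add: mult.assoc)
  then have "Re (of_real ((1 - s) * (2 powr s - 1)) * riemann_zeta (of_real s)) =
     (\<Sum>j. defect s (Suc j)) + (1 - s) * 2 powr s - 1 - (1 - s) * s / 24"
    by (simp only: Re_complex_of_real)
  moreover have "Re (of_real c * z) = c * Re z" for c z by simp
  ultimately show "(1 - s) * ((2 powr s - 1) * Re (riemann_zeta (of_real s))) =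
    (\<Sum>j. defect s (Suc j)) + (1 - s) * 2 powr s - 1 - (1 - s) * s / 24"
    by (simp only: mult.assoc)
qed

section \<open>Asymptotics of midpoint sums of the chord kernel\<close>

text \<open>\<open>T1\<close> replaces the most singular term by the pure power at a gain of two
  orders, \<open>T2\<close> has that lower order already, and both carry the factor
  \<open>s + 1\<close>. The term \<open>T3\<close> does not, whence the extra \<open>+ 1\<close> in
  the bound.\<close>

lemma chord4_diff_le:
  assumes s: "-1 \<le> s" "s < 1"
  obtains C where "C \<ge> 0" "\<And>\<theta>. 0 < \<theta> \<Longrightarrow> \<theta> \<le> pi \<Longrightarrow>
    \<bar>chord4 s \<theta> - s * (s + 1) * (s + 2) * (s + 3) * \<theta> powr (- s - 4)\<bar> \<le> C * ((s + 1) * \<theta> powr (- s - 2) + 1)"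
proof -
  define K1 where "K1 = \<bar>s * (s + 2) * (s + 3)\<bar> * (\<bar>s + 4\<bar> * 2 powr \<bar>s + 5\<bar>)"
  define k where "k = s * (s + 2)\<^sup>2 / 4 + s ^ 3 / 4"
  define K2 where "K2 = \<bar>k\<bar> * 2 powr \<bar>s + 2\<bar>"
  define K3 where "K3 = s ^ 4 / 16 * (2 powr \<bar>s\<bar> * 16)"
  have K: "K1 \<ge> 0" "K2 \<ge> 0" "K3 \<ge> 0" by (auto simp: K1_def K2_def K3_def)
  have "\<bar>chord4 s \<theta> - s * (s + 1) * (s + 2) * (s + 3) * \<theta> powr (- s - 4)\<bar> \<le> (K1 + K2 + K3) * ((s + 1) * \<theta> powr (- s - 2) + 1)"
    if \<theta>: "0 < \<theta>" "\<theta> \<le> pi" for \<theta>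
  proof -
    let ?p = "\<theta> powr (- s - 2)"
    define T1 where "T1 = s * (s + 1) * (s + 2) * (s + 3) * (chord (s + 4) \<theta> - \<theta> powr (- (s + 4)))"
    define T2 where "T2 = (s + 1) * k * chord (s + 2) \<theta>"
    define T3 where "T3 = s ^ 4 / 16 * chord s \<theta>"
    have e: "- (s + 4) = - s - 4" "2 - (s + 4) = - s - 2" "- (s + 2) = - s - 2" "s + 4 + 1 = s + 5" "s + 2 + 2 = s + 4" by simp_all
    have eq: "chord4 s \<theta> - s * (s + 1) * (s + 2) * (s + 3) * \<theta> powr (- s - 4) = T1 - T2 + T3"
      unfolding chord4_def chord2_def T1_def T2_def T3_def k_def e
      by (simp add: field_simps power2_eq_square power3_eq_cube power4_eq_xxxx)
    have "\<bar>T1\<bar> = (s + 1) * (\<bar>s * (s + 2) * (s + 3)\<bar> * \<bar>chord (s + 4) \<theta> - \<theta> powr (- (s + 4))\<bar>)"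
      using s by (simp add: T1_def abs_mult)
    also have "\<dots> \<le> (s + 1) * (\<bar>s * (s + 2) * (s + 3)\<bar> * (\<bar>s + 4\<bar> * 2 powr \<bar>s + 5\<bar> * ?p))"
      using chord_diff_le[OF \<theta>, of "s + 4"] s unfolding e by (intro mult_left_mono) auto
    finally have 1: "\<bar>T1\<bar> \<le> K1 * ((s + 1) * ?p)" by (simp add: K1_def mult_ac)
    have "\<bar>T2\<bar> = (s + 1) * (\<bar>k\<bar> * chord (s + 2) \<theta>)"
      using s chord_nonneg by (simp add: T2_def abs_mult)
    also have "\<dots> \<le> (s + 1) * (\<bar>k\<bar> * (2 powr \<bar>s + 2\<bar> * ?p))"
      using chord_le[OF \<theta>, of "s + 2"] s unfolding e by (intro mult_left_mono) auto
    finally have 2: "\<bar>T2\<bar> \<le> K2 * ((s + 1) * ?p)" by (simp add: K2_def mult_ac)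
    have "\<theta> powr (- s) \<le> 16 * ((s + 1) * ?p + 1)"
    proof (cases "s \<le> 0")
      case True
      have "\<theta> powr (- s) \<le> 4 powr (- s)" using True \<theta> pi_less_4 by (intro powr_mono2) auto
      also have "\<dots> \<le> 4 powr 1" using s by (intro powr_mono) auto
      finally have "\<theta> powr (- s) \<le> 16" by simp
      moreover have "0 \<le> (s + 1) * ?p" using s by simp
      ultimately have "\<theta> powr (- s) \<le> 16" "16 \<le> 16 * ((s + 1) * ?p + 1)" by simp_all
      then show ?thesis by (rule order_trans)
    next
      case False
      have "\<theta>\<^sup>2 \<le> 4\<^sup>2" using \<theta> pi_less_4 by (intro power_mono) auto
      have "\<theta> powr (- s) = \<theta>\<^sup>2 * ?p"
        using \<theta> powr_add[of \<theta> 2 "- s - 2"] by (simp add: powr_numeral)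
      also have "\<dots> \<le> 16 * ?p" using \<open>\<theta>\<^sup>2 \<le> 4\<^sup>2\<close> by (intro mult_right_mono) auto
      also have "\<dots> \<le> 16 * ((s + 1) * ?p + 1)" using False by (simp add: distrib_right add_increasing)
      finally show ?thesis .
    qed
    then have "\<bar>T3\<bar> \<le> s ^ 4 / 16 * (2 powr \<bar>s\<bar> * (16 * ((s + 1) * ?p + 1)))"
      unfolding T3_def using chord_le[OF \<theta>, of s] chord_nonneg[of s \<theta>]
      by (subst abs_of_nonneg) (auto intro!: mult_left_mono intro: order_trans[OF _ mult_left_mono])
    then have 3: "\<bar>T3\<bar> \<le> K3 * ((s + 1) * ?p + 1)" by (simp only: K3_def mult.assoc)
    have "\<bar>T1 - T2 + T3\<bar> \<le> \<bar>T1\<bar> + \<bar>T2\<bar> + \<bar>T3\<bar>" by linarith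
    also have "\<dots> \<le> K1 * ((s + 1) * ?p + 1) + K2 * ((s + 1) * ?p + 1) + K3 * ((s + 1) * ?p + 1)"
      using 1 2 3 K by (intro add_mono) (auto simp: distrib_left)
    finally show ?thesis unfolding eq by (simp add: algebra_simps)
  qed
  then show thesis using K that[of "K1 + K2 + K3"] by simp
qed

text \<open>Index 0 is a primitive of \<open>\<theta> powr (- s)\<close>, index 1 the power itself,
  higher indices its derivatives, in step with \<open>chord_family\<close>.\<close>

definition powr_family :: "real \<Rightarrow> nat \<Rightarrow> real \<Rightarrow> real" where
  "powr_family s i \<theta> = (\<Prod>k<i. 1 - s - real k) / (1 - s) * \<theta> powr (1 - s - real i)"

lemma powr_family_has_derivative:
  "s \<noteq> 1 \<Longrightarrow> 0 < \<theta> \<Longrightarrow> (powr_family s i has_real_derivative powr_family s (Suc i) \<theta>) (at \<theta>)"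
  unfolding powr_family_def[abs_def]
  by (auto intro!: derivative_eq_intros simp: diff_diff_eq add.commute add.left_commute)

text \<open>By homogeneity the rule with step \<open>h\<close> errs on each cell by the unit step
  defect times \<open>h powr (1 - s) / (1 - s)\<close>. The singular part thus yields an exact
  partial sum of the defect series behind the zeta constant.\<close>

lemma powr_family_midpoint:
  assumes s: "s < 1" and h: "h > 0" and m: "m \<ge> 1" "m \<le> M"
  shows "h * (\<Sum>j=m..<M. powr_family s 1 (h * real j + h / 2)) - (powr_family s 0 (h * real M) - powr_family s 0 (h * real m))
      + h\<^sup>2 / 24 * (powr_family s 2 (h * real M) - powr_family s 2 (h * real m)) =
    h powr (1 - s) / (1 - s) * (\<Sum>j=m..<M. defect s j)"
  using m(2)
proof (induction M rule: dec_induct)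
  case (step n)
  have n: "n \<ge> 1" using step m by simp
  define H where "H = h powr (1 - s)"
  have h1: "h * h powr (- s) = H" "h\<^sup>2 * h powr (- s - 1) = H"
    using h powr_add[of h 1 "- s"] powr_add[of h 2 "- s - 1"] by (simp_all add: H_def powr_numeral)
  have P: "powr_family s 0 (h * x) = H / (1 - s) * x powr (1 - s)"
    "h * powr_family s 1 (h * x) = H * x powr (- s)"
    "h\<^sup>2 * powr_family s 2 (h * x) = - s * H * x powr (- s - 1)" if "x > 0" for x
  proof -
    have e: "1 - s - 2 = - s - 1" by simp
    have p2: "(\<Prod>k<2. 1 - s - real k) = (1 - s) * (- s)" by (simp add: eval_nat_numeral)
    show "powr_family s 0 (h * x) = H / (1 - s) * x powr (1 - s)"
      using h that by (simp add: powr_family_def H_def powr_mult)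
    show "h * powr_family s 1 (h * x) = H * x powr (- s)"
      using h that s by (simp add: powr_family_def powr_mult h1(1)[symmetric])
    show "h\<^sup>2 * powr_family s 2 (h * x) = - s * H * x powr (- s - 1)"
      using h that s unfolding powr_family_def p2 by (simp add: e powr_mult h1(2)[symmetric])
  qed
  have "h * powr_family s 1 (h * real n + h / 2) - (powr_family s 0 (h * real (Suc n)) - powr_family s 0 (h * real n))
      + h\<^sup>2 / 24 * (powr_family s 2 (h * real (Suc n)) - powr_family s 2 (h * real n)) = H / (1 - s) * defect s n"
  proof -
    have "h * real n + h / 2 = h * (real n + 1/2)" by (simp add: algebra_simps)
    moreover have "h\<^sup>2 / 24 * (powr_family s 2 (h * real (Suc n)) - powr_family s 2 (h * real n)) =
       (h\<^sup>2 * powr_family s 2 (h * real (Suc n)) - h\<^sup>2 * powr_family s 2 (h * real n)) / 24"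
      by (simp add: algebra_simps diff_divide_distrib)
    moreover have "H = H / (1 - s) * (1 - s)" using s by simp
    ultimately show ?thesis
      using P[of "real n"] P[of "real (Suc n)"] P[of "real n + 1/2"] n s
      by (simp add: defect_def field_simps)
  qed
  then show ?case using step by (simp add: H_def algebra_simps)
qed simp


text \<open>Shaped as the sequence \<open>U\<close> of \<open>midpoint_rule_composite\<close>; only
  the indices up to 5 are meaningful.\<close>

definition chord_family :: "real \<Rightarrow> nat \<Rightarrow> real \<Rightarrow> real" where
  "chord_family s i = [chord_integral s, chord s, chord1 s, chord2 s, chord3 s, chord4 s] ! i"

lemma chord_family_has_derivative:
  assumes "s < 1" "0 < \<theta>" "\<theta> < 2 * pi" "i \<le> 4"
  shows "(chord_family s i has_real_derivative chord_family s (Suc i) \<theta>) (at \<theta>)"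
proof -
  have "i = 0 \<or> i = 1 \<or> i = 2 \<or> i = 3 \<or> i = 4" using assms(4) by arith
  then show ?thesis
    using chord_integral_has_derivative[of s \<theta>] chord_has_derivative[of \<theta> s] chord1_has_derivative[of \<theta> s]
      chord2_has_derivative[of \<theta> s] chord3_has_derivative[of \<theta> s] assms
    by (elim disjE) (simp_all add: chord_family_def eval_nat_numeral)
qed

text \<open>Subtracting from the chord kernel its two singular parts \<open>\<theta>\<^sup>-\<^sup>s\<close> and
  \<open>(2\<pi> - \<theta>)\<^sup>-\<^sup>s\<close> leaves a function whose fourth derivative grows only like \<open>\<theta>\<^sup>-\<^sup>s\<^sup>-\<^sup>2\<close> at the endpoints,
  so that the fourth order errors of the midpoint rule can be summed over the cells.\<close>

definition regular_family :: "real \<Rightarrow> nat \<Rightarrow> real \<Rightarrow> real" where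
  "regular_family s i \<theta> = chord_family s i \<theta> - powr_family s i \<theta> + (-1) ^ i * powr_family s i (2 * pi - \<theta>)"

text \<open>Reflection contributes a sign with each derivative, which \<open>(-1) ^ i\<close>
  absorbs; at index 1 both powers are therefore subtracted from the kernel.\<close>

lemma regular_family_has_derivative:
  assumes "s < 1" "0 < \<theta>" "\<theta> < 2 * pi" "i \<le> 4"
  shows "(regular_family s i has_real_derivative regular_family s (Suc i) \<theta>) (at \<theta>)"
proof -
  have "((\<lambda>\<theta>. powr_family s i (2 * pi - \<theta>)) has_real_derivative powr_family s (Suc i) (2 * pi - \<theta>) * (-1)) (at \<theta>)"
    by (rule DERIV_chain2[OF powr_family_has_derivative]) (use assms in \<open>auto intro!: derivative_eq_intros\<close>)
  then have "((\<lambda>\<theta>. chord_family s i \<theta> - powr_family s i \<theta> + (-1) ^ i * powr_family s i (2 * pi - \<theta>)) has_real_derivative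
     (chord_family s (Suc i) \<theta> - powr_family s (Suc i) \<theta>) + (-1) ^ i * (powr_family s (Suc i) (2 * pi - \<theta>) * (-1))) (at \<theta>)"
    using assms by (intro DERIV_add DERIV_diff DERIV_cmult chord_family_has_derivative powr_family_has_derivative) auto
  then show ?thesis by (simp add: regular_family_def[abs_def] algebra_simps)
qed

text \<open>On the left half \<open>chord4_diff_le\<close> removes the near singularity, and the far
  power is harmless since \<open>2 * pi - \<theta>\<close> exceeds 1. Reflection gives the right
  half.\<close>

lemma regular_family_5_le:
  assumes s: "-1 \<le> s" "s < 1"
  obtains C where "C \<ge> 0" "\<And>\<theta>. 0 < \<theta> \<Longrightarrow> \<theta> < 2 * pi \<Longrightarrow>
    \<bar>regular_family s 5 \<theta>\<bar> \<le> C * ((s + 1) * (\<theta> powr (- s - 2) + (2 * pi - \<theta>) powr (- s - 2)) + 1)"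
proof -
  define r where "r = s * (s + 1) * (s + 2) * (s + 3)"
  have r: "powr_family s 5 \<theta> = r * \<theta> powr (- s - 4)" for \<theta>
  proof -
    have "(\<Prod>k<5. 1 - s - real k) = (1 - s) * r" by (simp add: eval_nat_numeral r_def) algebra
    then show ?thesis using s by (simp add: powr_family_def minus_diff_commute)
  qed
  obtain C where C: "C \<ge> 0" "\<And>\<theta>. 0 < \<theta> \<Longrightarrow> \<theta> \<le> pi \<Longrightarrow>
    \<bar>chord4 s \<theta> - r * \<theta> powr (- s - 4)\<bar> \<le> C * ((s + 1) * \<theta> powr (- s - 2) + 1)"
    unfolding r_def using chord4_diff_le[OF s] by metis
  have absr: "\<bar>r\<bar> \<le> (s + 1) * 12"
  proof -
    have "\<bar>r\<bar> \<le> 1 * (s + 1) * 3 * 4" unfolding r_def abs_mult using s by (intro mult_mono) auto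
    then show ?thesis by simp
  qed
  have f: "regular_family s 5 \<theta> = chord4 s \<theta> - r * \<theta> powr (- s - 4) - r * (2 * pi - \<theta>) powr (- s - 4)" for \<theta>
  proof -
    have "chord_family s 5 = chord4 s" by (simp add: chord_family_def eval_nat_numeral)
    then show ?thesis by (simp add: regular_family_def r)
  qed
  have half: "\<bar>regular_family s 5 \<theta>\<bar> \<le> (C + 12) * ((s + 1) * (\<theta> powr (- s - 2) + (2 * pi - \<theta>) powr (- s - 2)) + 1)"
    if \<theta>: "0 < \<theta>" "\<theta> \<le> pi" for \<theta>
  proof -
    define p where "p = \<theta> powr (- s - 2)"
    define q where "q = (2 * pi - \<theta>) powr (- s - 2)"
    have pq: "p \<ge> 0" "q \<ge> 0" by (auto simp: p_def q_def)
    have "(2 * pi - \<theta>) powr (- s - 4) \<le> q"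
    proof -
      have "(2 * pi - \<theta>) powr (- s - 4) \<le> (2 * pi - \<theta>) powr (- s - 2)"
        using \<theta> pi_gt3 by (intro powr_mono) auto
      then show ?thesis by (simp add: q_def)
    qed
    then have "\<bar>r * (2 * pi - \<theta>) powr (- s - 4)\<bar> \<le> ((s + 1) * 12) * q"
      unfolding abs_mult using absr s by (intro mult_mono) auto
    moreover have "\<bar>chord4 s \<theta> - r * \<theta> powr (- s - 4)\<bar> \<le> C * ((s + 1) * p + 1)"
      using C(2)[OF \<theta>] by (simp add: p_def)
    ultimately have "\<bar>regular_family s 5 \<theta>\<bar> \<le> C * ((s + 1) * p + 1) + 12 * ((s + 1) * q)"
      unfolding f by linarith
    also have "\<dots> \<le> C * ((s + 1) * (p + q) + 1) + 12 * ((s + 1) * (p + q) + 1)"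
      using C(1) s pq by (intro add_mono mult_left_mono) (auto simp: distrib_left)
    finally show ?thesis by (simp add: p_def q_def algebra_simps)
  qed
  have "\<bar>regular_family s 5 \<theta>\<bar> \<le> (C + 12) * ((s + 1) * (\<theta> powr (- s - 2) + (2 * pi - \<theta>) powr (- s - 2)) + 1)"
    if \<theta>: "0 < \<theta>" "\<theta> < 2 * pi" for \<theta>
  proof (cases "\<theta> \<le> pi")
    case False
    then show ?thesis using half[of "2 * pi - \<theta>"] \<theta> unfolding f chord_reflect by (simp add: add.commute diff_right_commute)
  qed (use half \<theta> in auto)
  then show thesis using that[of "C + 12"] C(1) by simp
qed

text \<open>At \<open>s = -1\<close> the sum is harmonic and unbounded, but the factor
  \<open>s + 1\<close> vanishes; this is why the factor stays inside the statement.\<close>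

lemma sum_Suc_powr_bound:
  fixes s :: real assumes "-1 \<le> s"
  obtains Z where "Z \<ge> 0" "\<And>n. (s + 1) * (\<Sum>j=1..<n. real j powr (- s - 2)) \<le> Z"
    "summable (\<lambda>j. (s + 1) * real (Suc j) powr (- s - 2))"
proof (cases "s = -1")
  case False
  have sum: "summable (\<lambda>j. real (Suc j) powr (- s - 2))"
    using assms False by (intro summable_Suc_powr) auto
  have "(\<Sum>j=1..<n. real j powr (- s - 2)) \<le> (\<Sum>j. real (Suc j) powr (- s - 2))" for n
  proof -
    have "(\<Sum>j=1..<n. real j powr (- s - 2)) = (\<Sum>j<n - 1. real (Suc j) powr (- s - 2))"
      by (rule sum.reindex_bij_witness[of _ Suc "\<lambda>j. j - 1"]) auto
    also have "\<dots> \<le> (\<Sum>j. real (Suc j) powr (- s - 2))"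
      by (intro sum_le_suminf sum) auto
    finally show ?thesis .
  qed
  moreover have "0 \<le> (s + 1) * (\<Sum>j. real (Suc j) powr (- s - 2))"
    using assms sum by (intro mult_nonneg_nonneg suminf_nonneg) auto
  ultimately show thesis
    using assms sum by (intro that[of "(s + 1) * (\<Sum>j. real (Suc j) powr (- s - 2))"])
      (auto intro!: mult_left_mono summable_mult)
qed (use that[of 0] in auto)


text \<open>On the inner cells the fourth order rule is applied to the kernel minus its two powers,
  whose own share is an exact sum of defects. On the two outer cells kernel, derivative and integral
  are compared with the pure power. The zeta identity then cancels all main terms.\<close>

lemma chord_midpoint_sum_asymptotics:
  assumes s: "-1 \<le> s" "s < 1"
  obtains C where "C \<ge> 0" "\<And>N. N \<ge> 3 \<Longrightarrow>
    \<bar>(\<Sum>j<N. chord s ((2 * real j + 1) * pi / N)) -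
      (chord_integral s (2 * pi) / (2 * pi) * N
        + 2 * (2 powr s - 1) / (2 * pi) powr s * Re (riemann_zeta (of_real s)) * real N powr s)\<bar>
    \<le> C * real N powr (s - 2)"
proof -
  define D where "D = (\<lambda>j. defect s (Suc j))"
  define \<zeta> where "\<zeta> = (2 powr s - 1) * Re (riemann_zeta (of_real s))"
  have \<zeta>: "(1 - s) * \<zeta> = suminf D + (1 - s) * 2 powr s - 1 - (1 - s) * s / 24" and sumD: "summable D"
    using zeta_defect_formula[OF s] by (simp_all add: D_def \<zeta>_def)
  obtain Z where Z: "Z \<ge> 0" "\<And>n. (s + 1) * (\<Sum>j=1..<n. real j powr (- s - 2)) \<le> Z"
    "summable (\<lambda>j. (s + 1) * real (Suc j) powr (- s - 2))"
    using sum_Suc_powr_bound[OF s(1)] by blast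
  obtain C1 where C1: "C1 \<ge> 0" "\<And>\<theta>. 0 < \<theta> \<Longrightarrow> \<theta> < 2 * pi \<Longrightarrow>
    \<bar>regular_family s 5 \<theta>\<bar> \<le> C1 * ((s + 1) * (\<theta> powr (- s - 2) + (2 * pi - \<theta>) powr (- s - 2)) + 1)"
    using regular_family_5_le[OF s] by metis
  define T where "T = 48 * (\<Sum>j. (s + 1) * real (Suc j) powr (- s - 2))"
  have T: "T \<ge> 0" unfolding T_def using Z(3) s by (intro mult_nonneg_nonneg suminf_nonneg) auto
  \<comment> \<open>All indices of the tail are at least \<open>N / 2\<close>, so
    \<open>j powr (- s - 4)\<close> is at most \<open>4 / N ^ 2\<close> times
    \<open>j powr (- s - 2)\<close>.\<close>
  have tail: "\<bar>suminf D - (\<Sum>j=1..<N-1. defect s j)\<bar> \<le> T * (4 / (real N)\<^sup>2)" if N: "N \<ge> 3" for N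
  proof -
    define M where "M = N - 2"
    have M: "real M + 1 \<ge> real N / 2" using N by (simp add: M_def of_nat_diff)
    have "(\<Sum>j=1..<N-1. defect s j) = (\<Sum>j<M. D j)"
      unfolding D_def by (rule sum.reindex_bij_witness[of _ Suc "\<lambda>j. j - 1"]) (auto simp: M_def)
    then have "suminf D - (\<Sum>j=1..<N-1. defect s j) = (\<Sum>j. D (j + M))"
      using suminf_split_initial_segment[OF sumD, of M] by simp
    also have "\<bar>\<dots>\<bar> \<le> (\<Sum>j. 48 * (4 / (real N)\<^sup>2) * ((s + 1) * real (Suc (j + M)) powr (- s - 2)))"
    proof -
      have Zs: "summable (\<lambda>j. 48 * (4 / (real N)\<^sup>2) * ((s + 1) * real (Suc (j + M)) powr (- s - 2)))"
        by (rule summable_mult[OF summable_ignore_initial_segment[OF Z(3)]])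
      have Dle: "\<bar>D (j + M)\<bar> \<le> 48 * (4 / (real N)\<^sup>2) * ((s + 1) * real (Suc (j + M)) powr (- s - 2))" for j
      proof -
        let ?x = "real (Suc (j + M))"
        have "?x powr (- s - 4) = ?x powr (- s - 2) / ?x\<^sup>2"
          using powr_add[of ?x "- s - 4" 2] by (simp add: powr_numeral minus_diff_commute del: of_nat_Suc)
        also have "\<dots> \<le> ?x powr (- s - 2) / (real N / 2)\<^sup>2"
          using M N by (intro divide_left_mono power_mono) auto
        also have "\<dots> = 4 / (real N)\<^sup>2 * ?x powr (- s - 2)" by (simp add: power_divide)
        finally have "?x powr (- s - 4) \<le> 4 / (real N)\<^sup>2 * ?x powr (- s - 2)" .
        then have "(s + 1) * 48 * ?x powr (- s - 4) \<le> (s + 1) * 48 * (4 / (real N)\<^sup>2 * ?x powr (- s - 2))"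
          using s by (intro mult_left_mono) auto
        with abs_defect_le[OF s, of "j + M"]
        have "\<bar>D (j + M)\<bar> \<le> (s + 1) * 48 * (4 / (real N)\<^sup>2 * ?x powr (- s - 2))"
          unfolding D_def by (rule order_trans)
        also have "\<dots> = 48 * (4 / (real N)\<^sup>2) * ((s + 1) * ?x powr (- s - 2))" by (simp only: mult_ac)
        finally show ?thesis .
      qed
      then have sa: "summable (\<lambda>j. \<bar>D (j + M)\<bar>)"
        by (intro summable_comparison_test'[OF Zs, of 0]) simp
      have "(\<Sum>j. \<bar>D (j + M)\<bar>) \<le> (\<Sum>j. 48 * (4 / (real N)\<^sup>2) * ((s + 1) * real (Suc (j + M)) powr (- s - 2)))"
        by (rule suminf_le[OF Dle sa Zs])
      with summable_rabs[OF sa] show ?thesis by (rule order_trans)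
    qed
    also have "\<dots> = 48 * (4 / (real N)\<^sup>2) * (\<Sum>j. (s + 1) * real (Suc (j + M)) powr (- s - 2))"
      using summable_ignore_initial_segment[OF Z(3), of M] by (rule suminf_mult)
    also have "\<dots> \<le> 48 * (4 / (real N)\<^sup>2) * (\<Sum>j. (s + 1) * real (Suc j) powr (- s - 2))"
    proof (rule mult_left_mono)
      have "0 \<le> (\<Sum>j<M. (s + 1) * real (Suc j) powr (- s - 2))" using s by (intro sum_nonneg) auto
      then show "(\<Sum>j. (s + 1) * real (Suc (j + M)) powr (- s - 2)) \<le> (\<Sum>j. (s + 1) * real (Suc j) powr (- s - 2))"
        using suminf_split_initial_segment[OF Z(3), of M] by simp
    qed simp
    finally show ?thesis by (simp add: T_def mult_ac)
  qed
  \<comment> \<open>The sources of error in order: regular part on the inner cells, tail of the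
    defect series for both ends, midpoint values and integrals on the outer cells, first derivatives
    at their inner edges.\<close>
  define E where "E = C1 * (2 * Z + 112) + 2 / (1 - s) * T + 4 * (\<bar>s\<bar> * 2 powr \<bar>s + 1\<bar>)
      + (\<bar>s\<bar> * (\<bar>s + 1\<bar> * 2 powr \<bar>s + 2\<bar> + 2 powr \<bar>s + 1\<bar>)) / 12"
  have E: "E \<ge> 0" unfolding E_def using C1 Z T s by (intro add_nonneg_nonneg mult_nonneg_nonneg divide_nonneg_nonneg) auto
  have main: "\<bar>h * (\<Sum>j<N. chord s (h * real j + h / 2)) - chord_integral s (2 * pi) - 2 * h powr (1 - s) * \<zeta>\<bar> \<le> E * h powr (3 - s)"
    if N: "N \<ge> 3" and h_def: "h = 2 * pi / N" for N h
  proof -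
    define K where "K = \<bar>s\<bar> * 2 powr \<bar>s + 1\<bar>"
    define K' where "K' = \<bar>s\<bar> * (\<bar>s + 1\<bar> * 2 powr \<bar>s + 2\<bar> + 2 powr \<bar>s + 1\<bar>)"
    have hN: "h * real N = 2 * pi" using N by (simp add: h_def)
    have h: "h > 0" using N by (simp add: h_def)
    have "h * 3 \<le> h * real N" using h N by (intro mult_left_mono) auto
    then have hpi: "h < pi" using hN pi_gt_zero by linarith
    have h4: "h \<le> 4" using hpi pi_less_4 by linarith
    have hM: "h * real (N - 1) = 2 * pi - h" using N hN by (simp add: of_nat_diff right_diff_distrib)
    have rj: "h * real (N - 1 - j) = 2 * pi - h - h * real j" if "j < N" for j
    proof -
      have "real (N - 1 - j) = real N - 1 - real j" using that by linarith
      then have "h * real (N - 1 - j) = h * (real N - 1 - real j)" by simp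
      also have "\<dots> = h * real N - h - h * real j" by (simp add: right_diff_distrib)
      finally show ?thesis unfolding hN .
    qed
    define x where "x = (\<lambda>j::nat. h * real j + h / 2)"
    \<comment> \<open>The first and the last cell touch a singular end and are left out.\<close>
    define J where "J = {1..<N - 1}"
    define Qf where "Qf = h * (\<Sum>j\<in>J. chord s (x j)) - (chord_integral s (2 * pi - h) - chord_integral s h)
        + h\<^sup>2 / 24 * (chord1 s (2 * pi - h) - chord1 s h)"
    define QP where "QP = h * (\<Sum>j\<in>J. powr_family s 1 (x j)) - (powr_family s 0 (2 * pi - h) - powr_family s 0 h)
        + h\<^sup>2 / 24 * (powr_family s 2 (2 * pi - h) - powr_family s 2 h)"
    have QP: "QP = h powr (1 - s) / (1 - s) * (\<Sum>j=1..<N-1. defect s j)"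
      using powr_family_midpoint[OF s(2) h, of 1 "N - 1"] N unfolding hM by (simp add: QP_def J_def x_def)
    have refl: "(\<Sum>j\<in>J. powr_family s 1 (2 * pi - x j)) = (\<Sum>j\<in>J. powr_family s 1 (x j))"
    proof (rule sum.reindex_bij_witness[of _ "\<lambda>j. N - 1 - j" "\<lambda>j. N - 1 - j"])
      fix j assume "j \<in> J"
      then have j: "j < N" by (auto simp: J_def)
      have "x (N - 1 - j) = 2 * pi - x j"
        unfolding x_def rj[OF j] by simp
      then show "powr_family s 1 (x (N - 1 - j)) = powr_family s 1 (2 * pi - x j)" by simp
    qed (auto simp: J_def)
    \<comment> \<open>By \<open>refl\<close> the two powers have the same rule error
      \<open>QP\<close>, so \<open>Qf - 2 * QP\<close> is exactly the rule error of
      \<open>regular_family\<close>.\<close>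
    have Qdiff: "\<bar>Qf - 2 * QP\<bar> \<le> C1 * (2 * Z + 112) * h powr (3 - s)"
    proof -
      define p where "p = h powr (- s - 2)"
      define B where "B = (\<lambda>j. C1 * ((s + 1) * (p * (real j powr (- s - 2) + real (N - 1 - j) powr (- s - 2))) + 1))"
      have "\<bar>h * (\<Sum>j=1..<N-1. regular_family s 1 (0 + h * real j + h / 2))
          - (regular_family s 0 (0 + h * real (N - 1)) - regular_family s 0 (0 + h * real 1))
          + h\<^sup>2 / 24 * (regular_family s 2 (0 + h * real (N - 1)) - regular_family s 2 (0 + h * real 1))\<bar>
          \<le> h ^ 5 * (\<Sum>j=1..<N-1. B j)"
      proof (rule midpoint_rule_composite[OF h])
        show "1 \<le> N - 1" using N by simp
        show "(regular_family s i has_real_derivative regular_family s (Suc i) y) (at y)"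
          if "0 + h * real 1 \<le> y" "y \<le> 0 + h * real (N - 1)" "i \<le> 4" for i y
          using that h s(2) unfolding hM by (intro regular_family_has_derivative) auto
        show "\<bar>regular_family s 5 y\<bar> \<le> B j"
          if j: "1 \<le> j" "j < N - 1" and y: "0 + h * real j \<le> y" "y \<le> 0 + h * real (Suc j)" for j y
        proof -
          have y0: "0 < h * real j" "0 < h * real (N - 1 - j)" using h j by auto
          have "h * real (N - 1 - j) = 2 * pi - h * real (Suc j)"
            by (subst rj) (use j in \<open>simp_all add: distrib_left\<close>)
          then have y1: "h * real (N - 1 - j) \<le> 2 * pi - y" using y by simp
          have "y powr (- s - 2) \<le> (h * real j) powr (- s - 2)"
            using y y0 s by (intro powr_mono2') auto
          moreover have "(2 * pi - y) powr (- s - 2) \<le> (h * real (N - 1 - j)) powr (- s - 2)"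
            by (rule powr_mono2'[OF _ y0(2) y1]) (use s in auto)
          ultimately have pp: "y powr (- s - 2) + (2 * pi - y) powr (- s - 2) \<le> p * (real j powr (- s - 2) + real (N - 1 - j) powr (- s - 2))"
            using h by (simp add: powr_mult p_def distrib_left)
          have "\<bar>regular_family s 5 y\<bar> \<le> C1 * ((s + 1) * (y powr (- s - 2) + (2 * pi - y) powr (- s - 2)) + 1)"
            using y y0(1) less_le_trans[OF y0(2) y1] by (intro C1(2)) linarith+
          also have "\<dots> \<le> B j"
            unfolding B_def using pp s C1(1) by (intro mult_left_mono add_right_mono) auto
          finally show ?thesis .
        qed
      qed
      also have "h * (\<Sum>j=1..<N-1. regular_family s 1 (0 + h * real j + h / 2))
          - (regular_family s 0 (0 + h * real (N - 1)) - regular_family s 0 (0 + h * real 1))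
          + h\<^sup>2 / 24 * (regular_family s 2 (0 + h * real (N - 1)) - regular_family s 2 (0 + h * real 1)) = Qf - 2 * QP"
      proof -
        have sumeq: "(\<Sum>j=1..<N-1. regular_family s 1 (0 + h * real j + h / 2)) =
            (\<Sum>j\<in>J. chord s (x j)) - (\<Sum>j\<in>J. powr_family s 1 (x j)) - (\<Sum>j\<in>J. powr_family s 1 (2 * pi - x j))"
          by (simp add: regular_family_def chord_family_def J_def x_def sum_subtractf)
        show ?thesis
          unfolding sumeq refl hM Qf_def QP_def by (simp add: regular_family_def chord_family_def algebra_simps)
      qed
      also have "h ^ 5 * (\<Sum>j=1..<N-1. B j) \<le> C1 * (2 * Z + 112) * h powr (3 - s)"
      proof -
        let ?S = "\<Sum>j=1..<N-1. real j powr (- s - 2)"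
        have S': "(\<Sum>j=1..<N-1. real (N - 1 - j) powr (- s - 2)) = ?S"
          by (rule sum.reindex_bij_witness[of _ "\<lambda>j. N - 1 - j" "\<lambda>j. N - 1 - j"]) auto
        have "(\<Sum>j=1..<N-1. B j) = C1 * (p * (2 * ((s + 1) * ?S)) + real (N - 2))"
          unfolding B_def sum_distrib_left[symmetric] sum.distrib S' by (simp add: algebra_simps numeral_2_eq_2)
        also have "\<dots> \<le> C1 * (p * (2 * Z) + real N)"
          using Z(2)[of "N - 1"] C1(1) by (intro mult_left_mono add_mono) (auto simp: p_def)
        finally have "h ^ 5 * (\<Sum>j=1..<N-1. B j) \<le> h ^ 5 * (C1 * (p * (2 * Z) + real N))"
          using h by (intro mult_left_mono) auto
        also have "\<dots> = C1 * (2 * Z * (h ^ 5 * p) + h ^ 4 * (h * real N))"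
          by (simp add: algebra_simps eval_nat_numeral)
        finally have le: "h ^ 5 * (\<Sum>j=1..<N-1. B j) \<le> C1 * (2 * Z * (h ^ 5 * p) + h ^ 4 * (h * real N))" .
        have 5: "h ^ 5 * p = h powr (3 - s)"
          using h powr_add[of h 5 "- s - 2"] by (simp add: p_def powr_numeral)
        \<comment> \<open>\<open>112 = 16 * 7\<close>, from \<open>h powr (s + 1) \<le> 16\<close>
          and \<open>h * N = 2 * pi \<le> 7\<close>.\<close>
        have "h ^ 4 * (h * real N) \<le> 112 * h powr (3 - s)"
        proof -
          have "h powr (s + 1) \<le> 4 powr (s + 1)" using h h4 s by (intro powr_mono2) auto
          also have "\<dots> \<le> 4 powr 2" using s by (intro powr_mono) auto
          finally have "h powr (s + 1) \<le> 16" by simp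
          then have "h powr (3 - s) * h powr (s + 1) \<le> h powr (3 - s) * 16" by (intro mult_left_mono) auto
          moreover have "h ^ 4 = h powr (3 - s) * h powr (s + 1)"
            using h powr_add[of h "3 - s" "s + 1"] by (simp add: powr_numeral)
          ultimately have "h ^ 4 \<le> 16 * h powr (3 - s)" by simp
          moreover have "h * real N \<le> 7" using hN pi_approx by simp
          ultimately have "h ^ 4 * (h * real N) \<le> (16 * h powr (3 - s)) * 7"
            using h by (intro mult_mono) auto
          then show ?thesis by simp
        qed
        then have "C1 * (2 * Z * (h ^ 5 * p) + h ^ 4 * (h * real N)) \<le> C1 * (2 * Z * h powr (3 - s) + 112 * h powr (3 - s))"
          unfolding 5 using C1(1) by (intro mult_left_mono add_left_mono)
        also have "\<dots> = C1 * (2 * Z + 112) * h powr (3 - s)" by (simp add: distrib_left distrib_right)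
        finally show ?thesis using le by (rule order_trans[rotated])
      qed
      finally show ?thesis .
    qed
    have sum: "h * (\<Sum>j<N. chord s (x j)) - chord_integral s (2 * pi) =
        2 * h * chord s (h / 2) + Qf + h\<^sup>2 / 12 * chord1 s h - 2 * chord_integral s h"
    proof -
      have "{..<N} = insert 0 (insert (N - 1) J)" using N by (auto simp: J_def)
      then have "(\<Sum>j<N. chord s (x j)) = chord s (x 0) + (chord s (x (N - 1)) + (\<Sum>j\<in>J. chord s (x j)))"
        using N by (simp add: J_def)
      moreover have "x (N - 1) = 2 * pi - h / 2" unfolding x_def hM by simp
      moreover have "x 0 = h / 2" by (simp add: x_def)
      moreover have "chord_integral s (2 * pi) = chord_integral s h + chord_integral s (2 * pi - h)"
        using chord_integral_reflect[OF s(2), of h] h hpi by simp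
      ultimately show ?thesis
        unfolding Qf_def by (simp add: chord_reflect distrib_left right_diff_distrib)
    qed
    \<comment> \<open>Expanding the constant by the defect series pairs each of its terms with one
      of \<open>sum\<close>: the defects with \<open>Qf\<close>, the pure powers with the midpoint
      value, derivative and integral of the outer cells.\<close>
    have tgt: "2 * h powr (1 - s) * \<zeta> = 2 * h powr (1 - s) / (1 - s) * suminf D
        + 2 * h * (h / 2) powr (- s) - 2 * (h powr (1 - s) / (1 - s)) + h\<^sup>2 / 12 * (- s * h powr (- s - 1))"
    proof -
      have 1: "h * (h / 2) powr (- s) = h powr (1 - s) * 2 powr s"
        using h powr_add[of h 1 "- s"] by (simp add: powr_divide powr_minus field_simps)
      have 2: "h\<^sup>2 * h powr (- s - 1) = h powr (1 - s)"
        using h powr_add[of h 2 "- s - 1"] by (simp add: powr_numeral)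
      have "2 * h powr (1 - s) * \<zeta> = 2 * h powr (1 - s) / (1 - s) * ((1 - s) * \<zeta>)"
        using s by simp
      also have "\<dots> = 2 * h powr (1 - s) / (1 - s) * suminf D + 2 * (h powr (1 - s) * 2 powr s)
         - 2 * (h powr (1 - s) / (1 - s)) - s / 12 * h powr (1 - s)"
      proof -
        have "2 * H / c * (A + c * b - 1 - c * s / 24) = 2 * H / c * A + 2 * (H * b) - 2 * (H / c) - s / 12 * H"
          if "c \<noteq> 0" for c H A b :: real
          using that by (simp add: field_simps)
        then show ?thesis unfolding \<zeta> using s by simp
      qed
      also have "\<dots> = 2 * h powr (1 - s) / (1 - s) * suminf D
        + 2 * h * (h / 2) powr (- s) - 2 * (h powr (1 - s) / (1 - s)) + h\<^sup>2 / 12 * (- s * h powr (- s - 1))"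
        unfolding 1[symmetric] using 2 by (simp add: algebra_simps)
      finally show ?thesis .
    qed
    let ?tl = "suminf D - (\<Sum>j=1..<N-1. defect s j)"
    have "h * (\<Sum>j<N. chord s (x j)) - chord_integral s (2 * pi) - 2 * h powr (1 - s) * \<zeta> =
       (Qf - 2 * QP) - 2 / (1 - s) * (h powr (1 - s) * ?tl) + 2 * (h * (chord s (h / 2) - (h / 2) powr (- s)))
       + h\<^sup>2 / 12 * (chord1 s h - (- s * h powr (- s - 1))) - 2 * (chord_integral s h - h powr (1 - s) / (1 - s))"
      unfolding sum tgt QP by (simp add: algebra_simps)
    moreover have "\<bar>2 / (1 - s) * (h powr (1 - s) * ?tl)\<bar> \<le> 2 / (1 - s) * T * h powr (3 - s)"
    proof -
      have "\<bar>?tl\<bar> \<le> T * h\<^sup>2"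
      proof -
        have "4 / (real N)\<^sup>2 \<le> h\<^sup>2"
        proof -
          have "(2 / real N)\<^sup>2 \<le> h\<^sup>2"
            using pi_gt3 N by (intro power_mono) (auto simp: h_def divide_right_mono)
          then show ?thesis by (simp add: power_divide)
        qed
        then show ?thesis using tail[OF N] T by (meson mult_left_mono order_trans)
      qed
      then have "h powr (1 - s) * \<bar>?tl\<bar> \<le> h powr (1 - s) * (T * h\<^sup>2)" by (intro mult_left_mono) auto
      also have "\<dots> = T * h powr (3 - s)"
        using h powr_add[of h "1 - s" 2] by (simp add: powr_numeral)
      finally have "2 / (1 - s) * (h powr (1 - s) * \<bar>?tl\<bar>) \<le> 2 / (1 - s) * (T * h powr (3 - s))"
        using s by (intro mult_left_mono) auto
      then show ?thesis using s by (simp add: abs_mult mult.assoc)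
    qed
    moreover have "\<bar>2 * (h * (chord s (h / 2) - (h / 2) powr (- s)))\<bar> \<le> 2 * K * h powr (3 - s)"
    proof -
      have "\<bar>chord s (h / 2) - (h / 2) powr (- s)\<bar> \<le> K * (h / 2) powr (2 - s)"
        using chord_diff_le[of "h / 2" s] h hpi by (simp add: K_def)
      also have "\<dots> \<le> K * h powr (2 - s)"
        using h s by (intro mult_left_mono powr_mono2) (auto simp: K_def)
      finally have "h * \<bar>chord s (h / 2) - (h / 2) powr (- s)\<bar> \<le> h * (K * h powr (2 - s))"
        using h by (intro mult_left_mono) auto
      also have "\<dots> = K * h powr (3 - s)" using h powr_add[of h 1 "2 - s"] by simp
      finally show ?thesis using h by (simp add: abs_mult)
    qed
    moreover have "\<bar>h\<^sup>2 / 12 * (chord1 s h - (- s * h powr (- s - 1)))\<bar> \<le> K' / 12 * h powr (3 - s)"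
    proof -
      have "h\<^sup>2 * \<bar>chord1 s h - (- s * h powr (- s - 1))\<bar> \<le> h\<^sup>2 * (K' * h powr (1 - s))"
        using chord1_diff_le[of h s] h hpi by (intro mult_left_mono) (auto simp: K'_def)
      also have "\<dots> = K' * h powr (3 - s)" using h powr_add[of h 2 "1 - s"] by (simp add: powr_numeral)
      finally show ?thesis by (simp add: abs_mult)
    qed
    moreover have "\<bar>2 * (chord_integral s h - h powr (1 - s) / (1 - s))\<bar> \<le> 2 * K * h powr (3 - s)"
      using chord_integral_diff_le[OF s(2) h] hpi by (simp add: K_def abs_mult)
    ultimately have "\<bar>h * (\<Sum>j<N. chord s (x j)) - chord_integral s (2 * pi) - 2 * h powr (1 - s) * \<zeta>\<bar> \<le>
      C1 * (2 * Z + 112) * h powr (3 - s) + 2 / (1 - s) * T * h powr (3 - s) + 2 * K * h powr (3 - s)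
       + K' / 12 * h powr (3 - s) + 2 * K * h powr (3 - s)"
      using Qdiff by linarith
    also have "\<dots> = E * h powr (3 - s)" by (simp add: E_def K_def K'_def algebra_simps)
    finally show ?thesis by (simp add: x_def)
  qed
  show thesis
  proof (rule that[of "E * (2 * pi) powr (2 - s)"])
    show "E * (2 * pi) powr (2 - s) \<ge> 0" using E by simp
    fix N :: nat assume N: "N \<ge> 3"
    define h where "h = 2 * pi / N"
    have h: "h > 0" using N by (simp add: h_def)
    let ?S = "\<Sum>j<N. chord s ((2 * real j + 1) * pi / N)"
    have "(2 * real j + 1) * pi / N = h * real j + h / 2" for j using N by (simp add: h_def field_simps)
    then have "\<bar>h * ?S - chord_integral s (2 * pi) - 2 * h powr (1 - s) * \<zeta>\<bar> \<le> E * h powr (3 - s)"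
      using main[OF N h_def] by simp
    also have "E * h powr (3 - s) = h * (E * h powr (2 - s))" using h powr_add[of h 1 "2 - s"] by simp
    also have "h * ?S - chord_integral s (2 * pi) - 2 * h powr (1 - s) * \<zeta> =
        h * (?S - (chord_integral s (2 * pi) / h + 2 * h powr (- s) * \<zeta>))"
      using h powr_add[of h 1 "- s"] by (simp add: algebra_simps)
    finally have "\<bar>?S - (chord_integral s (2 * pi) / h + 2 * h powr (- s) * \<zeta>)\<bar> \<le> E * h powr (2 - s)"
      using h by (simp add: abs_mult)
    moreover have "chord_integral s (2 * pi) / h = chord_integral s (2 * pi) / (2 * pi) * N" by (simp add: h_def)
    moreover have pw: "h powr a = (2 * pi) powr a * real N powr (- a)" for a
    proof -
      have "(2 * pi / real N) powr a = (2 * pi) powr a / real N powr a" by (rule powr_divide)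
      then show ?thesis by (simp only: h_def powr_minus divide_inverse)
    qed
    have "2 * h powr (- s) * \<zeta> = 2 * (2 powr s - 1) / (2 * pi) powr s * Re (riemann_zeta (of_real s)) * real N powr s"
      unfolding pw \<zeta>_def minus_minus by (simp only: powr_minus divide_inverse mult_ac)
    moreover have "E * h powr (2 - s) = E * (2 * pi) powr (2 - s) * real N powr (s - 2)"
      unfolding pw by simp
    ultimately show "\<bar>?S - (chord_integral s (2 * pi) / (2 * pi) * N
        + 2 * (2 powr s - 1) / (2 * pi) powr s * Re (riemann_zeta (of_real s)) * real N powr s)\<bar>
      \<le> E * (2 * pi) powr (2 - s) * real N powr (s - 2)"
      by (simp only:)
  qed
qed

section \<open>Riesz energy\<close>

text \<open>The kernel as an even, \<open>2 * pi\<close>-periodic function on the line, for angle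
  differences outside a single period.\<close>

definition pchord :: "real \<Rightarrow> real \<Rightarrow> real" where
  "pchord s \<theta> = \<bar>2 * sin (\<theta> / 2)\<bar> powr (- s)"

lemma pchord_eq_chord: "0 \<le> \<theta> \<Longrightarrow> \<theta> \<le> 2 * pi \<Longrightarrow> pchord s \<theta> = chord s \<theta>"
  using sin_half_nonneg[of \<theta>] by (simp add: pchord_def chord_def)

lemma pchord_minus: "pchord s (- \<theta>) = pchord s \<theta>"
  by (simp add: pchord_def)

lemma pchord_plus_2pi: "pchord s (\<theta> + 2 * pi) = pchord s \<theta>"
proof -
  have "sin ((\<theta> + 2 * pi) / 2) = - sin (\<theta> / 2)" by (simp add: add_divide_distrib)
  then show ?thesis by (simp add: pchord_def)
qed

lemma pchord_nonneg: "pchord s \<theta> \<ge> 0"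
  by (simp add: pchord_def)

lemma continuous_on_pchord: "s < 0 \<Longrightarrow> continuous_on A (\<lambda>t. pchord s (t - a))"
  unfolding pchord_def by (intro continuous_on_powr' continuous_intros) auto

lemma norm_circ_powr: "norm (circ a - circ b) powr (- s) = pchord s (a - b)"
  by (simp add: norm_circ_diff pchord_def)

lemma has_integral_shift_real:
  fixes f :: "real \<Rightarrow> real"
  assumes "(f has_integral i) {a..b}"
  shows "((\<lambda>t. f (t + c)) has_integral i) {a - c..b - c}"
proof -
  have "((\<lambda>t. f (1 *\<^sub>R t + c)) has_integral i) ((\<lambda>x. (1 / 1) *\<^sub>R x + -((1 / 1) *\<^sub>R c)) ` cbox a b)"
    using has_integral_affinity[of f i a b 1 c] assms by simp
  moreover have "(\<lambda>x. (1 / 1) *\<^sub>R x + -((1 / 1) *\<^sub>R c)) ` cbox a b = {a - c..b - c}"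
    by (auto intro!: image_eqI[of _ _ "_ + c"])
  ultimately show ?thesis by simp
qed

lemma pchord_has_integral_period:
  assumes "s < 1" "c \<le> a" "a \<le> c + 2 * pi"
  shows "((\<lambda>t. pchord s (t - a)) has_integral chord_integral s (2 * pi)) {c..c + 2 * pi}"
proof -
  define b where "b = c + 2 * pi - a"
  have b: "0 \<le> b" "b \<le> 2 * pi" using assms by (auto simp: b_def)
  have int: "chord s integrable_on {x..y}" if "0 \<le> x" "y \<le> 2 * pi" for x y
    by (rule integrable_on_subinterval[OF chord_integrable[OF assms(1)]]) (use that in auto)
  have I: "chord_integral s b + integral {b..2 * pi} (chord s) = chord_integral s (2 * pi)"
    unfolding chord_integral_def using b int by (intro Henstock_Kurzweil_Integration.integral_combine) auto
  have "((\<lambda>t. chord s (t + (2 * pi - a))) has_integral integral {b..2 * pi} (chord s)) {b - (2 * pi - a)..2 * pi - (2 * pi - a)}"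
    using b by (intro has_integral_shift_real integrable_integral int) auto
  then have "((\<lambda>t. chord s (t + (2 * pi - a))) has_integral integral {b..2 * pi} (chord s)) {c..a}"
    by (simp add: b_def)
  moreover have "chord s (t + (2 * pi - a)) = pchord s (t - a)" if "t \<in> {c..a}" for t
  proof -
    have "pchord s (t - a) = pchord s (t + (2 * pi - a))" using pchord_plus_2pi[of s "t - a"] by (simp add: algebra_simps)
    then show ?thesis using that assms by (simp add: pchord_eq_chord)
  qed
  ultimately have 1: "((\<lambda>t. pchord s (t - a)) has_integral integral {b..2 * pi} (chord s)) {c..a}"
    by (rule has_integral_eq[rotated])
  have "((\<lambda>t. chord s (t + (- a))) has_integral chord_integral s b) {0 - (- a)..b - (- a)}"
    unfolding chord_integral_def using b by (intro has_integral_shift_real integrable_integral int) auto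
  then have "((\<lambda>t. chord s (t + (- a))) has_integral chord_integral s b) {a..c + 2 * pi}"
    by (simp add: b_def)
  moreover have "chord s (t + (- a)) = pchord s (t - a)" if "t \<in> {a..c + 2 * pi}" for t
    using that assms by (simp add: pchord_eq_chord)
  ultimately have 2: "((\<lambda>t. pchord s (t - a)) has_integral chord_integral s b) {a..c + 2 * pi}"
    by (rule has_integral_eq[rotated])
  show ?thesis
    using has_integral_combine[OF assms(2,3) 1 2] I by (simp add: add.commute)
qed

section \<open>Integration against the arc-length measure\<close>

lemma circ_measurable [measurable]: "circ \<in> borel_measurable borel"
  by (intro borel_measurable_continuous_onI continuous_on_circ)

lemma sigma1_eq: "sigma1 = distr (density lborel (\<lambda>t. ennreal (indicator {0..2 * pi} t / (2 * pi)))) borel circ"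
proof -
  have "uniform_measure lborel {0..2 * pi} = density lborel (\<lambda>t. ennreal (indicator {0..2 * pi} t / (2 * pi)))"
    unfolding uniform_measure_def
  proof (rule arg_cong[where f = "density lborel"], rule ext)
    fix t :: real
    show "indicator {0..2 * pi} t / emeasure lborel {0..2 * pi} = ennreal (indicator {0..2 * pi} t / (2 * pi))"
      by (auto simp: indicator_def divide_ennreal[symmetric])
  qed
  then show ?thesis by (simp add: sigma1_def circ_def[abs_def])
qed

lemma sets_sigma1 [simp, measurable_cong]: "sets sigma1 = sets borel"
  and space_sigma1 [simp]: "space sigma1 = UNIV"
  by (simp_all add: sigma1_eq)

lemma integral_sigma1:
  fixes f :: "real ^ 2 \<Rightarrow> real"
  assumes f [measurable]: "f \<in> borel_measurable borel"
  shows "(LINT x|sigma1. f x) = (LINT t|lborel. indicator {0..2 * pi} t * f (circ t)) / (2 * pi)"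
proof -
  have "(LINT x|sigma1. f x) = (LINT t|density lborel (\<lambda>t. ennreal (indicator {0..2 * pi} t / (2 * pi))). f (circ t))"
    unfolding sigma1_eq by (rule integral_distr) auto
  also have "\<dots> = (LINT t|lborel. (indicator {0..2 * pi} t / (2 * pi)) *\<^sub>R f (circ t))"
    by (rule integral_density) auto
  also have "\<dots> = (LINT t|lborel. (indicator {0..2 * pi} t * f (circ t)) / (2 * pi))"
    by simp
  finally show ?thesis by simp
qed

lemma emeasure_sigma1: "emeasure sigma1 UNIV = 1"
proof -
  have "emeasure sigma1 UNIV = (\<integral>\<^sup>+ t. ennreal (indicator {0..2 * pi} t / (2 * pi)) \<partial>lborel)"
    unfolding sigma1_eq by (subst emeasure_distr) (auto simp: emeasure_density)
  also have "\<dots> = (\<integral>\<^sup>+ t. ennreal (1 / (2 * pi)) * indicator {0..2 * pi} t \<partial>lborel)"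
    by (intro nn_integral_cong) (auto simp: indicator_def)
  also have "\<dots> = 1"
    by (simp add: nn_integral_cmult_indicator ennreal_mult[symmetric])
  finally show ?thesis .
qed

interpretation sigma1: finite_measure sigma1
  by (rule finite_measureI) (simp add: emeasure_sigma1)

lemma real_riesz_kernel: "s \<noteq> 0 \<Longrightarrow> real_of_ereal (riesz_kernel s x y) = sgn s * norm (x - y) powr (- s)"
  by (auto simp: riesz_kernel_def)

lemma integral_sigma1_norm_powr:
  assumes "s < 1" "x \<in> S1"
  shows "(LINT y|sigma1. norm (x - y) powr (- s)) = chord_integral s (2 * pi) / (2 * pi)"
proof -
  obtain a where a: "0 \<le> a" "a < 2 * pi" "x = circ a" using assms(2) by (rule S1_circE)
  have hi: "((\<lambda>t. pchord s (t - a)) has_integral chord_integral s (2 * pi)) {0..2 * pi}"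
    using pchord_has_integral_period[OF assms(1), of 0 a] a by simp
  have abs: "(\<lambda>t. pchord s (t - a)) absolutely_integrable_on {0..2 * pi}"
    using hi by (intro nonnegative_absolutely_integrable_1) (auto simp: integrable_on_def pchord_nonneg)
  have [measurable]: "(\<lambda>t. pchord s (t - a)) \<in> borel_measurable borel"
    unfolding pchord_def by measurable
  have "(LINT y|sigma1. norm (x - y) powr (- s)) = (LINT t|lborel. indicator {0..2 * pi} t * norm (x - circ t) powr (- s)) / (2 * pi)"
    by (rule integral_sigma1) measurable
  also have "(\<lambda>t. norm (x - circ t) powr (- s)) = (\<lambda>t. pchord s (t - a))"
    using norm_circ_powr[of a _ s] pchord_minus[of s "_ - a"] by (simp add: a(3) fun_eq_iff)
  also have "(LINT t|lborel. indicator {0..2 * pi} t * pchord s (t - a)) = (LINT t|lebesgue. indicator {0..2 * pi} t * pchord s (t - a))"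
    by (rule integral_completion[symmetric]) measurable
  also have "\<dots> = integral {0..2 * pi} (\<lambda>t. pchord s (t - a))"
    using set_lebesgue_integral_eq_integral(2)[OF abs] by (simp add: set_lebesgue_integral_def)
  also have "\<dots> = chord_integral s (2 * pi)" using hi by (rule integral_unique)
  finally show ?thesis .
qed

text \<open>The inner integral has the same value for every \<open>x\<close> on the circle, and
  \<open>sigma1\<close> is carried by the circle, so the outer integral averages a constant.\<close>

lemma riesz_energy_eq:
  assumes "s < 1" "s \<noteq> 0"
  shows "riesz_energy s = sgn s * (chord_integral s (2 * pi) / (2 * pi))"
proof -
  let ?J = "\<lambda>x. LINT y|sigma1. norm (x - y) powr (- s)"
  have "riesz_energy s = sgn s * (LINT x|sigma1. ?J x)"
    unfolding riesz_energy_def real_riesz_kernel[OF assms(2)] by simp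
  also have "(LINT x|sigma1. ?J x) = (LINT t|lborel. indicator {0..2 * pi} t * ?J (circ t)) / (2 * pi)"
  proof (rule integral_sigma1)
    have "?J \<in> borel_measurable sigma1"
      by (rule sigma1.borel_measurable_lebesgue_integral) measurable
    then show "?J \<in> borel_measurable borel" by simp
  qed
  also have "(\<lambda>t. indicator {0..2 * pi} t * ?J (circ t)) = (\<lambda>t. indicator {0..2 * pi} t * (chord_integral s (2 * pi) / (2 * pi)))"
    by (simp add: integral_sigma1_norm_powr[OF assms(1) circ_in_S1])
  also have "(LINT t|lborel. indicator {0..2 * pi} t * (chord_integral s (2 * pi) / (2 * pi))) = chord_integral s (2 * pi)"
    by simp
  finally show ?thesis .
qed

lemma max_polarization_asymptotics:
  assumes s: "-1 \<le> s" "s < 1" "s \<noteq> 0"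
  shows "\<exists>R :: nat \<Rightarrow> real. R \<in> O(\<lambda>N. real N powr (s - 2)) \<and>
         (\<forall>\<^sub>F N in sequentially.
            max_polarization (riesz_kernel s) N =
              ereal (riesz_energy s * real N
                + 2 * sgn s * (2 powr s - 1) / (2 * pi) powr s
                    * Re (riemann_zeta (of_real s)) * real N powr s
                + R N))"
proof -
  define A where "A = (\<lambda>N::nat. \<Sum>j<N. chord s ((2 * real j + 1) * pi / N))"
  define M where "M = (\<lambda>N::nat. chord_integral s (2 * pi) / (2 * pi) * N
        + 2 * (2 powr s - 1) / (2 * pi) powr s * Re (riemann_zeta (of_real s)) * real N powr s)"
  obtain C where C: "\<And>N. N \<ge> 3 \<Longrightarrow> \<bar>A N - M N\<bar> \<le> C * real N powr (s - 2)"
    unfolding A_def M_def using chord_midpoint_sum_asymptotics[OF s(1,2)] by metis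
  show ?thesis
  proof (intro exI conjI)
    show "(\<lambda>N. sgn s * (A N - M N)) \<in> O(\<lambda>N. real N powr (s - 2))"
    proof (rule bigoI)
      show "\<forall>\<^sub>F N in sequentially. norm (sgn s * (A N - M N)) \<le> C * norm (real N powr (s - 2))"
        using eventually_ge_at_top[of 3] by eventually_elim (use C s(3) in \<open>auto simp: abs_mult\<close>)
    qed
    show "\<forall>\<^sub>F N in sequentially.
            max_polarization (riesz_kernel s) N =
              ereal (riesz_energy s * real N
                + 2 * sgn s * (2 powr s - 1) / (2 * pi) powr s
                    * Re (riemann_zeta (of_real s)) * real N powr s
                + sgn s * (A N - M N))"
      using eventually_ge_at_top[of 1]
    proof eventually_elim
      case (elim N)
      have "(\<Sum>j<N. arc_kernel s ((2 * real j + 1) * pi / N)) = sgn s * A N"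
        using s(3) by (simp add: A_def arc_kernel_def chord_def sum_distrib_left)
      moreover have "riesz_energy s * real N
                + 2 * sgn s * (2 powr s - 1) / (2 * pi) powr s
                    * Re (riemann_zeta (of_real s)) * real N powr s = sgn s * M N"
        unfolding riesz_energy_eq[OF s(2,3)] M_def by (simp only: divide_inverse distrib_left mult_ac)
      ultimately show ?case
        using max_polarization_eq[OF s(1) elim] by (simp add: right_diff_distrib)
    qed
  qed
qed

section \<open>Lower bound for exponents below -1\<close>

lemma riesz_kernel_neg: "s < 0 \<Longrightarrow> riesz_kernel s x y = ereal (- (norm (x - y) powr (- s)))"
  by (simp add: riesz_kernel_def)

text \<open>A configuration is a function on all of \<open>nat\<close>; freezing its values outside
  \<open>{1..N}\<close> at 0 makes Tychonoff's theorem applicable in the product topology.\<close>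

lemma compact_configurations:
  "compact {\<omega> :: nat \<Rightarrow> real ^ 2. (\<forall>j\<in>{1..N}. \<omega> j \<in> S1) \<and> (\<forall>j. j \<notin> {1..N} \<longrightarrow> \<omega> j = 0)}"
proof -
  have "compactin (product_topology (\<lambda>i. euclidean) UNIV) (PiE UNIV (\<lambda>j. if j \<in> {1..N} then S1 else {0 :: real ^ 2}))"
    unfolding compactin_PiE by auto
  then have "compact (PiE UNIV (\<lambda>j. if j \<in> {1..N} then S1 else {0 :: real ^ 2}))"
    unfolding euclidean_product_topology by simp
  moreover have "PiE UNIV (\<lambda>j. if j \<in> {1..N} then S1 else {0 :: real ^ 2}) =
      {\<omega>. (\<forall>j\<in>{1..N}. \<omega> j \<in> S1) \<and> (\<forall>j. j \<notin> {1..N} \<longrightarrow> \<omega> j = 0)}"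
    by (auto simp: PiE_UNIV_domain Pi_iff split: if_splits)
  ultimately show ?thesis by simp
qed

text \<open>The superlevel sets of the polarization are intersections of closed sets, so the
  maximum exists by the finite intersection property.\<close>

lemma max_polarization_attained:
  assumes s: "s < 0"
  obtains \<omega> where "\<omega> \<in> {1..N} \<rightarrow> S1" "max_polarization (riesz_kernel s) N = polarization (riesz_kernel s) N \<omega>"
    "\<And>\<omega>'. \<omega>' \<in> {1..N} \<rightarrow> S1 \<Longrightarrow> polarization (riesz_kernel s) N \<omega>' \<le> max_polarization (riesz_kernel s) N"
proof -
  define P where "P = polarization (riesz_kernel s) N"
  define U where "U = (\<lambda>x \<omega>. \<Sum>j=1..N. riesz_kernel s x (\<omega> j))"
  define S where "S = {\<omega> :: nat \<Rightarrow> real ^ 2. (\<forall>j\<in>{1..N}. \<omega> j \<in> S1) \<and> (\<forall>j. j \<notin> {1..N} \<longrightarrow> \<omega> j = 0)}"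
  have P: "P \<omega> \<le> U x \<omega>" if "x \<in> S1" for x \<omega>
    using polarization_attained[of s N \<omega>] that unfolding P_def U_def by blast
  have Patt: "\<exists>x\<in>S1. P \<omega> = U x \<omega>" for \<omega>
    using polarization_attained[of s N \<omega>] unfolding P_def U_def by blast
  define T where "T = (\<lambda>\<omega>0. \<Inter>x\<in>S1. {\<omega>. P \<omega>0 \<le> U x \<omega>})"
  have clT: "closed (T \<omega>0)" for \<omega>0
    unfolding T_def
  proof (intro closed_INT ballI closed_Collect_le continuous_on_const)
    fix x
    have "continuous_on UNIV (\<lambda>\<omega> :: nat \<Rightarrow> real ^ 2. \<Sum>j=1..N. - (norm (x - \<omega> j) powr (- s)))"
      using s by (intro continuous_intros continuous_on_powr' continuous_on_product_coordinates) auto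
    moreover have "U x = (\<lambda>\<omega>. ereal (\<Sum>j=1..N. - (norm (x - \<omega> j) powr (- s))))"
      using s by (simp add: U_def riesz_kernel_neg fun_eq_iff)
    ultimately show "continuous_on UNIV (U x)"
      by (simp add: continuous_on_ereal)
  qed
  have fipT: "S \<inter> (\<Inter>\<omega>\<in>J. T \<omega>) \<noteq> {}" if J: "finite J" "J \<subseteq> S" for J
  proof (cases "J = {}")
    case True
    have "(\<lambda>j. if j \<in> {1..N} then circ 0 else 0) \<in> S" using circ_in_S1[of 0] by (simp add: S_def)
    then show ?thesis using True by auto
  next
    case False
    \<comment> \<open>The best of finitely many configurations lies in all of their superlevel
      sets.\<close>
    then have "Max (P ` J) \<in> P ` J" using J by (intro Max_in) auto
    then obtain \<omega>0 where "\<omega>0 \<in> J" "P \<omega>0 = Max (P ` J)" by auto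
    moreover have "P \<omega> \<le> U x \<omega>0" if "\<omega> \<in> J" "x \<in> S1" for \<omega> x
    proof -
      have "P \<omega> \<le> P \<omega>0" using \<open>P \<omega>0 = Max (P ` J)\<close> J that by simp
      then show ?thesis using P[OF that(2), of \<omega>0] by (rule order_trans)
    qed
    ultimately have "\<omega>0 \<in> S \<inter> (\<Inter>\<omega>\<in>J. T \<omega>)"
      using J(2) unfolding T_def by blast
    then show ?thesis by blast
  qed
  have "compact S" unfolding S_def by (rule compact_configurations)
  then have "S \<inter> (\<Inter>\<omega>\<in>S. T \<omega>) \<noteq> {}"
    using clT fipT by (rule compact_imp_fip_image)
  then obtain \<omega>m where \<omega>m: "\<omega>m \<in> S" "\<And>\<omega>. \<omega> \<in> S \<Longrightarrow> \<omega>m \<in> T \<omega>" by blast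
  have max: "P \<omega> \<le> P \<omega>m" if "\<omega> \<in> {1..N} \<rightarrow> S1" for \<omega>
  proof -
    define \<omega>' where "\<omega>' = (\<lambda>j. if j \<in> {1..N} then \<omega> j else 0)"
    have "\<omega>' \<in> S" using that by (auto simp: S_def \<omega>'_def)
    have "(\<Sum>j=1..N. riesz_kernel s x (\<omega>' j)) = (\<Sum>j=1..N. riesz_kernel s x (\<omega> j))" for x
      by (rule sum.cong) (simp_all add: \<omega>'_def)
    then have "P \<omega>' = P \<omega>"
      unfolding P_def polarization_def by (simp only:)
    moreover obtain x where "x \<in> S1" "P \<omega>m = U x \<omega>m" using Patt by blast
    ultimately show ?thesis using \<omega>m(2)[OF \<open>\<omega>' \<in> S\<close>] by (auto simp: T_def)
  qed
  have mem: "\<omega>m \<in> {1..N} \<rightarrow> S1" using \<omega>m(1) by (simp add: S_def)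
  have "max_polarization (riesz_kernel s) N = P \<omega>m"
    unfolding max_polarization_def P_def[symmetric]
    by (rule Greatest_equality) (use max mem in blast)+
  then show thesis using that[OF mem] max unfolding P_def by simp
qed

text \<open>Unlike in \<open>chord4_diff_le\<close> nothing is subtracted: for a bound of order
  \<open>N powr s\<close> it is enough that \<open>(h * j) powr (- s - 4)\<close> is summable over
  the cells.\<close>

lemma chord4_le:
  obtains C where "C \<ge> 0" "\<And>\<theta>. 0 < \<theta> \<Longrightarrow> \<theta> < 2 * pi \<Longrightarrow>
    \<bar>chord4 s \<theta>\<bar> \<le> C * (\<theta> powr (- s - 4) + (2 * pi - \<theta>) powr (- s - 4))"
proof -
  define a where "a = \<bar>s * (s + 1) * (s + 2) * (s + 3)\<bar>"
  define b where "b = \<bar>s * (s + 1) * (s + 2)\<^sup>2 / 4 + s\<^sup>2 / 4 * s * (s + 1)\<bar>"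
  define c where "c = s ^ 4 / 16"
  define C where "C = a * 2 powr \<bar>s + 4\<bar> + b * (2 powr \<bar>s + 2\<bar> * 16) + c * (2 powr \<bar>s\<bar> * 256)"
  have abc: "a \<ge> 0" "b \<ge> 0" "c \<ge> 0" by (auto simp: a_def b_def c_def)
  have half: "\<bar>chord4 s \<theta>\<bar> \<le> C * \<theta> powr (- s - 4)" if \<theta>: "0 < \<theta>" "\<theta> \<le> pi" for \<theta>
  proof -
    let ?p = "\<theta> powr (- s - 4)"
    have e: "- (s + 4) = - s - 4" "s + 2 + 2 = s + 4" by simp_all
    have eq: "chord4 s \<theta> = s * (s + 1) * (s + 2) * (s + 3) * chord (s + 4) \<theta>
        - (s * (s + 1) * (s + 2)\<^sup>2 / 4 + s\<^sup>2 / 4 * s * (s + 1)) * chord (s + 2) \<theta> + c * chord s \<theta>"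
      unfolding chord4_def chord2_def c_def e by (simp add: field_simps power2_eq_square power4_eq_xxxx)
    have "\<bar>chord4 s \<theta>\<bar> \<le> a * chord (s + 4) \<theta> + b * chord (s + 2) \<theta> + c * chord s \<theta>"
    proof -
      have "\<bar>s * (s + 1) * (s + 2) * (s + 3) * chord (s + 4) \<theta>\<bar> = a * chord (s + 4) \<theta>"
        "\<bar>(s * (s + 1) * (s + 2)\<^sup>2 / 4 + s\<^sup>2 / 4 * s * (s + 1)) * chord (s + 2) \<theta>\<bar> = b * chord (s + 2) \<theta>"
        "\<bar>c * chord s \<theta>\<bar> = c * chord s \<theta>"
        unfolding a_def b_def using abc(3) by (simp_all only: abs_mult abs_of_nonneg chord_nonneg)
      then show ?thesis unfolding eq by linarith
    qed
    also have "\<dots> \<le> a * (2 powr \<bar>s + 4\<bar> * ?p) + b * (2 powr \<bar>s + 2\<bar> * (16 * ?p)) + c * (2 powr \<bar>s\<bar> * (256 * ?p))"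
    proof -
      have "\<theta> ^ k \<le> 4 ^ k" for k using \<theta> pi_less_4 by (intro power_mono) auto
      note this[of 2] this[of 4]
      moreover have "\<theta> powr (- (s + 2)) = \<theta> ^ 2 * ?p" "\<theta> powr (- s) = \<theta> ^ 4 * ?p"
        using \<theta> powr_add[of \<theta> 2 "- s - 4"] powr_add[of \<theta> 4 "- s - 4"] by (simp_all add: powr_numeral minus_diff_commute)
      ultimately have "\<theta> powr (- (s + 2)) \<le> 16 * ?p" "\<theta> powr (- s) \<le> 256 * ?p"
        by (simp_all add: mult_right_mono)
      then have "chord (s + 2) \<theta> \<le> 2 powr \<bar>s + 2\<bar> * (16 * ?p)" "chord s \<theta> \<le> 2 powr \<bar>s\<bar> * (256 * ?p)"
        using chord_le[OF \<theta>, of "s + 2"] chord_le[OF \<theta>, of s] by (meson mult_left_mono order_trans powr_ge_zero)+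
      then show ?thesis
        using chord_le[OF \<theta>, of "s + 4"] abc unfolding e by (intro add_mono mult_left_mono) auto
    qed
    also have "\<dots> = C * ?p" by (simp add: C_def algebra_simps)
    finally show ?thesis .
  qed
  have C: "C \<ge> 0" using abc by (simp add: C_def)
  have "\<bar>chord4 s \<theta>\<bar> \<le> C * (\<theta> powr (- s - 4) + (2 * pi - \<theta>) powr (- s - 4))" if \<theta>: "0 < \<theta>" "\<theta> < 2 * pi" for \<theta>
  proof (cases "\<theta> \<le> pi")
    case True
    have "C * \<theta> powr (- s - 4) \<le> C * (\<theta> powr (- s - 4) + (2 * pi - \<theta>) powr (- s - 4))"
      using C by (intro mult_left_mono) auto
    then show ?thesis using half[OF \<theta>(1) True] by linarith
  next
    case False
    have "C * (2 * pi - \<theta>) powr (- s - 4) \<le> C * (\<theta> powr (- s - 4) + (2 * pi - \<theta>) powr (- s - 4))"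
      using C by (intro mult_left_mono) auto
    then show ?thesis using half[of "2 * pi - \<theta>"] False \<theta> by (simp add: chord_reflect)
  qed
  with C that show thesis by blast
qed

text \<open>The potential of equally spaced points is, up to sign, a midpoint sum with offset
  \<open>\<tau>\<close>, to be bounded uniformly in \<open>\<tau>\<close>. As the kernel is
  nonnegative, the integral over the inner cells is at most the full one, and the two outer summands
  are of order \<open>h powr (- s)\<close> already.\<close>

lemma chord_shifted_sum_le:
  assumes s: "-2 < s" "s < -1"
  obtains b where "b > 0" "\<And>N \<tau>. N \<ge> 3 \<Longrightarrow> 0 < \<tau> \<Longrightarrow> \<tau> \<le> 2 * pi / N \<Longrightarrow>
    (\<Sum>j<N. chord s (2 * pi * real j / real N + \<tau>)) \<le> chord_integral s (2 * pi) / (2 * pi) * N + b * real N powr s"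
proof -
  obtain C where C: "C \<ge> 0" "\<And>\<theta>. 0 < \<theta> \<Longrightarrow> \<theta> < 2 * pi \<Longrightarrow>
    \<bar>chord4 s \<theta>\<bar> \<le> C * (\<theta> powr (- s - 4) + (2 * pi - \<theta>) powr (- s - 4))"
    using chord4_le[of s] by blast
  define Z where "Z = (\<Sum>j. real (Suc j) powr (- s - 4))"
  have sumZ: "summable (\<lambda>j. real (Suc j) powr (- s - 4))" using s by (intro summable_Suc_powr) auto
  have Z: "(\<Sum>j=1..<n. real j powr (- s - 4)) \<le> Z" for n
  proof -
    have "(\<Sum>j=1..<n. real j powr (- s - 4)) = (\<Sum>j<n - 1. real (Suc j) powr (- s - 4))"
      by (rule sum.reindex_bij_witness[of _ Suc "\<lambda>j. j - 1"]) auto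
    also have "\<dots> \<le> Z" unfolding Z_def by (intro sum_le_suminf sumZ) auto
    finally show ?thesis .
  qed
  define K where "K = \<bar>s\<bar> * 2 powr \<bar>s + 1\<bar> * 2 powr (- s - 1)"
  define E where "E = C * 2 powr (s + 4) * (2 * Z) + K + 2 * 2 powr \<bar>s\<bar>"
  have Z0: "Z \<ge> 0" unfolding Z_def by (intro suminf_nonneg sumZ) auto
  have E: "E > 0" unfolding E_def K_def using C Z0 by (intro add_nonneg_pos add_nonneg_nonneg mult_nonneg_nonneg) auto
  have main: "h * (\<Sum>j<N. chord s (h * real j + \<tau>)) \<le> chord_integral s (2 * pi) + E * h powr (1 - s)"
    if N: "N \<ge> 3" and h_def: "h = 2 * pi / N" and \<tau>: "0 < \<tau>" "\<tau> \<le> h" for N h \<tau>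
  proof -
    have hN: "h * real N = 2 * pi" using N by (simp add: h_def)
    have h: "h > 0" using N by (simp add: h_def)
    have "h * 3 \<le> h * real N" using h N by (intro mult_left_mono) auto
    then have hpi: "3 / 2 * h \<le> pi" using hN by linarith
    have rj: "h * real (N - 1 - j) = 2 * pi - h - h * real j" if "j < N" for j
    proof -
      have "real (N - 1 - j) = real N - 1 - real j" using that by linarith
      then have "h * real (N - 1 - j) = h * (real N - 1 - real j)" by simp
      also have "\<dots> = h * real N - h - h * real j" by (simp add: right_diff_distrib)
      finally show ?thesis unfolding hN .
    qed
    have hM: "h * real (N - 1) = 2 * pi - h" using rj[of 0] N by simp
    \<comment> \<open>Shifts the cells so that their midpoints are the sampling points
      \<open>h * j + \<tau>\<close>.\<close>
    define a where "a = \<tau> - h / 2"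
    define p where "p = (h / 2) powr (- s - 4)"
    define B where "B = (\<lambda>j. C * (p * (real j powr (- s - 4) + real (N - 1 - j) powr (- s - 4))))"
    define lo where "lo = a + h * real 1"
    define hi where "hi = a + h * real (N - 1)"
    have lo: "h / 2 \<le> lo" "lo \<le> 3 / 2 * h" using \<tau> by (auto simp: lo_def a_def)
    have hi: "h / 2 \<le> 2 * pi - hi" "2 * pi - hi \<le> 3 / 2 * h" using \<tau> unfolding hi_def hM by (auto simp: a_def)
    \<comment> \<open>The shift moves cell edges by at most \<open>h / 2\<close>, which for these
      \<open>j\<close> at most halves the distance to either end; hence the \<open>h / 2\<close> in
      \<open>p\<close>.\<close>
    have cell: "0 < h / 2 * real j \<and> h / 2 * real j \<le> y \<and> 0 < h / 2 * real (N - 1 - j) \<and> h / 2 * real (N - 1 - j) \<le> 2 * pi - y"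
      if j: "1 \<le> j" "j < N - 1" and y: "a + h * real j \<le> y" "y \<le> a + h * real (Suc j)" for j y
    proof -
      define A where "A = h * real j"
      define B' where "B' = h * real (N - 1 - j)"
      have "h * 1 \<le> A" "h * 1 \<le> B'" unfolding A_def B'_def using j h by (intro mult_left_mono; simp)+
      moreover have "B' = 2 * pi - h - A" unfolding A_def B'_def by (rule rj) (use j in simp)
      moreover have "a + A \<le> y" "y \<le> a + A + h" using y by (simp_all add: A_def distrib_left)
      moreover have "h / 2 * real j = A / 2" "h / 2 * real (N - 1 - j) = B' / 2" by (simp_all add: A_def B'_def)
      ultimately show ?thesis using \<tau> h unfolding a_def by (intro conjI) linarith+
    qed
    have "\<bar>h * (\<Sum>j=1..<N-1. chord_family s 1 (a + h * real j + h / 2))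
          - (chord_family s 0 (a + h * real (N - 1)) - chord_family s 0 (a + h * real 1))
          + h\<^sup>2 / 24 * (chord_family s 2 (a + h * real (N - 1)) - chord_family s 2 (a + h * real 1))\<bar>
          \<le> h ^ 5 * (\<Sum>j=1..<N-1. B j)"
    proof (rule midpoint_rule_composite[OF h])
      show "1 \<le> N - 1" using N by simp
      show "(chord_family s i has_real_derivative chord_family s (Suc i) y) (at y)"
        if "a + h * real 1 \<le> y" "y \<le> a + h * real (N - 1)" "i \<le> 4" for i y
        using that lo hi h s unfolding lo_def[symmetric] hi_def[symmetric] by (intro chord_family_has_derivative) auto
      show "\<bar>chord_family s 5 y\<bar> \<le> B j"
        if j: "1 \<le> j" "j < N - 1" and y: "a + h * real j \<le> y" "y \<le> a + h * real (Suc j)" for j y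
      proof -
        note c = cell[OF that]
        have "y powr (- s - 4) \<le> (h / 2 * real j) powr (- s - 4)"
          by (rule powr_mono2') (use c s in auto)
        moreover have "(2 * pi - y) powr (- s - 4) \<le> (h / 2 * real (N - 1 - j)) powr (- s - 4)"
          by (rule powr_mono2') (use c s in simp_all)
        ultimately have pp: "y powr (- s - 4) + (2 * pi - y) powr (- s - 4) \<le> p * (real j powr (- s - 4) + real (N - 1 - j) powr (- s - 4))"
          unfolding powr_mult p_def distrib_left by (rule add_mono)
        have "chord_family s 5 = chord4 s" by (simp add: chord_family_def eval_nat_numeral)
        then have "\<bar>chord_family s 5 y\<bar> \<le> C * (y powr (- s - 4) + (2 * pi - y) powr (- s - 4))"
          using C(2)[of y] c by simp
        also have "\<dots> \<le> B j" unfolding B_def using pp C(1) by (intro mult_left_mono) auto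
        finally show ?thesis .
      qed
    qed
    then have R: "h * (\<Sum>j=1..<N-1. chord s (a + h * real j + h / 2)) \<le> (chord_integral s hi - chord_integral s lo)
          - h\<^sup>2 / 24 * (chord1 s hi - chord1 s lo) + h ^ 5 * (\<Sum>j=1..<N-1. B j)"
      unfolding lo_def[symmetric] hi_def[symmetric] by (simp add: chord_family_def abs_le_iff)
    have "h ^ 5 * (\<Sum>j=1..<N-1. B j) \<le> C * 2 powr (s + 4) * (2 * Z) * h powr (1 - s)"
    proof -
      let ?S = "\<Sum>j=1..<N-1. real j powr (- s - 4)"
      have S': "(\<Sum>j=1..<N-1. real (N - 1 - j) powr (- s - 4)) = ?S"
        by (rule sum.reindex_bij_witness[of _ "\<lambda>j. N - 1 - j" "\<lambda>j. N - 1 - j"]) auto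
      have "(\<Sum>j=1..<N-1. B j) = C * (p * (2 * ?S))"
        unfolding B_def sum_distrib_left[symmetric] sum.distrib S' by simp
      also have "\<dots> \<le> C * (p * (2 * Z))"
        using Z[of "N - 1"] C(1) by (intro mult_left_mono) (auto simp: p_def)
      finally have "h ^ 5 * (\<Sum>j=1..<N-1. B j) \<le> h ^ 5 * (C * (p * (2 * Z)))"
        using h by (intro mult_left_mono) auto
      also have "\<dots> = C * (h ^ 5 * p) * (2 * Z)" by simp
      also have "h ^ 5 * p = 2 powr (s + 4) * h powr (1 - s)"
      proof -
        have "(h / 2) powr (- s - 4) = h powr (- s - 4) / 2 powr (- s - 4)" by (rule powr_divide)
        also have "\<dots> = h powr (- s - 4) * 2 powr (s + 4)"
          using powr_minus_divide[of 2 "s + 4"] by (simp add: minus_diff_commute)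
        finally show ?thesis
          using h powr_add[of h 5 "- s - 4"] by (simp add: p_def powr_numeral)
      qed
      finally show ?thesis by (simp add: mult_ac)
    qed
    moreover have "- (h\<^sup>2 / 24 * (chord1 s hi - chord1 s lo)) \<le> K * h powr (1 - s)"
    proof -
      have b1: "\<bar>chord1 s y\<bar> \<le> K * h powr (- s - 1)" if y: "h / 2 \<le> y" "y \<le> 3 / 2 * h" for y
      proof -
        have "\<bar>chord1 s y\<bar> \<le> \<bar>s\<bar> * 2 powr \<bar>s + 1\<bar> * y powr (- s - 1)"
          using y h hpi by (intro chord1_le) auto
        also have "\<dots> \<le> \<bar>s\<bar> * 2 powr \<bar>s + 1\<bar> * (2 * h) powr (- s - 1)"
        proof -
          have "0 \<le> y" "y \<le> 2 * h" using y h by linarith+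
          then have "y powr (- s - 1) \<le> (2 * h) powr (- s - 1)" using s(2) by (intro powr_mono2) linarith+
          then show ?thesis by (rule mult_left_mono) simp
        qed
        also have "\<dots> = K * h powr (- s - 1)" by (simp add: K_def powr_mult)
        finally show ?thesis .
      qed
      have "\<bar>chord1 s lo\<bar> \<le> K * h powr (- s - 1)" using b1 lo by blast
      moreover have "\<bar>chord1 s hi\<bar> \<le> K * h powr (- s - 1)"
        using b1[OF hi] by (simp add: chord_reflect)
      ultimately have "- (chord1 s hi - chord1 s lo) \<le> 24 * (K * h powr (- s - 1))" by linarith
      then have "h\<^sup>2 / 24 * (- (chord1 s hi - chord1 s lo)) \<le> h\<^sup>2 / 24 * (24 * (K * h powr (- s - 1)))"
        by (intro mult_left_mono) auto
      also have "\<dots> = K * h powr (1 - s)"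
        using h powr_add[of h 2 "- s - 1"] by (simp add: powr_numeral)
      finally show ?thesis by (simp only: mult_minus_right)
    qed
    moreover have "chord_integral s hi - chord_integral s lo \<le> chord_integral s (2 * pi)"
    proof -
      have lh: "0 < lo" "hi < 2 * pi" using lo hi h by auto
      have int: "chord s integrable_on {x..y}" if "0 \<le> x" "y \<le> 2 * pi" for x y
        by (rule integrable_on_subinterval[OF chord_integrable[of s]]) (use that s in auto)
      have "chord_integral s hi \<le> chord_integral s (2 * pi)"
        unfolding chord_integral_def
        by (rule integral_subset_le) (use lh int chord_nonneg in auto)
      moreover have "0 \<le> chord_integral s lo"
        unfolding chord_integral_def by (rule integral_nonneg) (use lo hpi h int chord_nonneg in auto)
      ultimately show ?thesis by linarith
    qed
    moreover have "h * (\<Sum>j<N. chord s (h * real j + \<tau>)) \<le> h * (\<Sum>j=1..<N-1. chord s (a + h * real j + h / 2)) + 2 * 2 powr \<bar>s\<bar> * h powr (1 - s)"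
    proof -
      have "{..<N} = insert 0 (insert (N - 1) {1..<N - 1})" using N by auto
      then have "(\<Sum>j<N. chord s (h * real j + \<tau>)) = chord s \<tau> + (chord s (h * real (N - 1) + \<tau>) + (\<Sum>j=1..<N-1. chord s (h * real j + \<tau>)))"
        using N by simp
      moreover have "(\<Sum>j=1..<N-1. chord s (h * real j + \<tau>)) = (\<Sum>j=1..<N-1. chord s (a + h * real j + h / 2))"
        by (simp add: a_def algebra_simps)
      moreover have small: "chord s y \<le> 2 powr \<bar>s\<bar> * h powr (- s)" if y: "0 \<le> y" "y \<le> h" for y
      proof (cases "y = 0")
        case False
        then have "chord s y \<le> 2 powr \<bar>s\<bar> * y powr (- s)" using y hpi h by (intro chord_le) auto
        also have "\<dots> \<le> 2 powr \<bar>s\<bar> * h powr (- s)" using y s by (intro mult_left_mono powr_mono2) auto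
        finally show ?thesis .
      qed (simp add: chord_def)
      have "chord s \<tau> \<le> 2 powr \<bar>s\<bar> * h powr (- s)" using small \<tau> by simp
      moreover have "chord s (h * real (N - 1) + \<tau>) \<le> 2 powr \<bar>s\<bar> * h powr (- s)"
      proof -
        have "h * real (N - 1) + \<tau> = 2 * pi - (h - \<tau>)" unfolding hM by simp
        then have "chord s (h * real (N - 1) + \<tau>) = chord s (h - \<tau>)" by (simp only: chord_reflect)
        then show ?thesis using small[of "h - \<tau>"] \<tau> by simp
      qed
      ultimately have "(\<Sum>j<N. chord s (h * real j + \<tau>)) \<le> (\<Sum>j=1..<N-1. chord s (a + h * real j + h / 2)) + 2 * (2 powr \<bar>s\<bar> * h powr (- s))"
        by linarith
      then have "h * (\<Sum>j<N. chord s (h * real j + \<tau>)) \<le> h * ((\<Sum>j=1..<N-1. chord s (a + h * real j + h / 2)) + 2 * (2 powr \<bar>s\<bar> * h powr (- s)))"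
        using h by (intro mult_left_mono) auto
      also have "\<dots> = h * (\<Sum>j=1..<N-1. chord s (a + h * real j + h / 2)) + 2 * 2 powr \<bar>s\<bar> * h powr (1 - s)"
        using h powr_add[of h 1 "- s"] by (simp add: distrib_left)
      finally show ?thesis .
    qed
    ultimately have "h * (\<Sum>j<N. chord s (h * real j + \<tau>)) \<le> chord_integral s (2 * pi)
        + C * 2 powr (s + 4) * (2 * Z) * h powr (1 - s) + K * h powr (1 - s) + 2 * 2 powr \<bar>s\<bar> * h powr (1 - s)"
      using R by linarith
    also have "\<dots> = chord_integral s (2 * pi) + E * h powr (1 - s)" by (simp add: E_def algebra_simps)
    finally show ?thesis .
  qed
  show thesis
  proof (rule that[of "E * (2 * pi) powr (- s)"])
    show "E * (2 * pi) powr (- s) > 0" using E by simp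
    fix N :: nat and \<tau> :: real
    assume N: "N \<ge> 3" and \<tau>: "0 < \<tau>" "\<tau> \<le> 2 * pi / N"
    define h where "h = 2 * pi / N"
    have h: "h > 0" using N by (simp add: h_def)
    let ?S = "\<Sum>j<N. chord s (2 * pi * real j / real N + \<tau>)"
    have "2 * pi * real j / real N + \<tau> = h * real j + \<tau>" for j by (simp add: h_def)
    then have "h * ?S \<le> chord_integral s (2 * pi) + E * h powr (1 - s)"
      using main[OF N h_def \<tau>(1)] \<tau>(2) by (simp add: h_def)
    also have "\<dots> = h * (chord_integral s (2 * pi) / h + E * h powr (- s))"
      using h powr_add[of h 1 "- s"] by (simp add: algebra_simps)
    finally have "?S \<le> chord_integral s (2 * pi) / h + E * h powr (- s)" using h by simp
    moreover have "chord_integral s (2 * pi) / h = chord_integral s (2 * pi) / (2 * pi) * N" by (simp add: h_def)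
    moreover have "h powr (- s) = (2 * pi) powr (- s) * real N powr s"
    proof -
      have "(2 * pi / real N) powr (- s) = (2 * pi) powr (- s) / real N powr (- s)" by (rule powr_divide)
      then show ?thesis by (simp only: h_def powr_minus divide_inverse inverse_inverse_eq)
    qed
    ultimately show "?S \<le> chord_integral s (2 * pi) / (2 * pi) * N + E * (2 * pi) powr (- s) * real N powr s"
      by (simp only: mult.assoc)
  qed
qed

lemma polarization_equally_spaced_ge:
  assumes s: "-2 < s" "s < -1"
  obtains b where "b > 0" "\<And>N. N \<ge> 3 \<Longrightarrow>
    ereal (riesz_energy s * real N - b * real N powr s) \<le> max_polarization (riesz_kernel s) N"
proof -
  obtain b where b: "b > 0" "\<And>N \<tau>. N \<ge> 3 \<Longrightarrow> 0 < \<tau> \<Longrightarrow> \<tau> \<le> 2 * pi / N \<Longrightarrow>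
    (\<Sum>j<N. chord s (2 * pi * real j / real N + \<tau>)) \<le> chord_integral s (2 * pi) / (2 * pi) * N + b * real N powr s"
    using chord_shifted_sum_le[OF s] by blast
  have "ereal (riesz_energy s * real N - b * real N powr s) \<le> max_polarization (riesz_kernel s) N" if N: "N \<ge> 3" for N
  proof -
    let ?\<omega> = "\<lambda>j::nat. circ (2 * pi * real j / real N)"
    obtain x where x: "x \<in> S1" "polarization (riesz_kernel s) N ?\<omega> = (\<Sum>j=1..N. riesz_kernel s x (?\<omega> j))"
      using polarization_attained[of s N ?\<omega>] by blast
    obtain \<tau> where \<tau>: "0 < \<tau>" "\<tau> \<le> 2 * pi / N"
      and eq: "(\<Sum>j=1..N. riesz_kernel s x (?\<omega> j)) = (\<Sum>j<N. riesz_kernel s (circ (- \<tau>)) (?\<omega> j))"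
      using N by (rule_tac equally_spaced_sum[OF x(1), of N s]) auto
    have "riesz_kernel s (circ (- \<tau>)) (?\<omega> j) = ereal (- chord s (2 * pi * real j / real N + \<tau>))" if j: "j < N" for j
    proof -
      have "(real j + 1) * (2 * pi / N) \<le> real N * (2 * pi / N)" using j by (intro mult_right_mono) auto
      then have "2 * pi * real j / N + 2 * pi / N \<le> 2 * pi" using N by (simp add: field_simps)
      then have "2 * pi * real j / real N + \<tau> \<le> 2 * pi" using \<tau> by linarith
      moreover have "0 \<le> 2 * pi * real j / real N + \<tau>" using \<tau> by (simp add: add_nonneg_nonneg)
      ultimately show ?thesis
        using riesz_kernel_circ[of "2 * pi * real j / real N" "- \<tau>" s] s by (simp add: arc_kernel_def chord_def)
    qed
    then have "polarization (riesz_kernel s) N ?\<omega> = ereal (- (\<Sum>j<N. chord s (2 * pi * real j / real N + \<tau>)))"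
      unfolding x(2) eq by (simp add: sum_negf)
    moreover have "riesz_energy s * real N - b * real N powr s \<le> - (\<Sum>j<N. chord s (2 * pi * real j / real N + \<tau>))"
      using b(2)[OF N \<tau>] riesz_energy_eq[of s] s by simp
    ultimately have "ereal (riesz_energy s * real N - b * real N powr s) \<le> polarization (riesz_kernel s) N ?\<omega>"
      by simp
    also have "\<dots> \<le> max_polarization (riesz_kernel s) N"
    proof -
      have "?\<omega> \<in> {1..N} \<rightarrow> S1" by (intro Pi_I circ_in_S1)
      moreover have "s < 0" using s by simp
      ultimately show ?thesis using max_polarization_attained[of s N] by blast
    qed
    finally show ?thesis .
  qed
  with b(1) that show thesis by blast
qed

section \<open>Upper bound for exponents below -1\<close>

text \<open>Sturm comparison: the Wronskian \<open>y1 * S - y * S1\<close> has derivative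
  \<open>(y2 + q\<^sup>2 * y) * S \<ge> 0\<close>, vanishes at 0 and equals \<open>y h\<close> at
  \<open>h\<close>. It is used with \<open>S t = h - t\<close> for \<open>q = 0\<close> and with
  \<open>S t = sin (q * (h - t)) / q\<close>.\<close>

lemma sturm_nonneg:
  fixes y y1 y2 S S1 :: "real \<Rightarrow> real"
  assumes h: "0 \<le> h"
    and y: "\<And>t. 0 \<le> t \<Longrightarrow> t \<le> h \<Longrightarrow> (y has_real_derivative y1 t) (at t)"
    and y1: "\<And>t. 0 \<le> t \<Longrightarrow> t \<le> h \<Longrightarrow> (y1 has_real_derivative y2 t) (at t)"
    and S: "\<And>t. (S has_real_derivative S1 t) (at t)"
    and S1: "\<And>t. (S1 has_real_derivative - q\<^sup>2 * S t) (at t)"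
    and pos: "\<And>t. 0 \<le> t \<Longrightarrow> t \<le> h \<Longrightarrow> 0 \<le> S t" and Sh: "S h = 0" "S1 h = -1"
    and ineq: "\<And>t. 0 \<le> t \<Longrightarrow> t \<le> h \<Longrightarrow> 0 \<le> y2 t + q\<^sup>2 * y t"
    and init: "y 0 = 0" "y1 0 = 0"
  shows "0 \<le> y h"
proof -
  have "y1 0 * S 0 - y 0 * S1 0 \<le> y1 h * S h - y h * S1 h"
  proof (rule DERIV_nonneg_imp_nondecreasing[OF h])
    fix t assume t: "0 \<le> t" "t \<le> h"
    have "((\<lambda>t. y1 t * S t - y t * S1 t) has_real_derivative
        (y2 t * S t + S1 t * y1 t) - (y1 t * S1 t + (- q\<^sup>2 * S t) * y t)) (at t)"
      by (intro DERIV_diff DERIV_mult y y1 S S1 t)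
    moreover have "(y2 t * S t + S1 t * y1 t) - (y1 t * S1 t + (- q\<^sup>2 * S t) * y t) = (y2 t + q\<^sup>2 * y t) * S t"
      by (simp add: algebra_simps)
    ultimately show "\<exists>D. ((\<lambda>t. y1 t * S t - y t * S1 t) has_real_derivative D) (at t) \<and> 0 \<le> D"
      using mult_nonneg_nonneg[OF ineq pos, OF t t] by metis
  qed
  then show ?thesis using Sh init by simp
qed

lemma second_difference_ge:
  fixes g g1 g2 :: "real \<Rightarrow> real"
  assumes h: "0 \<le> h"
    and g: "\<And>x. \<theta> - h \<le> x \<Longrightarrow> x \<le> \<theta> + h \<Longrightarrow> (g has_real_derivative g1 x) (at x)"
    and g1: "\<And>x. \<theta> - h \<le> x \<Longrightarrow> x \<le> \<theta> + h \<Longrightarrow> (g1 has_real_derivative g2 x) (at x)"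
    and m: "\<And>x. \<theta> - h \<le> x \<Longrightarrow> x \<le> \<theta> + h \<Longrightarrow> m \<le> g2 x"
  shows "h\<^sup>2 * m \<le> g (\<theta> + h) + g (\<theta> - h) - 2 * g \<theta>"
proof -
  have "0 \<le> g (\<theta> + h) + g (\<theta> - h) - 2 * g \<theta> - m * h\<^sup>2"
  proof (rule sturm_nonneg[where q = 0 and y = "\<lambda>t. g (\<theta> + t) + g (\<theta> - t) - 2 * g \<theta> - m * t\<^sup>2"
      and ?y1.0 = "\<lambda>t. g1 (\<theta> + t) - g1 (\<theta> - t) - 2 * m * t"
      and ?y2.0 = "\<lambda>t. g2 (\<theta> + t) + g2 (\<theta> - t) - 2 * m"
      and S = "\<lambda>t. h - t" and ?S1.0 = "\<lambda>t. -1" and h = h])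
    fix t assume t: "0 \<le> t" "t \<le> h"
    have "((\<lambda>t. g (\<theta> + t)) has_real_derivative g1 (\<theta> + t) * 1) (at t)"
      "((\<lambda>t. g (\<theta> - t)) has_real_derivative g1 (\<theta> - t) * (-1)) (at t)"
      by (rule DERIV_chain2[OF g]; use t in \<open>auto intro!: derivative_eq_intros\<close>)+
    then show "((\<lambda>t. g (\<theta> + t) + g (\<theta> - t) - 2 * g \<theta> - m * t\<^sup>2) has_real_derivative g1 (\<theta> + t) - g1 (\<theta> - t) - 2 * m * t) (at t)"
      by (auto intro!: derivative_eq_intros)
    have "((\<lambda>t. g1 (\<theta> + t)) has_real_derivative g2 (\<theta> + t) * 1) (at t)"
      "((\<lambda>t. g1 (\<theta> - t)) has_real_derivative g2 (\<theta> - t) * (-1)) (at t)"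
      by (rule DERIV_chain2[OF g1]; use t in \<open>auto intro!: derivative_eq_intros\<close>)+
    then show "((\<lambda>t. g1 (\<theta> + t) - g1 (\<theta> - t) - 2 * m * t) has_real_derivative g2 (\<theta> + t) + g2 (\<theta> - t) - 2 * m) (at t)"
      by (auto intro!: derivative_eq_intros)
    show "0 \<le> g2 (\<theta> + t) + g2 (\<theta> - t) - 2 * m + 0\<^sup>2 * (g (\<theta> + t) + g (\<theta> - t) - 2 * g \<theta> - m * t\<^sup>2)"
      using m[of "\<theta> + t"] m[of "\<theta> - t"] t by simp
  qed (use h in \<open>auto intro!: derivative_eq_intros\<close>)
  then show ?thesis by (simp add: mult.commute)
qed

text \<open>The operator on the right vanishes on solutions of
  \<open>f'' + q\<^sup>2 * f = 0\<close>, and the left side is its value at the constant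
  \<open>\<kappa> / q\<^sup>2\<close>. The condition \<open>q * h \<le> pi\<close> keeps the
  comparison function nonnegative.\<close>

lemma cos_difference_ge:
  fixes f f1 f2 :: "real \<Rightarrow> real"
  assumes h: "0 \<le> h" and q: "0 < q" "q * h \<le> pi"
    and f: "\<And>x. \<xi> - h \<le> x \<Longrightarrow> x \<le> \<xi> + h \<Longrightarrow> (f has_real_derivative f1 x) (at x)"
    and f1: "\<And>x. \<xi> - h \<le> x \<Longrightarrow> x \<le> \<xi> + h \<Longrightarrow> (f1 has_real_derivative f2 x) (at x)"
    and \<kappa>: "\<And>x. \<xi> - h \<le> x \<Longrightarrow> x \<le> \<xi> + h \<Longrightarrow> \<kappa> \<le> f2 x + q\<^sup>2 * f x"
  shows "\<kappa> / q\<^sup>2 * (1 - cos (q * h)) \<le> (f (\<xi> + h) + f (\<xi> - h)) / 2 - cos (q * h) * f \<xi>"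
proof -
  let ?y = "\<lambda>t. (f (\<xi> + t) + f (\<xi> - t)) / 2 - cos (q * t) * f \<xi> - \<kappa> / q\<^sup>2 * (1 - cos (q * t))"
  let ?y1 = "\<lambda>t. (f1 (\<xi> + t) - f1 (\<xi> - t)) / 2 + q * sin (q * t) * f \<xi> - \<kappa> / q * sin (q * t)"
  let ?y2 = "\<lambda>t. (f2 (\<xi> + t) + f2 (\<xi> - t)) / 2 + q\<^sup>2 * cos (q * t) * f \<xi> - \<kappa> * cos (q * t)"
  have "0 \<le> ?y h"
  proof (rule sturm_nonneg[where q = q and y = ?y and ?y1.0 = ?y1 and ?y2.0 = ?y2
      and S = "\<lambda>t. sin (q * (h - t)) / q" and ?S1.0 = "\<lambda>t. - cos (q * (h - t))" and h = h])
    fix t assume t: "0 \<le> t" "t \<le> h"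
    have d: "((\<lambda>t. f (\<xi> + t)) has_real_derivative f1 (\<xi> + t) * 1) (at t)"
      "((\<lambda>t. f (\<xi> - t)) has_real_derivative f1 (\<xi> - t) * (-1)) (at t)"
      by (rule DERIV_chain2[OF f]; use t in \<open>auto intro!: derivative_eq_intros\<close>)+
    have tr: "((\<lambda>t. cos (q * t)) has_real_derivative - sin (q * t) * q) (at t)"
      "((\<lambda>t. sin (q * t)) has_real_derivative cos (q * t) * q) (at t)"
      by (auto intro!: derivative_eq_intros)
    have "(?y has_real_derivative (f1 (\<xi> + t) * 1 + f1 (\<xi> - t) * (-1)) / 2 - - sin (q * t) * q * f \<xi>
        - \<kappa> / q\<^sup>2 * (0 - - sin (q * t) * q)) (at t)"
      by (intro DERIV_diff DERIV_add DERIV_cdivide DERIV_cmult DERIV_cmult_right DERIV_const d tr)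
    also have "(f1 (\<xi> + t) * 1 + f1 (\<xi> - t) * (-1)) / 2 - - sin (q * t) * q * f \<xi>
        - \<kappa> / q\<^sup>2 * (0 - - sin (q * t) * q) = ?y1 t"
      using q by (simp add: power2_eq_square)
    finally show "(?y has_real_derivative ?y1 t) (at t)" .
    have d: "((\<lambda>t. f1 (\<xi> + t)) has_real_derivative f2 (\<xi> + t) * 1) (at t)"
      "((\<lambda>t. f1 (\<xi> - t)) has_real_derivative f2 (\<xi> - t) * (-1)) (at t)"
      by (rule DERIV_chain2[OF f1]; use t in \<open>auto intro!: derivative_eq_intros\<close>)+
    have "(?y1 has_real_derivative (f2 (\<xi> + t) * 1 - f2 (\<xi> - t) * (-1)) / 2 + q * (cos (q * t) * q) * f \<xi>
        - \<kappa> / q * (cos (q * t) * q)) (at t)"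
      by (intro DERIV_diff DERIV_add DERIV_cdivide DERIV_cmult DERIV_cmult_right d tr)
    also have "(f2 (\<xi> + t) * 1 - f2 (\<xi> - t) * (-1)) / 2 + q * (cos (q * t) * q) * f \<xi>
        - \<kappa> / q * (cos (q * t) * q) = ?y2 t"
      using q by (simp add: power2_eq_square)
    finally show "(?y1 has_real_derivative ?y2 t) (at t)" .
    have "0 \<le> q * (h - t)" "q * (h - t) \<le> q * h"
      using q t by (auto intro!: mult_left_mono)
    then show "0 \<le> sin (q * (h - t)) / q"
      using q by (intro divide_nonneg_nonneg sin_ge_zero) linarith+
    have "?y2 t + q\<^sup>2 * ?y t = ((f2 (\<xi> + t) + q\<^sup>2 * f (\<xi> + t)) + (f2 (\<xi> - t) + q\<^sup>2 * f (\<xi> - t))) / 2 - \<kappa>"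
      using q by (simp add: field_simps)
    then show "0 \<le> ?y2 t + q\<^sup>2 * ?y t"
      using \<kappa>[of "\<xi> + t"] \<kappa>[of "\<xi> - t"] t by simp
  next
    fix t
    show "((\<lambda>t. sin (q * (h - t)) / q) has_real_derivative - cos (q * (h - t))) (at t)"
      using q by (auto intro!: derivative_eq_intros)
    show "((\<lambda>t. - cos (q * (h - t))) has_real_derivative - q\<^sup>2 * (sin (q * (h - t)) / q)) (at t)"
      using q by (auto intro!: derivative_eq_intros simp: power2_eq_square)
  qed (use h in auto)
  then show ?thesis by simp
qed

text \<open>A fourth order difference that annihilates constants and, applied to the kernel, is
  governed by the convexity of \<open>(D\<^sup>2 + q\<^sup>2)\<close> of the kernel, where \<open>q = s/2\<close>.\<close>

definition gap_difference :: "real \<Rightarrow> real \<Rightarrow> (real \<Rightarrow> real) \<Rightarrow> real \<Rightarrow> real" where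
  "gap_difference c h f x = f (x + 2 * h) / 2 + f (x - 2 * h) / 2 + (1 + 2 * c) * f x
     - (1 + c) * (f (x + h) + f (x - h))"

text \<open>The five point combination is the second difference of the cosine difference
  \<open>M\<close>. Two derivatives pass through \<open>M\<close>, so
  \<open>second_difference_ge\<close> reduces the claim to \<open>cos_difference_ge\<close> for
  \<open>chord2\<close>.\<close>

lemma gap_difference_chord_ge:
  assumes h: "0 \<le> h" and q: "q = - s / 2" "0 < q" "q * h \<le> pi"
    and \<theta>: "0 < \<theta> - 2 * h" "\<theta> + 2 * h < 2 * pi"
    and \<kappa>: "\<And>x. \<theta> - 2 * h \<le> x \<Longrightarrow> x \<le> \<theta> + 2 * h \<Longrightarrow> \<kappa> \<le> chord4 s x + q\<^sup>2 * chord2 s x"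
  shows "h\<^sup>2 * (\<kappa> / q\<^sup>2 * (1 - cos (q * h))) \<le> gap_difference (cos (q * h)) h (chord s) \<theta>"
proof -
  let ?c = "cos (q * h)"
  define M where "M = (\<lambda>f x. (f (x + h) + f (x - h)) / 2 - ?c * f x :: real)"
  have M: "(M f has_real_derivative M f' x) (at x)"
    if "\<And>y. 0 < y \<Longrightarrow> y < 2 * pi \<Longrightarrow> (f has_real_derivative f' y) (at y)" "h < x" "x + h < 2 * pi" for f f' x
  proof -
    have "((\<lambda>x. f (x + h)) has_real_derivative f' (x + h) * 1) (at x)"
      "((\<lambda>x. f (x - h)) has_real_derivative f' (x - h) * 1) (at x)"
      by (rule DERIV_chain2[OF that(1)]; use that(2,3) h in \<open>auto intro!: derivative_eq_intros\<close>)+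
    moreover have "(f has_real_derivative f' x) (at x)" using that h by auto
    ultimately show ?thesis unfolding M_def by (auto intro!: derivative_eq_intros)
  qed
  have "h\<^sup>2 * (\<kappa> / q\<^sup>2 * (1 - ?c)) \<le> M (chord s) (\<theta> + h) + M (chord s) (\<theta> - h) - 2 * M (chord s) \<theta>"
  proof (rule second_difference_ge[OF h])
    fix x assume x: "\<theta> - h \<le> x" "x \<le> \<theta> + h"
    show "(M (chord s) has_real_derivative M (chord1 s) x) (at x)"
      by (rule M[OF chord_has_derivative]) (use x \<theta> in auto)
    show "(M (chord1 s) has_real_derivative M (chord2 s) x) (at x)"
      by (rule M[OF chord1_has_derivative]) (use x \<theta> in auto)
    show "\<kappa> / q\<^sup>2 * (1 - ?c) \<le> M (chord2 s) x"
      unfolding M_def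
    proof (rule cos_difference_ge[OF h q(2,3)])
      fix y assume y: "x - h \<le> y" "y \<le> x + h"
      then have y': "0 < y" "y < 2 * pi" using x \<theta> by auto
      show "(chord2 s has_real_derivative chord3 s y) (at y)" by (rule chord2_has_derivative[OF y'])
      show "(chord3 s has_real_derivative chord4 s y) (at y)" by (rule chord3_has_derivative[OF y'])
      show "\<kappa> \<le> chord4 s y + q\<^sup>2 * chord2 s y" using \<kappa> x y by simp
    qed
  qed
  also have "\<dots> = gap_difference ?c h (chord s) \<theta>"
    unfolding M_def gap_difference_def by (simp add: field_simps)
  finally show ?thesis .
qed

text \<open>Since the chord is at most 2, the subtracted term of \<open>chord2\<close> is at most
  \<open>a\<^sup>2 * chord (a + 2) \<theta>\<close>, which leaves
  \<open>a * chord (a + 2) \<theta>\<close>. The result is used for the convex exponent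
  \<open>a = s + 2\<close>.\<close>

lemma chord2_ge:
  assumes a: "0 < a" "a < 1" and \<theta>: "0 < \<theta>" "\<theta> < 2 * pi"
  shows "0 \<le> chord2 a \<theta>" "\<theta> \<le> L \<Longrightarrow> a * L powr (- a - 2) \<le> chord2 a \<theta>"
proof -
  define u where "u = 2 * sin (\<theta> / 2)"
  have u: "0 < u" "u \<le> \<theta>" "u \<le> 2"
    using sin_half_pos[OF \<theta>] sin_x_le_x[of "\<theta> / 2"] \<theta> by (auto simp: u_def)
  have "chord a \<theta> = u\<^sup>2 * chord (a + 2) \<theta>"
    using u(1) powr_add[of u 2 "- (a + 2)"] by (simp add: chord_def u_def[symmetric] powr_numeral)
  also have "\<dots> \<le> 4 * chord (a + 2) \<theta>"
    using u power_mono[of u 2 2] by (intro mult_right_mono chord_nonneg) auto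
  finally have "a\<^sup>2 / 4 * chord a \<theta> \<le> a\<^sup>2 / 4 * (4 * chord (a + 2) \<theta>)" by (intro mult_left_mono) auto
  then have ge: "a * chord (a + 2) \<theta> \<le> chord2 a \<theta>"
    by (simp add: chord2_def power2_eq_square distrib_left distrib_right)
  then show "0 \<le> chord2 a \<theta>" using a chord_nonneg[of "a + 2" \<theta>] by (smt (verit) mult_nonneg_nonneg)
  assume L: "\<theta> \<le> L"
  have "L powr (- a - 2) \<le> u powr (- a - 2)" using u L a by (intro powr_mono2') auto
  also have "\<dots> = chord (a + 2) \<theta>" by (simp add: chord_def u_def minus_diff_commute)
  finally have "a * L powr (- a - 2) \<le> a * chord (a + 2) \<theta>" using a by (intro mult_left_mono) auto
  with ge show "a * L powr (- a - 2) \<le> chord2 a \<theta>" by linarith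
qed

lemma one_minus_cos_ge: "0 \<le> x \<Longrightarrow> x \<le> 2 \<Longrightarrow> x\<^sup>2 / 8 \<le> 1 - cos x" for x :: real
proof -
  assume x: "0 \<le> x" "x \<le> 2"
  have "(x / 2)\<^sup>2 \<le> 1\<^sup>2" using x by (intro power_mono) auto
  then have "(x / 2) * (x / 2)\<^sup>2 \<le> (x / 2) * 1" using x by (intro mult_left_mono) auto
  then have "(x / 2) ^ 3 \<le> x / 2" by (simp add: power3_eq_cube power2_eq_square)
  then have "x / 4 \<le> sin (x / 2)" using sin_ge_cubic[of "x / 2"] x by linarith
  then have "(x / 4)\<^sup>2 \<le> (sin (x / 2))\<^sup>2" using x by (intro power_mono) auto
  moreover have "cos x = 1 - 2 * (sin (x / 2))\<^sup>2" using cos_double_sin[of "x / 2"] by simp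
  moreover have "(x / 4)\<^sup>2 = x\<^sup>2 / 16" by (simp add: power_divide)
  ultimately show ?thesis by linarith
qed

text \<open>An unrolled configuration whose negated potential is bounded by \<open>B\<close>
  everywhere. With \<open>B\<close> equal to minus the polarization, the aim is that
  \<open>B\<close> exceeds the mean of that function by order \<open>N powr s\<close>.\<close>

locale gap_configuration =
  fixes s :: real and N :: nat and X :: "nat \<Rightarrow> real" and B :: real
  assumes s: "-2 < s" "s < -1" and N: "N \<ge> 1"
    and mono: "X k \<le> X (Suc k)" and per: "X (k + N) = X k + 2 * pi"
    and bound: "(\<Sum>j<N. pchord s (t - X j)) \<le> B"
begin

definition F :: "real \<Rightarrow> real" where
  "F t = (\<Sum>j<N. pchord s (t - X j))"

definition v :: "real \<Rightarrow> real" where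
  "v t = B - F t"

lemma v_nonneg: "0 \<le> v t"
  using bound by (simp add: v_def F_def)

lemma continuous_v: "continuous_on A v"
  unfolding v_def F_def using s by (intro continuous_intros continuous_on_pchord) auto

lemma v_integrable: "v integrable_on {a..b}"
  by (intro integrable_continuous_real continuous_v)

lemma X_mono: "i \<le> j \<Longrightarrow> X i \<le> X j"
  using lift_Suc_mono_le[of X i j] mono by simp

lemma F_window: "F t = (\<Sum>j<N. pchord s (t - X (m + j)))"
proof -
  have "pchord s (t - X (k + N)) = pchord s (t - X k)" for k
  proof -
    have "t - X k = t - X (k + N) + 2 * pi" by (simp add: per)
    then show ?thesis by (simp only: pchord_plus_2pi)
  qed
  then show ?thesis
    unfolding F_def using sum_periodic_window[of "\<lambda>j. pchord s (t - X j)" N m] by simp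
qed

text \<open>Collects \<open>s * (s + 1) * (s + 2)\<close> from the lower bound of the convex kernel,
  \<open>1 / 8\<close> from \<open>1 - cos x \<ge> x\<^sup>2 / 8\<close>, and \<open>12 ^ 4\<close>
  from the step \<open>h = L / 12\<close>. It is positive because exactly two factors are
  negative.\<close>

definition gap_const :: real where
  "gap_const = s * (s + 1) * (s + 2) / 8 / 12 ^ 4"

lemma gap_const_pos: "gap_const > 0"
  unfolding gap_const_def using s by (intro divide_pos_pos mult_pos_pos mult_neg_neg) auto

text \<open>\<open>gap_difference\<close> of \<open>F\<close> splits over the points of the
  configuration. Every share is nonnegative, and the share of the left end of the gap alone has
  order \<open>L powr (- s)\<close>. All five evaluation points stay at least \<open>3 * h\<close>
  away from the ends, where the kernel is smooth.\<close>

lemma gap_pointwise: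
  assumes L: "L = X (Suc k) - X k" "L > 0" and h: "h = L / 12"
    and t: "(X k + X (Suc k)) / 2 - h \<le> t" "t \<le> (X k + X (Suc k)) / 2 + h"
  shows "gap_const / 2 * L powr (- s) \<le> v (t + h) + v (t - h)"
proof -
  define q where "q = - s / 2"
  define c where "c = cos (q * h)"
  have q: "0 < q" "q < 1" using s by (auto simp: q_def)
  have Lpi: "L \<le> 2 * pi" using X_mono[of "Suc k" "k + N"] N per[of k] L by simp
  have h0: "0 < h" "h \<le> pi / 6" using L(2) Lpi by (auto simp: h)
  have tX: "X k + 3 * h \<le> t - 2 * h" "t + 2 * h \<le> X (Suc k) - 3 * h" using t L by (auto simp: h field_simps)
  have "q * h \<le> 1 * (pi / 6)" using q h0 by (intro mult_mono) auto
  then have qh: "0 \<le> q * h" "q * h \<le> pi" "q * h \<le> pi / 2" "q * h \<le> 2" using q h0 pi_less_4 by auto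
  have c: "0 \<le> c" "c \<le> 1" unfolding c_def using qh by (auto intro!: cos_ge_zero)
  define D where "D = (\<lambda>j. gap_difference c h (chord s) (X (Suc k + j) - t))"
  have rng: "0 < X (Suc k + j) - t - 2 * h" "X (Suc k + j) - t + 2 * h < 2 * pi" if j: "j < N" for j
  proof -
    have "X (Suc k) \<le> X (Suc k + j)" by (rule X_mono) simp
    then show "0 < X (Suc k + j) - t - 2 * h" using tX h0 by linarith
    have "X (Suc k + j) \<le> X (k + N)" by (rule X_mono) (use j in simp)
    then show "X (Suc k + j) - t + 2 * h < 2 * pi" using tX h0 per[of k] by linarith
  qed
  have op: "chord4 s x + q\<^sup>2 * chord2 s x = s * (s + 1) * chord2 (s + 2) x" for x
    by (simp add: chord4_def q_def power_divide)
  have ss: "s * (s + 1) > 0" using s by (intro mult_neg_neg) auto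
  have D0: "0 \<le> D j" if j: "j < N" for j
  proof -
    have "h\<^sup>2 * (0 / q\<^sup>2 * (1 - cos (q * h))) \<le> gap_difference (cos (q * h)) h (chord s) (X (Suc k + j) - t)"
    proof (rule gap_difference_chord_ge)
      fix x assume "X (Suc k + j) - t - 2 * h \<le> x" "x \<le> X (Suc k + j) - t + 2 * h"
      then have "0 < x" "x < 2 * pi" using rng[OF j] by linarith+
      then have "0 \<le> chord2 (s + 2) x" using s by (intro chord2_ge) auto
      then show "0 \<le> chord4 s x + q\<^sup>2 * chord2 s x" unfolding op using ss by simp
    qed (use q h0 qh rng[OF j] in \<open>auto simp: q_def\<close>)
    then show ?thesis by (simp add: D_def c_def)
  qed
  define \<kappa> where "\<kappa> = s * (s + 1) * ((s + 2) * L powr (- s - 4))"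
  have \<kappa>0: "0 \<le> \<kappa>" unfolding \<kappa>_def using ss s by simp
  \<comment> \<open>Index \<open>N - 1\<close> is the point \<open>X k + 2 * pi\<close>, the left
    end of the gap seen from the other side; its reflected angle is at most
    \<open>L\<close>.\<close>
  have last: "gap_const * L powr (- s) \<le> D (N - 1)"
  proof -
    have e: "X (Suc k + (N - 1)) = X k + 2 * pi" using N per[of k] by simp
    have "h\<^sup>2 * (\<kappa> / q\<^sup>2 * (1 - cos (q * h))) \<le> D (N - 1)"
      unfolding D_def c_def
    proof (rule gap_difference_chord_ge)
      fix x assume x: "X (Suc k + (N - 1)) - t - 2 * h \<le> x" "x \<le> X (Suc k + (N - 1)) - t + 2 * h"
      then have x': "0 < x" "x < 2 * pi" using rng[of "N - 1"] N by linarith+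
      have "2 * pi - x \<le> L" using x tX L h0 unfolding e by linarith
      then have "(s + 2) * L powr (- (s + 2) - 2) \<le> chord2 (s + 2) (2 * pi - x)"
        using x' s by (intro chord2_ge(2)) auto
      then have "(s + 2) * L powr (- s - 4) \<le> chord2 (s + 2) x"
        by (simp add: chord_reflect minus_diff_commute)
      then show "\<kappa> \<le> chord4 s x + q\<^sup>2 * chord2 s x"
        unfolding op \<kappa>_def using ss by (intro mult_left_mono) auto
    qed (use q h0 qh rng[of "N - 1"] N in \<open>auto simp: q_def\<close>)
    moreover have "h\<^sup>2 * (\<kappa> / q\<^sup>2 * ((q * h)\<^sup>2 / 8)) \<le> h\<^sup>2 * (\<kappa> / q\<^sup>2 * (1 - cos (q * h)))"
      using one_minus_cos_ge[OF qh(1,4)] \<kappa>0 by (intro mult_left_mono) auto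
    moreover have "h\<^sup>2 * (\<kappa> / q\<^sup>2 * ((q * h)\<^sup>2 / 8)) = gap_const * L powr (- s)"
    proof -
      have "h\<^sup>2 * (\<kappa> / q\<^sup>2 * ((q * h)\<^sup>2 / 8)) = \<kappa> * h ^ 4 / 8"
        using q by (simp add: power_mult_distrib power2_eq_square power4_eq_xxxx)
      also have "\<dots> = gap_const * (L ^ 4 * L powr (- s - 4))"
        by (simp add: \<kappa>_def gap_const_def h power_divide)
      also have "L ^ 4 * L powr (- s - 4) = L powr (- s)"
        using L(2) powr_add[of L 4 "- s - 4"] by (simp add: powr_numeral)
      finally show ?thesis .
    qed
    ultimately show ?thesis by linarith
  qed
  have FD: "gap_difference c h F t = (\<Sum>j<N. D j)"
  proof -
    have Fu: "F u = (\<Sum>j<N. chord s (X (Suc k + j) - u))" if u: "t - 2 * h \<le> u" "u \<le> t + 2 * h" for u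
    proof -
      have "pchord s (u - X (Suc k + j)) = chord s (X (Suc k + j) - u)" if "j < N" for j
        using pchord_minus[of s "X (Suc k + j) - u"] pchord_eq_chord[of "X (Suc k + j) - u" s] rng[OF that] u by simp
      then show ?thesis unfolding F_window[of u "Suc k"] by simp
    qed
    have "gap_difference c h F t = (\<Sum>j<N. chord s (X (Suc k + j) - (t + 2 * h))) / 2
        + (\<Sum>j<N. chord s (X (Suc k + j) - (t - 2 * h))) / 2 + (1 + 2 * c) * (\<Sum>j<N. chord s (X (Suc k + j) - t))
        - (1 + c) * ((\<Sum>j<N. chord s (X (Suc k + j) - (t + h))) + (\<Sum>j<N. chord s (X (Suc k + j) - (t - h))))"
      unfolding gap_difference_def using h0 by (subst (1 2 3 4 5) Fu) auto
    also have "\<dots> = (\<Sum>j<N. D j)"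
      unfolding sum_divide_distrib sum_distrib_left sum.distrib[symmetric] sum_subtractf[symmetric] D_def gap_difference_def
      by (intro sum.cong) (auto simp: algebra_simps)
    finally show ?thesis .
  qed
  have "D (N - 1) \<le> (\<Sum>j<N. D j)"
    using D0 N by (intro member_le_sum) auto
  then have "gap_const * L powr (- s) \<le> gap_difference c h F t" using last FD by linarith
  also have "gap_difference c h F t = - gap_difference c h v t"
    by (simp add: gap_difference_def v_def field_simps)
  \<comment> \<open>The constant \<open>B\<close> has dropped out. The values of \<open>v\<close> at
    \<open>t\<close> and at distance \<open>2 * h\<close> have nonnegative weights and are
    discarded.\<close>
  also have "\<dots> \<le> (1 + c) * (v (t + h) + v (t - h))"
  proof -
    have "0 \<le> v (t + 2 * h) / 2 + v (t - 2 * h) / 2 + (1 + 2 * c) * v t"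
      using v_nonneg c by (intro add_nonneg_nonneg mult_nonneg_nonneg) auto
    then show ?thesis by (simp add: gap_difference_def)
  qed
  also have "\<dots> \<le> 2 * (v (t + h) + v (t - h))"
    using v_nonneg[of "t + h"] v_nonneg[of "t - h"] c by (intro mult_right_mono) auto
  finally show ?thesis by simp
qed

text \<open>Integrating the pointwise bound over \<open>t\<close> within \<open>h\<close> of the
  midpoint \<open>m\<close> makes the two shifted arguments sweep the adjacent intervals
  \<open>{m - 2 * h..m}\<close> and \<open>{m..m + 2 * h}\<close> of the gap.\<close>

lemma gap_integral:
  "gap_const / 12 * (X (Suc k) - X k) powr (1 - s) \<le> integral {X k..X (Suc k)} v"
proof (cases "X k = X (Suc k)")
  case False
  define L where "L = X (Suc k) - X k"
  define h where "h = L / 12"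
  define m where "m = (X k + X (Suc k)) / 2"
  have L: "L > 0" using False mono[of k] by (simp add: L_def)
  have h: "h > 0" using L by (simp add: h_def)
  have "((\<lambda>t. v (t + h)) has_integral integral {m..m + 2 * h} v) {m - h..m + 2 * h - h}"
    by (intro has_integral_shift_real integrable_integral v_integrable)
  moreover have "m + 2 * h - h = m + h" by simp
  ultimately have 1: "((\<lambda>t. v (t + h)) has_integral integral {m..m + 2 * h} v) {m - h..m + h}" by (simp only:)
  have "((\<lambda>t. v (t + - h)) has_integral integral {m - 2 * h..m} v) {m - 2 * h - - h..m - - h}"
    by (intro has_integral_shift_real integrable_integral v_integrable)
  then have 2: "((\<lambda>t. v (t - h)) has_integral integral {m - 2 * h..m} v) {m - h..m + h}" by simp
  have "gap_const / 12 * L powr (1 - s) = integral {m - h..m + h} (\<lambda>t. gap_const / 2 * L powr (- s))"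
    using h L powr_add[of L 1 "- s"] by (simp add: h_def)
  also have "\<dots> \<le> integral {m - h..m + h} (\<lambda>t. v (t + h) + v (t - h))"
  proof (rule integral_le)
    show "(\<lambda>t. v (t + h) + v (t - h)) integrable_on {m - h..m + h}"
      using has_integral_add[OF 1 2] by (auto simp: integrable_on_def)
    show "gap_const / 2 * L powr (- s) \<le> v (t + h) + v (t - h)" if "t \<in> {m - h..m + h}" for t
      using gap_pointwise[OF L_def L h_def, of t] that by (simp add: m_def)
  qed auto
  also have "\<dots> = integral {m..m + 2 * h} v + integral {m - 2 * h..m} v"
    by (rule integral_unique[OF has_integral_add[OF 1 2]])
  also have "\<dots> = integral {m - 2 * h..m + 2 * h} v"
    using Henstock_Kurzweil_Integration.integral_combine[of "m - 2 * h" m "m + 2 * h" v] h v_integrable by simp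
  also have "\<dots> \<le> integral {X k..X (Suc k)} v"
  proof (rule integral_subset_le)
    have "12 * h = L" by (simp add: h_def)
    then show "{m - 2 * h..m + 2 * h} \<subseteq> {X k..X (Suc k)}"
      using h by (auto simp: m_def L_def field_simps)
  qed (use v_integrable v_nonneg in auto)
  finally show ?thesis by (simp add: L_def)
qed simp

text \<open>The gap lengths are arbitrary, so \<open>L powr (1 - s)\<close> is bounded below by
  \<open>a powr (- s) * (L - a)\<close> with \<open>a\<close> half the mean gap. The sum of
  \<open>L - a\<close> over a period is \<open>2 * pi - pi\<close>, however the points lie.\<close>

lemma bound_ge:
  "chord_integral s (2 * pi) / (2 * pi) * N + gap_const / 24 * pi powr (- s) * real N powr s \<le> B"
proof -
  define a where "a = pi / N"
  have a: "a > 0" using N by (simp add: a_def)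
  have powr_ge: "a powr (- s) * (L - a) \<le> L powr (1 - s)" if "0 \<le> L" for L
  proof (cases "L \<le> a")
    case True
    then have "a powr (- s) * (L - a) \<le> 0" by (intro mult_nonneg_nonpos) auto
    also have "\<dots> \<le> L powr (1 - s)" by simp
    finally show ?thesis .
  next
    case False
    have "a powr (- s) * (L - a) \<le> L powr (- s) * L"
      using False a s by (intro mult_mono powr_mono2) auto
    also have "\<dots> = L powr (1 - s)" using False a powr_add[of L 1 "- s"] by (simp add: mult.commute)
    finally show ?thesis .
  qed
  have tele: "(\<Sum>k<n. integral {X k..X (Suc k)} v) = integral {X 0..X n} v" for n
  proof (induction n)
    case (Suc n)
    then show ?case
      using Henstock_Kurzweil_Integration.integral_combine[of "X 0" "X n" "X (Suc n)" v] X_mono mono v_integrable by simp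
  qed simp
  have "((\<lambda>t. B - (\<Sum>j<N. pchord s (t - X j))) has_integral
      (2 * pi * B - (\<Sum>j<N. chord_integral s (2 * pi)))) {X 0..X 0 + 2 * pi}"
  proof (intro has_integral_diff has_integral_sum pchord_has_integral_period)
    show "((\<lambda>t. B) has_integral 2 * pi * B) {X 0..X 0 + 2 * pi}"
      using has_integral_const_real[of B "X 0" "X 0 + 2 * pi"] by simp
    show "X 0 \<le> X j" for j by (rule X_mono) simp
    show "X j \<le> X 0 + 2 * pi" if "j \<in> {..<N}" for j
      using X_mono[of j N] per[of 0] that by simp
  qed (use s in auto)
  then have tot: "integral {X 0..X N} v = 2 * pi * B - N * chord_integral s (2 * pi)"
    using per[of 0] by (simp add: v_def[abs_def] F_def integral_unique)
  have "gap_const / 12 * (a powr (- s) * pi) = (\<Sum>k<N. gap_const / 12 * (a powr (- s) * ((X (Suc k) - X k) - a)))"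
  proof -
    have "(\<Sum>k<N. (X (Suc k) - X k) - a) = (\<Sum>k<N. X (Suc k) - X k) - N * a"
      by (subst sum_subtractf) simp
    also have "(\<Sum>k<N. X (Suc k) - X k) = X N - X 0" by (rule sum_lessThan_telescope)
    also have "X N - X 0 - N * a = pi" using per[of 0] N by (simp add: a_def)
    finally have S: "(\<Sum>k<N. (X (Suc k) - X k) - a) = pi" .
    show ?thesis by (simp only: sum_distrib_left[symmetric] S)
  qed
  also have "\<dots> \<le> (\<Sum>k<N. integral {X k..X (Suc k)} v)"
  proof (rule sum_mono)
    fix k
    have "gap_const / 12 * (a powr (- s) * ((X (Suc k) - X k) - a)) \<le> gap_const / 12 * (X (Suc k) - X k) powr (1 - s)"
      using powr_ge[of "X (Suc k) - X k"] mono[of k] gap_const_pos by (intro mult_left_mono) auto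
    also have "\<dots> \<le> integral {X k..X (Suc k)} v" by (rule gap_integral)
    finally show "gap_const / 12 * (a powr (- s) * ((X (Suc k) - X k) - a)) \<le> integral {X k..X (Suc k)} v" .
  qed
  also have "\<dots> = 2 * pi * B - N * chord_integral s (2 * pi)" by (simp only: tele tot)
  finally have "N * chord_integral s (2 * pi) + gap_const / 12 * (a powr (- s) * pi) \<le> 2 * pi * B" by linarith
  then have "(N * chord_integral s (2 * pi) + gap_const / 12 * (a powr (- s) * pi)) / (2 * pi) \<le> B"
    by (simp add: divide_le_eq mult.commute)
  moreover have "a powr (- s) = pi powr (- s) * real N powr s"
  proof -
    have "(pi / real N) powr (- s) = pi powr (- s) / real N powr (- s)" by (rule powr_divide)
    then show ?thesis by (simp only: a_def powr_minus divide_inverse inverse_inverse_eq)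
  qed
  ultimately show ?thesis by (simp add: add_divide_distrib mult_ac)
qed

end

lemma polarization_upper_bound:
  assumes s: "-2 < s" "s < -1"
  obtains c where "c > 0" "\<And>N \<omega>. N \<ge> 1 \<Longrightarrow> \<omega> \<in> {1..N} \<rightarrow> S1 \<Longrightarrow>
    polarization (riesz_kernel s) N \<omega> \<le> ereal (riesz_energy s * real N - c * real N powr s)"
proof -
  define c where "c = s * (s + 1) * (s + 2) / 8 / 12 ^ 4 / 24 * pi powr (- s)"
  have "s * (s + 1) > 0" using s by (intro mult_neg_neg) auto
  then have "c > 0" unfolding c_def using s by simp
  moreover have "polarization (riesz_kernel s) N \<omega> \<le> ereal (riesz_energy s * real N - c * real N powr s)"
    if N: "N \<ge> 1" and \<omega>: "\<omega> \<in> {1..N} \<rightarrow> S1" for N \<omega>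
  proof -
    obtain X where mono: "\<And>k. X k \<le> X (Suc k)" and per: "\<And>k. X (k + N) = X k + 2 * pi"
      and sumX: "\<And>m (g :: real ^ 2 \<Rightarrow> ereal). (\<Sum>j=1..N. g (\<omega> j)) = (\<Sum>j<N. g (circ (X (m + j))))"
      by (rule sorted_lift[OF \<omega> N, where ?'a = ereal]) (use that in blast)
    let ?F = "\<lambda>t. \<Sum>j<N. pchord s (t - X j)"
    have U: "(\<Sum>j=1..N. riesz_kernel s (circ t) (\<omega> j)) = ereal (- ?F t)" for t
      using sumX[of "riesz_kernel s (circ t)" 0] s
      by (simp add: riesz_kernel_neg norm_circ_powr sum_negf)
    obtain x where x: "x \<in> S1" "polarization (riesz_kernel s) N \<omega> = (\<Sum>j=1..N. riesz_kernel s x (\<omega> j))"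
      and min: "\<And>y. y \<in> S1 \<Longrightarrow> polarization (riesz_kernel s) N \<omega> \<le> (\<Sum>j=1..N. riesz_kernel s y (\<omega> j))"
      using polarization_attained[of s N \<omega>] by blast
    obtain t0 where t0: "x = circ t0" using S1_circE[OF x(1)] by blast
    have P: "polarization (riesz_kernel s) N \<omega> = ereal (- ?F t0)" unfolding x(2) t0 by (rule U)
    \<comment> \<open>A minimum of the potential is a maximum of \<open>?F\<close>, so its value can
      serve as the bound \<open>B\<close>.\<close>
    have le: "?F t \<le> ?F t0" for t using min[OF circ_in_S1, of t] unfolding P U by simp
    interpret gap_configuration s N X "?F t0"
      by unfold_locales (fact s N mono per le)+
    show ?thesis
      using bound_ge riesz_energy_eq[of s] s unfolding P by (simp add: c_def gap_const_def)
  qed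
  ultimately show thesis by (rule that)
qed

theorem corollary2p1:
  "(\<forall>s::real. -1 \<le> s \<and> s < 1 \<and> s \<noteq> 0 \<longrightarrow>
      (\<exists>R :: nat \<Rightarrow> real. R \<in> O(\<lambda>N. real N powr (s - 2)) \<and>
         (\<forall>\<^sub>F N in sequentially.
            max_polarization (riesz_kernel s) N =
              ereal (riesz_energy s * real N
                + 2 * sgn s * (2 powr s - 1) / (2 * pi) powr s
                    * Re (riemann_zeta (of_real s)) * real N powr s
                + R N))))
   \<and> (\<forall>N::nat. N \<ge> 1 \<longrightarrow> max_polarization (riesz_kernel 0) N = ereal (- ln 2))
   \<and> (\<forall>s::real. -2 < s \<and> s < -1 \<longrightarrow>
      (\<exists>b c :: real. b > 0 \<and> c > 0 \<and>
         (\<forall>\<^sub>F N in sequentially.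
            ereal (riesz_energy s * real N - b * real N powr s)
              \<le> max_polarization (riesz_kernel s) N \<and>
            max_polarization (riesz_kernel s) N
              \<le> ereal (riesz_energy s * real N - c * real N powr s))))"
proof (intro conjI allI impI, goal_cases)
  case (1 s)
  then show ?case by (intro max_polarization_asymptotics) auto
next
  case (2 N)
  then show ?case by (rule max_polarization_log)
next
  case s: (3 s)
  obtain b where b: "b > 0" "\<And>N. N \<ge> 3 \<Longrightarrow>
      ereal (riesz_energy s * real N - b * real N powr s) \<le> max_polarization (riesz_kernel s) N"
    using polarization_equally_spaced_ge[of s] s by blast
  obtain c where c: "c > 0" "\<And>N \<omega>. N \<ge> 1 \<Longrightarrow> \<omega> \<in> {1..N} \<rightarrow> S1 \<Longrightarrow>
      polarization (riesz_kernel s) N \<omega> \<le> ereal (riesz_energy s * real N - c * real N powr s)"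
    using polarization_upper_bound[of s] s by blast
  have upper: "max_polarization (riesz_kernel s) N \<le> ereal (riesz_energy s * real N - c * real N powr s)"
    if N: "N \<ge> 1" for N
  proof -
    have "s < 0" using s by simp
    then obtain \<omega> where "\<omega> \<in> {1..N} \<rightarrow> S1" "max_polarization (riesz_kernel s) N = polarization (riesz_kernel s) N \<omega>"
      using max_polarization_attained[of s N] by blast
    then show ?thesis using c(2)[OF N] by simp
  qed
  have "\<forall>\<^sub>F N in sequentially.
            ereal (riesz_energy s * real N - b * real N powr s)
              \<le> max_polarization (riesz_kernel s) N \<and>
            max_polarization (riesz_kernel s) N
              \<le> ereal (riesz_energy s * real N - c * real N powr s)"
    using eventually_ge_at_top[of 3] by eventually_elim (use b(2) upper in auto)
  with b(1) c(1) show ?case by blast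
qed

end
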